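(* Let $N=2$, $k>0$ and $V_k(r)=\dfrac{1}{r^2(-\log(r/e))^{2+k}}$. Let $p_s:=k+1$, $$p^-_{\mathrm{JL}}:=1+\frac{2k}{1-k+\sqrt{k(k+2)}},\qquad p^+_{\mathrm{JL}}:=\begin{cases}1+\dfrac{2k}{1-k-\sqrt{k(k+2)}}& k<\frac14,\\ \infty& k\ge\frac14.\end{cases}$$ (i) When $f(u)=e^u$ and $(\lambda_*,U_* )=(k,\,k\log(-\log(r/e)))$, we have $m(U_* )=0$ for $k\le\frac14$ and $m(U_* )=\infty$ for $k>\frac14$. (ii) When $f(u)=(1+u)^p$ with $p>p_s$ and $(\lambda_*,U_* )=\bigl(\frac{k}{p-1}(1-\frac{k}{p-1}),\ (-\log(r/e))^{\frac{k}{p-1}}-1\bigr)$, we have $m(U_* )=0$ for $p\le p^-_{\mathrm{JL}}$ or $p\ge p^+_{\mathrm{JL}}$, and $m(U_* )=\infty$ for $p^-_{\mathrm{JL}}<p<p^+_{\mathrm{JL}}$.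
   Context: $B_1\subset\mathbb{R}^2$ is the open unit ball, $r=|x|$. The pair $(\lambda_*,U_* )$ is a radial singular solution of $-\Delta u=\lambda V_k(|x|)f(u)$ in $B_1$, $u>0$ in $B_1$, $u=0$ on $\partial B_1$. Define $$Q_{U_*}(\xi):=\int_{B_1}|\nabla\xi|^2\,dx-\int_{B_1}\lambda_*V_k(|x|)f'(U_* )\xi^2\,dx.$$ The Morse index $m(U_* )\in\{0,1,2,\dots\}\cup\{\infty\}$ is the maximal dimension of a linear subspace $X\subset H^1_0(B_1)$ such that $Q_{U_*}(\xi)<0$ for all $\xi\in X\setminus\{0\}$. *)

theory Defs
  imports "HOL-Analysis.Analysis" "HOL-Library.Extended_Nat"
begin

section \<open>The space $L^2$ of the open unit ball\<close>

abbreviation ball_measure :: "'a::euclidean_space measure"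
  where "ball_measure \<equiv> lebesgue_on (ball 0 1)"

definition square_integrable :: "('a::euclidean_space \<Rightarrow> 'b::euclidean_space) \<Rightarrow> bool"
  where "square_integrable f \<longleftrightarrow>
    f \<in> borel_measurable ball_measure \<and> integrable ball_measure (\<lambda>x. (norm (f x))\<^sup>2)"

definition l2_rel :: "('a::euclidean_space \<Rightarrow> real) \<Rightarrow> ('a \<Rightarrow> real) \<Rightarrow> bool"
  where "l2_rel f g \<longleftrightarrow>
    square_integrable f \<and> square_integrable g \<and> (AE x in ball_measure. f x = g x)"

lemma square_integrable_zero: "square_integrable (\<lambda>_. 0)"
  by (simp add: square_integrable_def)

lemma square_integrable_add:
  fixes f g :: "'a::euclidean_space \<Rightarrow> 'b::euclidean_space"
  assumes "square_integrable f" "square_integrable g"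
  shows "square_integrable (\<lambda>x. f x + g x)"
proof -
  have m: "f \<in> borel_measurable ball_measure" "g \<in> borel_measurable ball_measure"
    and i: "integrable ball_measure (\<lambda>x. (norm (f x))\<^sup>2)"
      "integrable ball_measure (\<lambda>x. (norm (g x))\<^sup>2)"
    using assms by (auto simp: square_integrable_def)
  have bound: "(norm (a + b))\<^sup>2 \<le> 2 * (norm a)\<^sup>2 + 2 * (norm b)\<^sup>2" for a b :: 'b
  proof -
    have "(norm (a + b))\<^sup>2 \<le> (norm a + norm b)\<^sup>2"
      by (simp add: norm_triangle_ineq power_mono)
    also have "\<dots> \<le> 2 * (norm a)\<^sup>2 + 2 * (norm b)\<^sup>2"
      using sum_squares_bound[of "norm a" "norm b"] by (simp add: power2_sum)
    finally show ?thesis .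
  qed
  have "integrable ball_measure (\<lambda>x. (norm (f x + g x))\<^sup>2)"
  proof (rule Bochner_Integration.integrable_bound)
    show "integrable ball_measure (\<lambda>x. 2 * (norm (f x))\<^sup>2 + 2 * (norm (g x))\<^sup>2)"
      using i by auto
    show "(\<lambda>x. (norm (f x + g x))\<^sup>2) \<in> borel_measurable ball_measure"
      using m by measurable
    show "AE x in ball_measure. norm ((norm (f x + g x))\<^sup>2)
        \<le> norm (2 * (norm (f x))\<^sup>2 + 2 * (norm (g x))\<^sup>2)"
      using bound by (intro AE_I2) (auto intro: order_trans[OF bound])
  qed
  with m show ?thesis by (auto simp: square_integrable_def)
qed

lemma square_integrable_scaleR:
  assumes "square_integrable f"
  shows "square_integrable (\<lambda>x. c *\<^sub>R f x)"
  using assms by (auto simp: square_integrable_def power_mult_distrib)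

quotient_type (overloaded) 'a l2_ball = "'a::euclidean_space \<Rightarrow> real" / partial: l2_rel
proof (rule part_equivpI)
  show "\<exists>f. l2_rel f f"
    by (rule exI[of _ "\<lambda>_. 0"]) (simp add: l2_rel_def square_integrable_zero)
  show "symp l2_rel"
    by (rule sympI) (auto simp: l2_rel_def elim: eventually_mono)
  show "transp l2_rel"
    by (rule transpI) (auto simp: l2_rel_def elim: eventually_elim2)
qed

instantiation l2_ball :: (euclidean_space) real_vector
begin

lift_definition zero_l2_ball :: "'a l2_ball" is "\<lambda>_. 0"
  by (simp add: l2_rel_def square_integrable_zero)

lift_definition plus_l2_ball :: "'a l2_ball \<Rightarrow> 'a l2_ball \<Rightarrow> 'a l2_ball"
  is "\<lambda>f g x. f x + g x"
  by (auto simp: l2_rel_def intro: square_integrable_add elim: eventually_elim2)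

lift_definition scaleR_l2_ball :: "real \<Rightarrow> 'a l2_ball \<Rightarrow> 'a l2_ball"
  is "\<lambda>c f x. c *\<^sub>R f x"
  using square_integrable_scaleR
  by (fastforce simp: l2_rel_def elim: eventually_mono)

definition uminus_l2_ball :: "'a l2_ball \<Rightarrow> 'a l2_ball"
  where "uminus_l2_ball u = (-1) *\<^sub>R u"

definition minus_l2_ball :: "'a l2_ball \<Rightarrow> 'a l2_ball \<Rightarrow> 'a l2_ball"
  where "minus_l2_ball u v = u + (-1) *\<^sub>R v"

instance
proof
  fix u v w :: "'a l2_ball" and a b :: real
  show "u + v + w = u + (v + w)"
    by transfer (auto simp: l2_rel_def add.assoc intro!: square_integrable_add)
  show "u + v = v + u"
    by transfer (auto simp: l2_rel_def add.commute intro!: square_integrable_add)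
  show "0 + u = u"
    by transfer (auto simp: l2_rel_def)
  show "- u + u = 0"
    unfolding uminus_l2_ball_def
    by transfer (auto simp: l2_rel_def square_integrable_zero)
  show "u - v = u + - v"
    by (simp add: uminus_l2_ball_def minus_l2_ball_def)
  show "a *\<^sub>R (u + v) = a *\<^sub>R u + a *\<^sub>R v"
    by transfer (use square_integrable_scaleR square_integrable_add in
      \<open>fastforce simp: l2_rel_def distrib_left\<close>)
  show "(a + b) *\<^sub>R u = a *\<^sub>R u + b *\<^sub>R u"
    by transfer (use square_integrable_scaleR square_integrable_add in
      \<open>fastforce simp: l2_rel_def distrib_right\<close>)
  show "a *\<^sub>R b *\<^sub>R u = (a * b) *\<^sub>R u"
    by transfer (use square_integrable_scaleR in \<open>fastforce simp: l2_rel_def mult.assoc\<close>)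
  show "1 *\<^sub>R u = u"
    by transfer (auto simp: l2_rel_def)
qed

end

abbreviation l2_repr :: "'a::euclidean_space l2_ball \<Rightarrow> 'a \<Rightarrow> real"
  where "l2_repr \<equiv> rep_l2_ball"

abbreviation l2_class :: "('a::euclidean_space \<Rightarrow> real) \<Rightarrow> 'a l2_ball"
  where "l2_class \<equiv> abs_l2_ball"


section \<open>The Sobolev spaces $H^1$ and $H^1_0$ of the open unit ball\<close>

primrec C_k :: "nat \<Rightarrow> ('a::euclidean_space \<Rightarrow> real) \<Rightarrow> bool" where
  "C_k 0 f \<longleftrightarrow> continuous_on UNIV f"
| "C_k (Suc n) f \<longleftrightarrow>
     f differentiable_on UNIV \<and> (\<forall>b\<in>Basis. C_k n (\<lambda>x. frechet_derivative f (at x) b))"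

definition test_functions :: "('a::euclidean_space \<Rightarrow> real) set"
  where "test_functions =
    {\<phi>. (\<forall>n. C_k n \<phi>) \<and> compact (closure {x. \<phi> x \<noteq> 0}) \<and> closure {x. \<phi> x \<noteq> 0} \<subseteq> ball 0 1}"

definition has_weak_gradient :: "'a::euclidean_space l2_ball \<Rightarrow> ('a \<Rightarrow> 'a) \<Rightarrow> bool"
  where "has_weak_gradient u g \<longleftrightarrow> square_integrable g \<and>
    (\<forall>\<phi>\<in>test_functions. \<forall>b\<in>Basis.
      (\<integral>x. l2_repr u x * frechet_derivative \<phi> (at x) b \<partial>ball_measure)
        = - (\<integral>x. (g x \<bullet> b) * \<phi> x \<partial>ball_measure))"

definition H1 :: "'a::euclidean_space l2_ball set"
  where "H1 = {u. \<exists>g. has_weak_gradient u g}"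

text \<open>A weak gradient is unique up to a null set, so the choice does not affect integrals.\<close>

definition weak_gradient :: "'a::euclidean_space l2_ball \<Rightarrow> 'a \<Rightarrow> 'a"
  where "weak_gradient u = (SOME g. has_weak_gradient u g)"

definition H1_norm :: "'a::euclidean_space l2_ball \<Rightarrow> real"
  where "H1_norm u = sqrt ((\<integral>x. (l2_repr u x)\<^sup>2 \<partial>ball_measure)
    + (\<integral>x. (norm (weak_gradient u x))\<^sup>2 \<partial>ball_measure))"

definition H10 :: "'a::euclidean_space l2_ball set"
  where "H10 = {u \<in> H1. \<forall>\<epsilon>>0. \<exists>\<phi>\<in>test_functions. H1_norm (u - l2_class \<phi>) < \<epsilon>}"


section \<open>Quadratic form and Morse index\<close>

text \<open>
  The form of the linearization of $-\Delta u = l V(|x|) f(u)$ at \<open>U\<close>.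
  A Bochner integral of a non-integrable function is 0; this never happens for the potentials
  considered below, which are constant multiples of $|x|^{-2}(1 - \log |x|)^{-2}$: by Hardy's
  inequality they are integrable against $\xi^2$ for every $\xi \in H^1_0$.
\<close>

definition quadratic_form ::
    "real \<Rightarrow> (real \<Rightarrow> real) \<Rightarrow> (real \<Rightarrow> real) \<Rightarrow> ('a::euclidean_space \<Rightarrow> real) \<Rightarrow> 'a l2_ball \<Rightarrow> real"
  where "quadratic_form l V f U \<xi> =
    (\<integral>x. (norm (weak_gradient \<xi> x))\<^sup>2 \<partial>ball_measure)
      - (\<integral>x. l * V (norm x) * deriv f (U x) * (l2_repr \<xi> x)\<^sup>2 \<partial>ball_measure)"

definition edim :: "'v::real_vector set \<Rightarrow> enat"
  where "edim X = (if \<exists>B. finite B \<and> X \<subseteq> span B then enat (dim X) else \<infinity>)"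

definition morse_index ::
    "real \<Rightarrow> (real \<Rightarrow> real) \<Rightarrow> (real \<Rightarrow> real) \<Rightarrow> ('a::euclidean_space \<Rightarrow> real) \<Rightarrow> enat"
  where "morse_index l V f U =
    (SUP X \<in> {X. subspace X \<and> X \<subseteq> H10 \<and> (\<forall>\<xi>\<in>X - {0}. quadratic_form l V f U \<xi> < 0)}. edim X)"


section \<open>Weight and critical exponents\<close>

definition V_weight :: "real \<Rightarrow> real \<Rightarrow> real"
  where "V_weight k r = 1 / (r\<^sup>2 * (- ln (r / exp 1)) powr (2 + k))"

definition p_s :: "real \<Rightarrow> real"
  where "p_s k = k + 1"

definition p_JL_minus :: "real \<Rightarrow> real"
  where "p_JL_minus k = 1 + 2 * k / (1 - k + sqrt (k * (k + 2)))"

definition p_JL_plus :: "real \<Rightarrow> ereal"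
  where "p_JL_plus k =
    (if k < 1/4 then ereal (1 + 2 * k / (1 - k - sqrt (k * (k + 2)))) else \<infinity>)"

end

theory Submission
  imports Defs "HOL-Computational_Algebra.Polynomial"
begin

text \<open>
  Both potentials equal \<open>c / (|x|\<^sup>2 (1 - ln |x|)\<^sup>2)\<close>, with \<open>c = k\<close> in the exponential case and
  \<open>c = (\<alpha> + k) (1 - \<alpha>)\<close>, \<open>\<alpha> = k / (p - 1)\<close>, in the power case; the condition \<open>c \<le> 1/4\<close> is a quadratic
  inequality in \<open>\<alpha>\<close> whose roots give the Joseph--Lundgren exponents. The constant \<open>1/4\<close> is that of the
  two-dimensional critical Hardy inequality, so \<open>c \<le> 1/4\<close> makes the form nonnegative on \<open>H\<^sup>1\<^sub>0\<close>. For
  \<open>c > 1/4\<close>, put \<open>t = ln (1 - ln |x|)\<close>: the functions \<open>exp (t/2) \<chi> (t/L - j)\<close>, \<open>j = 1, 2, \<dots>\<close>, for a bump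
  \<open>\<chi>\<close> on \<open>(0,1)\<close> with \<open>\<chi>'' \<ge> - C \<chi>\<close> and large \<open>L\<close>, have disjoint supports and span spaces on which the
  form is negative.
\<close>

section \<open>Smooth functions\<close>

text \<open>Four obstacles shape the proof. Test functions need not vanish at the origin, where the
  Hardy weight is singular, so Hardy's inequality is proved with |x|^2 regularised to |x|^2 +
  \<epsilon>, and only afterwards does \<epsilon> tend to 0. The trial functions are given by
  formulas that make sense only off the origin, so smoothness is treated on open sets and glued.
  Weak gradients and L^2 representatives are arbitrary choices, so they have to be unique up to null
  sets before explicit functions can enter the form. Finally, polar coordinates are avoided: each
  radial computation is a divergence identity for a compactly supported field, and dimension two
  enters only as the trace of the identity. The factor exp (t/2) is the square root of s = 1 - ln
  |x|, which solves - u'' = u / (4 s^2), the radial equation at the critical constant. Dividing it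
  out leaves X'' + (c - 1/4) X, so for c > 1/4 a slowly varying profile X is enough.\<close>

primrec Ck_on :: "nat \<Rightarrow> 'a::euclidean_space set \<Rightarrow> ('a \<Rightarrow> real) \<Rightarrow> bool" where
  "Ck_on 0 S f \<longleftrightarrow> continuous_on S f"
| "Ck_on (Suc n) S f \<longleftrightarrow>
     (\<forall>x\<in>S. f differentiable at x) \<and>
     (\<forall>b\<in>Basis. Ck_on n S (\<lambda>x. frechet_derivative f (at x) b))"

lemma C_k_iff_Ck_on: "C_k n f \<longleftrightarrow> Ck_on n UNIV f"
  by (induction n arbitrary: f) (auto simp: differentiable_on_def)

text \<open>Openness of \<open>S\<close> makes the derivatives of \<open>f\<close> and
  \<open>g\<close> agree at every point of \<open>S\<close>, so the agreement passes to the next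
  level of the induction.\<close>

lemma Ck_on_cong:
  assumes "open S" "\<And>x. x \<in> S \<Longrightarrow> f x = g x" "Ck_on n S f"
  shows "Ck_on n S g"
  using assms(2,3)
proof (induction n arbitrary: f g)
  case 0
  then show ?case
    by (metis Ck_on.simps(1) continuous_on_cong)
next
  case (Suc n)
  have d: "(g has_derivative frechet_derivative f (at x)) (at x)" if "x \<in> S" for x
  proof (rule has_derivative_transform_within_open)
    show "(f has_derivative frechet_derivative f (at x)) (at x)"
      using Suc.prems that by (auto simp: frechet_derivative_works)
  qed (use assms(1) that Suc.prems in auto)
  then have eq: "frechet_derivative f (at x) = frechet_derivative g (at x)" if "x \<in> S" for x
    using that frechet_derivative_at by blast
  show ?case
  proof (simp, intro conjI ballI)
    show "g differentiable at x" if "x \<in> S" for x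
      using d that differentiable_def by blast
    show "Ck_on n S (\<lambda>x. frechet_derivative g (at x) b)" if "b \<in> Basis" for b
      by (rule Suc.IH[of "\<lambda>x. frechet_derivative f (at x) b"]) (use Suc.prems eq that in auto)
  qed
qed

text \<open>\<open>frechet_derivative\<close> is defined by choice. This rule trades it for an
  explicit formula, so that the closure properties reduce to the usual rules for
  derivatives.\<close>

lemma Ck_on_Suc_I:
  assumes "open S" "\<And>x. x \<in> S \<Longrightarrow> (f has_derivative f' x) (at x)"
    and "\<And>b. b \<in> Basis \<Longrightarrow> Ck_on n S (\<lambda>x. f' x b)"
  shows "Ck_on (Suc n) S f"
proof (simp, intro conjI ballI)
  show "f differentiable at x" if "x \<in> S" for x
    using assms(2) that differentiable_def by blast
  show "Ck_on n S (\<lambda>x. frechet_derivative f (at x) b)" if "b \<in> Basis" for b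
    by (rule Ck_on_cong[OF assms(1) _ assms(3)[OF that]]) (simp add: frechet_derivative_at[OF assms(2), symmetric])
qed

lemma Ck_on_SucD:
  assumes "Ck_on (Suc n) S f" "x \<in> S"
  shows "(f has_derivative frechet_derivative f (at x)) (at x)"
  using assms by (auto simp: frechet_derivative_works)

lemma Ck_on_Suc_imp: "Ck_on (Suc n) S f \<Longrightarrow> Ck_on n S f"
  by (induction n arbitrary: f) (auto intro!: continuous_at_imp_continuous_on differentiable_imp_continuous_within)

text \<open>Smoothness is local. The gluing serves the trial functions, which are given by a formula
  on the punctured ball and vanish off a compact annulus.\<close>

lemma Ck_on_Un:
  assumes "open S" "open T" "Ck_on n S f" "Ck_on n T f"
  shows "Ck_on n (S \<union> T) f"
  using assms(3,4)
  by (induction n arbitrary: f) (auto intro: continuous_on_open_Un assms)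

lemma Ck_on_const: "open S \<Longrightarrow> Ck_on n S (\<lambda>_. c)"
proof (induction n arbitrary: c)
  case (Suc n)
  then show ?case
    by (intro Ck_on_Suc_I[where f' = "\<lambda>_ _. 0"]) auto
qed auto

lemma Ck_on_add:
  assumes "open S" "Ck_on n S f" "Ck_on n S g"
  shows "Ck_on n S (\<lambda>x. f x + g x)"
  using assms(2,3)
proof (induction n arbitrary: f g)
  case (Suc n)
  show ?case
  proof (rule Ck_on_Suc_I[OF assms(1)], rule has_derivative_add)
    fix b :: 'a assume "b \<in> Basis"
    then show "Ck_on n S (\<lambda>x. frechet_derivative f (at x) b + frechet_derivative g (at x) b)"
      using Suc.prems by (intro Suc.IH) auto
  qed (erule Ck_on_SucD[OF Suc.prems(1)] Ck_on_SucD[OF Suc.prems(2)])+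
qed (auto intro: continuous_intros)

lemma Ck_on_mult:
  assumes "open S" "Ck_on n S f" "Ck_on n S g"
  shows "Ck_on n S (\<lambda>x. f x * g x)"
  using assms(2,3)
proof (induction n arbitrary: f g)
  case (Suc n)
  show ?case
  proof (rule Ck_on_Suc_I[OF assms(1)], rule has_derivative_mult)
    fix b :: 'a assume "b \<in> Basis"
    then show "Ck_on n S (\<lambda>x. f x * frechet_derivative g (at x) b + frechet_derivative f (at x) b * g x)"
      using Suc.prems Ck_on_Suc_imp[of n S f] Ck_on_Suc_imp[of n S g]
      by (intro Ck_on_add assms(1) Suc.IH) auto
  qed (erule Ck_on_SucD[OF Suc.prems(1)] Ck_on_SucD[OF Suc.prems(2)])+
qed (auto intro: continuous_intros)

text \<open>\<open>G\<close> lists all derivatives of the outer function. Differentiating the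
  composition at index \<open>i\<close> gives a derivative of \<open>f\<close> times the composition
  at index \<open>Suc i\<close>, so induction on \<open>n\<close> with \<open>i\<close> arbitrary
  replaces a higher-order chain rule.\<close>

lemma Ck_on_compose:
  fixes G :: "nat \<Rightarrow> real \<Rightarrow> real"
  assumes "open S" "Ck_on n S f" "\<And>x. x \<in> S \<Longrightarrow> f x \<in> I"
    and G: "\<And>i y. y \<in> I \<Longrightarrow> (G i has_real_derivative G (Suc i) y) (at y)"
  shows "Ck_on n S (\<lambda>x. G i (f x))"
  using assms(2)
proof (induction n arbitrary: i)
  case 0
  have "continuous_on I (G i)"
    using G by (intro continuous_at_imp_continuous_on) (auto intro: DERIV_isCont)
  with 0 show ?case
    using assms(3) by (auto intro: continuous_on_compose2)
next
  case (Suc n)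
  show ?case
  proof (rule Ck_on_Suc_I[OF assms(1)])
    fix x assume x: "x \<in> S"
    have "(G i has_derivative (\<lambda>h. h * G (Suc i) (f x))) (at (f x))"
      using G[OF assms(3)[OF x], of i] by (simp add: has_field_derivative_def mult_commute_abs)
    from has_derivative_compose[OF Ck_on_SucD[OF Suc.prems x] this]
    show "((\<lambda>x. G i (f x)) has_derivative (\<lambda>h. frechet_derivative f (at x) h * G (Suc i) (f x))) (at x)" .
  next
    fix b :: 'a assume "b \<in> Basis"
    then show "Ck_on n S (\<lambda>x. frechet_derivative f (at x) b * G (Suc i) (f x))"
      using Suc.prems Ck_on_Suc_imp[of n S f] by (intro Ck_on_mult assms(1) Suc.IH) auto
  qed
qed

lemma Ck_on_inner_left: "open S \<Longrightarrow> Ck_on n S (\<lambda>x. x \<bullet> a)"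
proof (cases n)
  case (Suc m)
  assume S: "open S"
  show ?thesis unfolding Suc
  proof (rule Ck_on_Suc_I[OF S])
    show "((\<lambda>x. x \<bullet> a) has_derivative (\<lambda>h. h \<bullet> a)) (at x)" for x :: 'a
      by (auto intro!: derivative_eq_intros)
  qed (intro Ck_on_const[OF S])
qed (auto intro: continuous_intros)

lemma Ck_on_inner_self: "open S \<Longrightarrow> Ck_on n S (\<lambda>x. x \<bullet> x)"
proof (cases n)
  case (Suc m)
  assume S: "open S"
  show ?thesis unfolding Suc
  proof (rule Ck_on_Suc_I[OF S])
    show "((\<lambda>x. x \<bullet> x) has_derivative (\<lambda>h. 2 * (x \<bullet> h))) (at x)" for x :: 'a
      by (auto intro!: derivative_eq_intros simp: inner_commute)
  qed (intro Ck_on_mult[OF S] Ck_on_const[OF S] Ck_on_inner_left[OF S])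
qed (auto intro: continuous_intros)

lemma Ck_on_exp: "open S \<Longrightarrow> Ck_on n S f \<Longrightarrow> Ck_on n S (\<lambda>x. exp (f x))"
  by (rule Ck_on_compose[where G = "\<lambda>_. exp" and I = UNIV]) (auto intro: DERIV_exp)

lemma Ck_on_ln:
  assumes "open S" "Ck_on n S f" "\<And>x. x \<in> S \<Longrightarrow> f x > 0"
  shows "Ck_on n S (\<lambda>x. ln (f x))"
proof -
  \<comment> \<open>Index 0 is the logarithm; index i + 1 is its derivative of order i + 1, namely
    (-1)^i i! / y^(i+1).\<close>
  define G :: "nat \<Rightarrow> real \<Rightarrow> real" where
    "G = rec_nat ln (\<lambda>i _ y. (-1) ^ i * fact i / y ^ Suc i)"
  have "(G i has_real_derivative G (Suc i) y) (at y)" if "y > 0" for i y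
  proof (cases i)
    case 0
    then show ?thesis using that by (auto simp: G_def intro!: derivative_eq_intros)
  next
    case (Suc m)
    then show ?thesis using that
      by (auto simp: G_def intro!: derivative_eq_intros simp: divide_simps)
        (cases m; simp add: algebra_simps)
  qed
  then have "Ck_on n S (\<lambda>x. G 0 (f x))"
    by (intro Ck_on_compose[where I = "{0<..}" and G = G] assms) (use assms(3) in auto)
  then show ?thesis by (simp add: G_def)
qed

section \<open>A smooth function on the line that is positive exactly on the positive
  half-line\<close>

definition flat_exp :: "real \<Rightarrow> real"
  where "flat_exp y = (if y > 0 then exp (- 1 / y) else 0)"

lemma poly_exp_minus_tendsto_0: "((\<lambda>t. poly p t * exp (- t)) \<longlongrightarrow> (0::real)) at_top"
proof -
  have "((\<lambda>t::real. \<Sum>i\<le>degree p. coeff p i * (t ^ i / exp t)) \<longlongrightarrow> (\<Sum>i\<le>degree p. coeff p i * 0)) at_top"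
    by (intro tendsto_intros tendsto_power_div_exp_0)
  then show ?thesis
    by (simp add: poly_altdef exp_minus sum_divide_distrib divide_inverse[symmetric])
qed

text \<open>With t = 1/y one has d/dy = - t^2 d/dt, so p(t) exp (-t) becomes t^2 (p - p')(t) exp
  (-t). Polynomials in 1/y times exp (-1/y) are thus closed under differentiation, and iteration
  yields all derivatives of \<open>flat_exp\<close>.\<close>

lemma flat_poly_DERIV:
  fixes p :: "real poly"
  defines "Q \<equiv> \<lambda>p y. if y > 0 then poly p (1 / y) * exp (- 1 / y) else 0"
  shows "(Q p has_real_derivative Q ([:0, 0, 1:] * (p - pderiv p)) y) (at y)"
proof (cases y "0::real" rule: linorder_cases)
  case less
  have "((\<lambda>_. 0) has_real_derivative 0) (at y)" by simp
  then have "(Q p has_real_derivative 0) (at y)"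
    by (rule has_field_derivative_transform_within_open[where S = "{..<0}"]) (use less in \<open>auto simp: Q_def\<close>)
  then show ?thesis using less by (simp add: Q_def)
next
  case equal
  have "((\<lambda>h. Q p h / h) \<longlongrightarrow> 0) (at_right 0)"
  proof -
    have "filterlim (\<lambda>h::real. 1 / h) at_top (at_right 0)"
      using filterlim_inverse_at_top_right by (simp add: inverse_eq_divide)
    \<comment> \<open>The quotient \<open>Q p h / h\<close> is t p(t) exp (-t) at t = 1/h; the extra
      factor t is the polynomial \<open>[:0, 1:]\<close>.\<close>
    from filterlim_compose[OF poly_exp_minus_tendsto_0[of "[:0, 1:] * p"] this]
    show ?thesis
      by (rule Lim_transform_eventually)
        (auto simp: Q_def eventually_at_filter)
  qed
  moreover have "((\<lambda>h. Q p h / h) \<longlongrightarrow> 0) (at_left 0)"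
    by (rule Lim_transform_eventually[OF tendsto_const]) (auto simp: Q_def eventually_at_filter)
  ultimately have "((\<lambda>h. Q p h / h) \<longlongrightarrow> 0) (at 0)"
    by (simp add: filterlim_split_at)
  then show ?thesis
    using equal by (simp add: Q_def has_field_derivative_iff)
next
  case greater
  have "((\<lambda>y. poly p (1 / y) * exp (- 1 / y)) has_real_derivative
      Q ([:0, 0, 1:] * (p - pderiv p)) y) (at y)"
    using greater
    by (auto intro!: derivative_eq_intros DERIV_chain2[OF poly_DERIV] simp: Q_def field_simps power2_eq_square)
  then show ?thesis
    by (rule has_field_derivative_transform_within_open[where S = "{0<..}"])
      (use greater in \<open>auto simp: Q_def\<close>)
qed

lemma Ck_on_flat_exp:
  assumes "open S" "Ck_on n S f"
  shows "Ck_on n S (\<lambda>x. flat_exp (f x))"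
proof -
  define P where "P = rec_nat (1 :: real poly) (\<lambda>_ p. [:0, 0, 1:] * (p - pderiv p))"
  define G where "G i y = (if y > 0 then poly (P i) (1 / y) * exp (- 1 / y) else 0)" for i :: nat and y :: real
  have "(G i has_real_derivative G (Suc i) y) (at y)" for i y
    using flat_poly_DERIV[of "P i" y] unfolding G_def P_def nat.rec .
  then have "Ck_on n S (\<lambda>x. G 0 (f x))"
    by (intro Ck_on_compose[where I = UNIV and G = G] assms UNIV_I)
  moreover have "G 0 = flat_exp"
    by (auto simp: G_def P_def flat_exp_def fun_eq_iff)
  ultimately show ?thesis by simp
qed

lemma flat_exp_range: "0 \<le> flat_exp y" "flat_exp y \<le> 1" "flat_exp y > 0 \<longleftrightarrow> y > 0"
  by (auto simp: flat_exp_def)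

lemma flat_exp_tendsto_1:
  assumes "filterlim g at_top F"
  shows "((\<lambda>n. flat_exp (g n)) \<longlongrightarrow> 1) F"
proof -
  have "((\<lambda>n. exp (- 1 / g n)) \<longlongrightarrow> exp 0) F"
    by (intro tendsto_intros real_tendsto_divide_at_top[OF tendsto_const assms])
  moreover have "eventually (\<lambda>n. g n > 0) F"
    using assms by (auto simp: filterlim_at_top_dense)
  ultimately show ?thesis
    by (auto intro: Lim_transform_eventually elim!: eventually_mono simp: flat_exp_def)
qed

section \<open>Integration by parts\<close>

lemma integrable_lborel_compact_support:
  fixes f :: "'a::euclidean_space \<Rightarrow> real"
  assumes "continuous_on UNIV f" "compact K" "\<And>x. x \<notin> K \<Longrightarrow> f x = 0"
  shows "integrable lborel f"
proof -
  have "integrable lborel (\<lambda>x. indicator K x *\<^sub>R f x)"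
    using assms by (intro borel_integrable_compact) (auto intro: continuous_on_subset)
  moreover have "(\<lambda>x. indicator K x *\<^sub>R f x) = f"
    using assms(3) by (auto simp: indicator_def fun_eq_iff)
  ultimately show ?thesis by simp
qed

lemma lborel_translate:
  fixes f :: "'a::euclidean_space \<Rightarrow> real"
  assumes "integrable lborel f"
  shows "integrable lborel (\<lambda>x. f (x + c))" "(\<integral>x. f (x + c) \<partial>lborel) = (\<integral>x. f x \<partial>lborel)"
proof -
  have "integrable (distr lborel borel ((+) c)) f"
    using assms by (simp add: lborel_distr_plus)
  then show "integrable lborel (\<lambda>x. f (x + c))"
    by (subst (asm) integrable_distr_eq) (use assms in \<open>auto simp: add.commute\<close>)
  have "(\<integral>x. f x \<partial>distr lborel borel ((+) c)) = (\<integral>x. f (c + x) \<partial>lborel)"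
    using assms by (intro integral_distr) auto
  then show "(\<integral>x. f (x + c) \<partial>lborel) = (\<integral>x. f x \<partial>lborel)"
    by (simp add: lborel_distr_plus add.commute)
qed

text \<open>Differentiates the integral of the translates of a compactly supported function.\<close>

lemma lborel_integral_derivative_eq_0:
  fixes f D :: "'a::euclidean_space \<Rightarrow> real"
  assumes K: "compact K" "\<And>x. x \<notin> K \<Longrightarrow> f x = 0" "\<And>x. x \<notin> K \<Longrightarrow> D x = 0"
    and cont: "continuous_on UNIV f" "continuous_on UNIV D"
    and deriv: "\<And>x t. ((\<lambda>t. f (x + t *\<^sub>R b)) has_real_derivative D (x + t *\<^sub>R b)) (at t)"
  shows "(\<integral>x. D x \<partial>lborel) = 0"
proof -
  define h :: "nat \<Rightarrow> real" where "h n = 1 / (real n + 1)" for n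
  have h: "0 < h n" "h n \<le> 1" for n by (auto simp: h_def)
  define q where "q n x = (f (x + h n *\<^sub>R b) - f x) / h n" for n x
  have int: "integrable lborel f"
    by (rule integrable_lborel_compact_support) (use K cont in auto)
  \<comment> \<open>Translation invariance of Lebesgue measure.\<close>
  have q0: "(\<integral>x. q n x \<partial>lborel) = 0" for n
    using lborel_translate[OF int, of "h n *\<^sub>R b"] int by (simp add: q_def)
  \<comment> \<open>The mean value theorem turns each difference quotient into a value of
    \<open>D\<close>, at a point shifted by at most |b| because h n \<le> 1. A bound for
    \<open>D\<close> and an enlarged ball then give one dominating function for all
    \<open>n\<close>.\<close>
  have q_mvt: "\<exists>t\<in>{0<..<1}. q n x = D (x + t *\<^sub>R b)" for n x
  proof -
    obtain t where t: "t > 0" "t < h n"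
      "f (x + h n *\<^sub>R b) - f (x + 0 *\<^sub>R b) = (h n - 0) * D (x + t *\<^sub>R b)"
      using MVT2[OF h(1), of n "\<lambda>t. f (x + t *\<^sub>R b)" "\<lambda>t. D (x + t *\<^sub>R b)"] deriv by blast
    then show ?thesis
      using h[of n] by (intro bexI[of _ t]) (auto simp: q_def)
  qed
  obtain M where M: "\<And>x. \<bar>D x\<bar> \<le> M"
  proof -
    have "bounded (D ` K)"
      by (intro compact_imp_bounded compact_continuous_image K) (use cont continuous_on_subset in auto)
    then obtain M where "\<And>x. x \<in> K \<Longrightarrow> \<bar>D x\<bar> \<le> M"
      by (auto simp: bounded_iff)
    then have "\<bar>D x\<bar> \<le> max M 0" for x
      using K(3)[of x] by (cases "x \<in> K") (auto simp: le_max_iff_disj)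
    then show ?thesis using that by blast
  qed
  obtain R where R: "\<And>x. x \<in> K \<Longrightarrow> norm x \<le> R"
    using compact_imp_bounded[OF K(1)] by (auto simp: bounded_iff)
  have bound: "\<bar>q n x\<bar> \<le> M * indicator (cball 0 (R + norm b)) x" for n x
  proof -
    obtain t where t: "0 < t" "t < 1" "q n x = D (x + t *\<^sub>R b)"
      using q_mvt[of n x] by auto
    show ?thesis
    proof (cases "x + t *\<^sub>R b \<in> K")
      case True
      have "norm x \<le> norm (x + t *\<^sub>R b) + norm (t *\<^sub>R b)"
        by (metis add_diff_cancel_right' norm_triangle_ineq4)
      also have "\<dots> \<le> R + norm b"
        using R[OF True] t by (intro add_mono) (auto intro: mult_left_le_one_le)
      finally show ?thesis using t M by (simp add: indicator_def)
    next
      case False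
      then show ?thesis
        using t K(3) M[of 0] by (auto simp: indicator_def)
    qed
  qed
  have "(\<lambda>n. \<integral>x. q n x \<partial>lborel) \<longlonglongrightarrow> (\<integral>x. D x \<partial>lborel)"
  proof (rule integral_dominated_convergence[where w = "\<lambda>x. M * indicator (cball 0 (R + norm b)) x"])
    show "AE x in lborel. (\<lambda>n. q n x) \<longlonglongrightarrow> D x"
    proof (rule AE_I2)
      fix x
      have "((\<lambda>t. (f (x + t *\<^sub>R b) - f x) / t) \<longlongrightarrow> D x) (at 0)"
        using deriv[of x 0] by (simp add: has_field_derivative_iff)
      moreover have "filterlim h (at 0) sequentially"
        unfolding h_def filterlim_at
        by (auto intro!: LIMSEQ_inverse_real_of_nat simp flip: inverse_eq_divide)
           (use LIMSEQ_inverse_real_of_nat in \<open>simp add: add.commute\<close>)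
      ultimately show "(\<lambda>n. q n x) \<longlonglongrightarrow> D x"
        unfolding q_def by (rule filterlim_compose)
    qed
    show "D \<in> borel_measurable lborel"
      using cont by (simp add: borel_measurable_continuous_onI)
    have "f \<in> borel_measurable borel"
      using cont by (simp add: borel_measurable_continuous_onI)
    then show "q n \<in> borel_measurable lborel" for n
      unfolding q_def by measurable
    show "integrable lborel (\<lambda>x. M * indicator (cball 0 (R + norm b)) x)"
      by (intro integrable_mult_right integrable_real_indicator)
        (use emeasure_bounded_finite[OF bounded_cball, of 0 "R + norm b"] in auto)
  qed (use bound in auto)
  then show ?thesis
    by (simp add: q0 LIMSEQ_const_iff)
qed

lemma has_derivative_zero_outside_compact:
  fixes f :: "'a::euclidean_space \<Rightarrow> real"
  assumes "compact K" "\<And>x. x \<notin> K \<Longrightarrow> f x = 0" "x \<notin> K"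
  shows "(f has_derivative (\<lambda>_. 0)) (at x)"
proof (rule has_derivative_transform_within_open[of "\<lambda>_. 0" _ x UNIV "- K"])
  show "open (- K)" using assms(1) by (simp add: compact_imp_closed open_Compl)
qed (use assms in auto)

text \<open>\<open>S\<close> and the complement of \<open>K\<close> are open and cover the space,
  and the extension is continuous on each of them.\<close>

lemma continuous_zero_extension:
  fixes f :: "'a::euclidean_space \<Rightarrow> real"
  assumes "open S" "compact K" "K \<subseteq> S" "continuous_on S f" "\<And>x. x \<in> S - K \<Longrightarrow> f x = 0"
  shows "continuous_on UNIV (\<lambda>x. if x \<in> S then f x else 0)" (is "continuous_on _ ?g")
proof -
  have "continuous_on S ?g"
    using assms(4) by (simp cong: continuous_on_cong)
  moreover have "continuous_on (- K) ?g"
    using assms(5) by (intro continuous_on_cong[THEN iffD1, OF refl _ continuous_on_const[of _ 0]]) auto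
  ultimately have "continuous_on (S \<union> - K) ?g"
    using assms by (intro continuous_on_open_Un) (auto simp: compact_imp_closed open_Compl)
  moreover have "S \<union> - K = UNIV" using assms(3) by auto
  ultimately show ?thesis by simp
qed

text \<open>Sobolev spaces are defined with the restricted completed measure, while translation
  invariance is used for \<open>lborel\<close>. The completion has the same integrals for Borel
  functions, hence the measurability hypothesis on the extension.\<close>

lemma lebesgue_on_zero_extension:
  fixes f :: "'a::euclidean_space \<Rightarrow> real"
  assumes "open S" and g: "(\<lambda>x. if x \<in> S then f x else 0) \<in> borel_measurable borel"
  shows "integrable (lebesgue_on S) f \<longleftrightarrow> integrable lborel (\<lambda>x. if x \<in> S then f x else 0)"
    "(\<integral>x. f x \<partial>lebesgue_on S) = (\<integral>x. (if x \<in> S then f x else 0) \<partial>lborel)"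
proof -
  have S: "S \<in> sets lebesgue" using assms(1) by auto
  have eq: "(\<lambda>x. indicator S x *\<^sub>R f x) = (\<lambda>x. if x \<in> S then f x else 0)" by (auto simp: indicator_def)
  have m: "(\<lambda>x. if x \<in> S then f x else 0) \<in> borel_measurable lborel"
    using g by simp
  have "integrable (lebesgue_on S) f \<longleftrightarrow> integrable lebesgue (\<lambda>x. if x \<in> S then f x else 0)"
    using S by (subst integrable_restrict_space) (simp_all only: eq, simp)
  then show "integrable (lebesgue_on S) f \<longleftrightarrow> integrable lborel (\<lambda>x. if x \<in> S then f x else 0)"
    by (simp only: integrable_completion[OF m])
  have "(\<integral>x. f x \<partial>lebesgue_on S) = (\<integral>x. (if x \<in> S then f x else 0) \<partial>lebesgue)"
    using S by (subst integral_restrict_space) (simp_all only: eq, simp)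
  then show "(\<integral>x. f x \<partial>lebesgue_on S) = (\<integral>x. (if x \<in> S then f x else 0) \<partial>lborel)"
    by (simp only: integral_completion[OF m])
qed

lemma integrable_on_compact_support:
  fixes f :: "'a::euclidean_space \<Rightarrow> real"
  assumes "open S" "compact K" "K \<subseteq> S" "continuous_on S f" "\<And>x. x \<in> S - K \<Longrightarrow> f x = 0"
  shows "integrable (lebesgue_on S) f"
proof -
  note cont = continuous_zero_extension[OF assms]
  then have "integrable lborel (\<lambda>x. if x \<in> S then f x else 0)"
    by (rule integrable_lborel_compact_support[OF _ assms(2)]) (use assms in auto)
  then show ?thesis
    using cont by (subst lebesgue_on_zero_extension(1)[OF assms(1)]) (auto intro: borel_measurable_continuous_onI)
qed

text \<open>The divergence theorem without boundary term. It is stated for an open set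
  \<open>S\<close> because Hardy's inequality uses it on the ball and the trial functions use it on
  the punctured ball.\<close>

lemma integral_derivative_compact_support:
  fixes f :: "'a::euclidean_space \<Rightarrow> real"
  assumes "open S" "compact K" "K \<subseteq> S" "\<And>x. x \<notin> K \<Longrightarrow> f x = 0"
    and deriv: "\<And>x. x \<in> S \<Longrightarrow> (f has_derivative f' x) (at x)"
    and cont: "continuous_on S (\<lambda>x. f' x b)"
  shows "integrable (lebesgue_on S) (\<lambda>x. f' x b)" "(\<integral>x. f' x b \<partial>lebesgue_on S) = 0"
proof -
  define D where "D x = (if x \<in> S then f' x b else 0)" for x
  \<comment> \<open>Off \<open>K\<close> the function is locally zero, and uniqueness of the
    derivative forces \<open>f'\<close> to vanish there.\<close>
  have zero: "f' x b = 0" if "x \<in> S - K" for x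
    using has_derivative_unique[OF deriv has_derivative_zero_outside_compact[where f = f, OF assms(2,4)], of x] that
    by (auto dest: fun_cong)
  then show "integrable (lebesgue_on S) (\<lambda>x. f' x b)"
    by (intro integrable_on_compact_support[OF assms(1-3) cont]) auto
  have d: "(f has_derivative (if x \<in> S then f' x else (\<lambda>_. 0))) (at x)" for x
    using deriv[of x] has_derivative_zero_outside_compact[where f = f and x = x, OF assms(2,4)] assms(3) by (cases "x \<in> S") auto
  have cD: "continuous_on UNIV D"
    unfolding D_def by (rule continuous_zero_extension[OF assms(1-3) cont]) (use zero in auto)
  have "(\<integral>x. D x \<partial>lborel) = 0"
  proof (rule lborel_integral_derivative_eq_0[OF assms(2)])
    show "continuous_on UNIV f"
      using d by (intro continuous_at_imp_continuous_on) (auto intro: has_derivative_continuous)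
    show "((\<lambda>t. f (x + t *\<^sub>R b)) has_real_derivative D (x + t *\<^sub>R b)) (at t)" for x t
    proof -
      let ?F = "if x + t *\<^sub>R b \<in> S then f' (x + t *\<^sub>R b) else (\<lambda>_. 0)"
      have "((\<lambda>t. x + t *\<^sub>R b) has_derivative (\<lambda>h. h *\<^sub>R b)) (at t)"
        by (auto intro!: derivative_eq_intros)
      from has_derivative_compose[OF this d]
      have "((\<lambda>t. f (x + t *\<^sub>R b)) has_derivative (\<lambda>h. ?F (h *\<^sub>R b))) (at t)" .
      moreover have "?F (h *\<^sub>R b) = D (x + t *\<^sub>R b) * h" for h
        using linear_scale[OF has_derivative_linear[OF d[of "x + t *\<^sub>R b"]], of h b] by (simp add: D_def)
      ultimately show ?thesis by (simp add: has_field_derivative_def)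
    qed
  qed (use assms(4) cD zero in \<open>auto simp: D_def\<close>)
  then show "(\<integral>x. f' x b \<partial>lebesgue_on S) = 0"
    using cD unfolding D_def
    by (subst lebesgue_on_zero_extension(2)[OF assms(1)]) (auto intro: borel_measurable_continuous_onI)
qed

section \<open>Test functions and the fundamental lemma\<close>

text \<open>Half-spaces generate the Borel sets and are positivity sets of affine functions;
  conversely, the positivity set of a continuous function is open.\<close>

lemma sets_borel_eq_smooth_positivity:
  "sets (borel :: 'a::euclidean_space measure) =
    sigma_sets UNIV {{x. g x > 0} |g. \<forall>n. Ck_on n UNIV g}"
proof
  let ?H = "(\<lambda>(a, i). {x::'a. a < x \<bullet> i}) ` (UNIV \<times> Basis)"
  have "?H \<subseteq> {{x. g x > 0} |g. \<forall>n. Ck_on n UNIV g}"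
  proof clarsimp
    fix a and i :: 'a
    show "\<exists>g. {x. a < x \<bullet> i} = {x. 0 < g x} \<and> (\<forall>n. Ck_on n UNIV g)"
      by (intro exI[of _ "\<lambda>x. x \<bullet> i + - a"] conjI allI Ck_on_add Ck_on_const Ck_on_inner_left) auto
  qed
  then show "sets (borel :: 'a measure) \<subseteq> sigma_sets UNIV {{x. g x > 0} |g. \<forall>n. Ck_on n UNIV g}"
    by (subst borel_eq_halfspace_greater) (simp add: sigma_sets_mono')
  have "open {x. g x > 0}" if "\<forall>n. Ck_on n UNIV g" for g :: "'a \<Rightarrow> real"
    using spec[OF that, of 0] by (intro open_Collect_less) auto
  then show "sigma_sets UNIV {{x. g x > 0} |g. \<forall>n. Ck_on n UNIV g} \<subseteq> sets (borel :: 'a measure)"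
    by (intro sets.sigma_sets_subset[of _ "borel :: 'a measure", simplified]) auto
qed

text \<open>The positivity sets generate the Borel sets and are stable under intersection, so a
  Dynkin-system argument makes the integral of \<open>h\<close> vanish over every Borel set.\<close>

lemma AE_zero_if_integral_smooth_positivity_zero:
  fixes h :: "'a::euclidean_space \<Rightarrow> real"
  assumes h: "integrable lborel h"
    and zero: "\<And>g. \<forall>n. Ck_on n UNIV g \<Longrightarrow> (LINT x:{x. g x > 0}|lborel. h x) = 0"
  shows "AE x in lborel. h x = 0"
proof -
  define G where "G = {{x::'a. g x > 0} |g. \<forall>n. Ck_on n UNIV g}"
  have "Int_stable G"
  proof (rule Int_stableI)
    fix A B assume "A \<in> G" "B \<in> G"
    then obtain f g where fg: "A = {x. f x > 0}" "B = {x. g x > 0}"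
      "\<forall>n. Ck_on n UNIV f" "\<forall>n. Ck_on n UNIV g" by (auto simp: G_def)
    \<comment> \<open>The product of \<open>f\<close> and \<open>g\<close> would also be positive
      where both are negative; \<open>flat_exp\<close> truncates the negative parts and keeps
      smoothness.\<close>
    have "\<forall>n. Ck_on n UNIV (\<lambda>x. flat_exp (f x) * flat_exp (g x))"
      using fg by (auto intro!: Ck_on_mult Ck_on_flat_exp)
    moreover have "A \<inter> B = {x. flat_exp (f x) * flat_exp (g x) > 0}"
      using fg flat_exp_range by (auto simp: zero_less_mult_iff) (meson leD)+
    ultimately show "A \<inter> B \<in> G" unfolding G_def mem_Collect_eq by (intro exI[of _ "\<lambda>x. flat_exp (f x) * flat_exp (g x)"] conjI)
  qed
  have G_borel: "sigma_sets UNIV G = sets borel"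
    by (simp add: G_def sets_borel_eq_smooth_positivity)
  \<comment> \<open>The whole space is the positivity set of the constant 1; the complement step
    below relies on this total integral.\<close>
  have UNIV: "(\<integral>x. h x \<partial>lborel) = 0"
    using zero[of "\<lambda>_. 1"] by (simp add: Ck_on_const set_lebesgue_integral_def)
  have int: "set_integrable lborel A h" if "A \<in> sets borel" for A
    unfolding set_integrable_def using h that by (intro integrable_mult_indicator) auto
  have "(LINT x:A|lborel. h x) = 0" if "A \<in> sigma_sets UNIV G" for A
    using \<open>Int_stable G\<close> subset_UNIV[of G, unfolded Pow_UNIV[symmetric]] that
  proof (induction rule: sigma_sets_induct_disjoint)
    case (basic A)
    then show ?case using zero by (auto simp: G_def)
  next
    case empty
    then show ?case by (simp add: set_lebesgue_integral_def)
  next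
    case (compl A)
    then have A: "A \<in> sets borel" by (simp add: G_borel)
    have "(LINT x:A \<union> (UNIV - A)|lborel. h x) = (LINT x:A|lborel. h x) + (LINT x:UNIV - A|lborel. h x)"
      using A by (intro set_integral_Un int) auto
    then show ?case
      using compl UNIV by (simp add: set_lebesgue_integral_def)
  next
    case (union A)
    have "(LINT x:(\<Union>i. A i)|lborel. h x) = (\<Sum>i. (LINT x:(A i)|lborel. h x))"
      using union by (intro lebesgue_integral_countable_add int) (auto simp: G_borel disjoint_family_on_def)
    then show ?case using union by simp
  qed
  then show ?thesis
    using h by (intro density_unique_real) (auto simp: G_borel set_lebesgue_integral_def)
qed

lemma test_functionsI:
  assumes "\<And>n. C_k n \<phi>" "compact K" "K \<subseteq> ball 0 1" "\<And>x. x \<notin> K \<Longrightarrow> \<phi> x = 0"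
  shows "\<phi> \<in> test_functions"
proof -
  have "closure {x. \<phi> x \<noteq> 0} \<subseteq> K"
    using assms by (intro closure_minimal) (auto intro: compact_imp_closed)
  moreover from this have "compact (closure {x. \<phi> x \<noteq> 0})"
    using compact_Int_closed[OF assms(2) closed_closure, of "{x. \<phi> x \<noteq> 0}"] by (simp add: Int_absorb1)
  ultimately show ?thesis
    using assms(1,3) by (auto simp: test_functions_def)
qed

lemma test_functionsE:
  assumes "\<phi> \<in> test_functions"
  obtains K where "\<And>n. C_k n \<phi>" "compact K" "K \<subseteq> ball 0 1" "\<And>x. x \<notin> K \<Longrightarrow> \<phi> x = 0"
proof (rule that[of "closure {x. \<phi> x \<noteq> 0}"])
  show "\<phi> x = 0" if "x \<notin> closure {x. \<phi> x \<noteq> 0}" for x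
    using that closure_subset[of "{x. \<phi> x \<noteq> 0}"] by auto
qed (use assms in \<open>auto simp: test_functions_def\<close>)

lemma test_functions_zero: "(\<lambda>_. 0) \<in> test_functions"
  by (rule test_functionsI[where K = "{}"]) (auto simp: C_k_iff_Ck_on Ck_on_const)

lemma test_functions_add:
  assumes "\<phi> \<in> test_functions" "\<psi> \<in> test_functions"
  shows "(\<lambda>x. \<phi> x + \<psi> x) \<in> test_functions"
proof -
  obtain K where K: "\<And>n. C_k n \<phi>" "compact K" "K \<subseteq> ball 0 1" "\<And>x. x \<notin> K \<Longrightarrow> \<phi> x = 0"
    using test_functionsE[OF assms(1)] by blast
  obtain L where L: "\<And>n. C_k n \<psi>" "compact L" "L \<subseteq> ball 0 1" "\<And>x. x \<notin> L \<Longrightarrow> \<psi> x = 0"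
    using test_functionsE[OF assms(2)] by blast
  show ?thesis
    by (rule test_functionsI[where K = "K \<union> L"])
      (use K L in \<open>auto simp: C_k_iff_Ck_on intro: Ck_on_add\<close>)
qed

lemma test_functions_mult:
  assumes "\<psi> \<in> test_functions" "\<And>n. C_k n \<phi>"
  shows "(\<lambda>x. \<phi> x * \<psi> x) \<in> test_functions"
proof -
  obtain L where L: "\<And>n. C_k n \<psi>" "compact L" "L \<subseteq> ball 0 1" "\<And>x. x \<notin> L \<Longrightarrow> \<psi> x = 0"
    using test_functionsE[OF assms(1)] by blast
  show ?thesis
    by (rule test_functionsI[where K = L])
      (use assms L in \<open>auto simp: C_k_iff_Ck_on intro: Ck_on_mult\<close>)
qed

lemma test_functions_sum:
  assumes "\<And>j. j \<in> J \<Longrightarrow> \<phi> j \<in> test_functions"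
  shows "(\<lambda>x. \<Sum>j\<in>J. a j * \<phi> j x) \<in> test_functions"
  using assms
proof (induction J rule: infinite_finite_induct)
  case (insert j J)
  then have "(\<lambda>x. a j * \<phi> j x) \<in> test_functions"
    by (intro test_functions_mult) (auto simp: C_k_iff_Ck_on Ck_on_const)
  with insert show ?case by (auto intro: test_functions_add)
qed (auto simp: test_functions_zero)

text \<open>
  For smooth \<open>g\<close> the test functions \<open>flat_exp (n g) * flat_exp (n (1 - |x|\<^sup>2) - 1)\<close> converge
  boundedly to the indicator of the part of the ball where \<open>g\<close> is positive, and these sets generate
  the Borel sets.
\<close>

lemma fundamental_lemma_calculus_of_variations:
  fixes h :: "'a::euclidean_space \<Rightarrow> real"
  assumes h: "integrable ball_measure h"
    and zero: "\<And>\<phi>. \<phi> \<in> test_functions \<Longrightarrow> (\<integral>x. h x * \<phi> x \<partial>ball_measure) = 0"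
  shows "AE x in ball_measure. h x = 0"
proof -
  let ?B = "ball 0 1 :: 'a set"
  have "integrable lebesgue (\<lambda>x. indicator ?B x *\<^sub>R h x)"
    using h by (subst (asm) integrable_restrict_space) auto
  then have int: "integrable lebesgue (\<lambda>x. indicator ?B x * h x)"
    by simp
  \<comment> \<open>The zero extension of \<open>h\<close> is only Lebesgue measurable; a Borel
    representative \<open>h0\<close> lets the argument over Borel sets run in
    \<open>lborel\<close>.\<close>
  from completion_ex_borel_measurable_real[OF borel_measurable_integrable[OF this]]
  obtain h0 where h0: "h0 \<in> borel_measurable lborel" and eq: "AE x in lborel. indicator ?B x * h x = h0 x"
    by auto
  have eq': "AE x in lebesgue. indicator ?B x * h x = h0 x"
    using eq by (rule AE_completion)
  have "integrable lebesgue h0"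
    using integrable_cong_AE_imp[OF int measurable_completion[OF h0] ] eq' by auto
  then have int0: "integrable lborel h0"
    by (simp only: integrable_completion[OF h0])
  have test: "(\<integral>x. h0 x * \<phi> x \<partial>lborel) = 0" if "\<phi> \<in> test_functions" for \<phi>
  proof -
    have "continuous_on UNIV \<phi>"
      using test_functionsE[OF that] C_k.simps(1) by metis
    then have m: "\<phi> \<in> borel_measurable borel"
      by (rule borel_measurable_continuous_onI)
    have "(\<integral>x. h0 x * \<phi> x \<partial>lborel) = (\<integral>x. h0 x * \<phi> x \<partial>lebesgue)"
      using h0 m by (intro integral_completion[symmetric] borel_measurable_times) auto
    also have "\<dots> = (\<integral>x. indicator ?B x *\<^sub>R (h x * \<phi> x) \<partial>lebesgue)"
    proof (rule integral_cong_AE)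
      have "(\<lambda>x. h0 x * \<phi> x) \<in> borel_measurable lborel"
        using h0 m by measurable
      then show "(\<lambda>x. h0 x * \<phi> x) \<in> borel_measurable lebesgue"
        by (rule measurable_completion)
      have "(\<lambda>x. (indicator ?B x * h x) * \<phi> x) \<in> borel_measurable lebesgue"
        using m by (intro borel_measurable_times borel_measurable_integrable[OF int]) (auto intro: measurable_completion)
      then show "(\<lambda>x. indicator ?B x *\<^sub>R (h x * \<phi> x)) \<in> borel_measurable lebesgue"
        by (simp add: mult.assoc)
      show "AE x in lebesgue. h0 x * \<phi> x = indicator ?B x *\<^sub>R (h x * \<phi> x)"
        using eq' by eventually_elim (simp add: mult.assoc[symmetric])
    qed
    also have "\<dots> = (\<integral>x. h x * \<phi> x \<partial>ball_measure)"
      by (subst integral_restrict_space) auto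
    also have "\<dots> = 0" by (rule zero[OF that])
    finally show ?thesis .
  qed
  have "AE x in lborel. h0 x = 0"
  proof (rule AE_zero_if_integral_smooth_positivity_zero[OF int0])
    fix g :: "'a \<Rightarrow> real" assume g: "\<forall>n. Ck_on n UNIV g"
    then have g_cont: "continuous_on UNIV g"
      using Ck_on.simps(1) by metis
    \<comment> \<open>The shift by -1 keeps the support inside |x|^2 \<le> 1 - 1/n, a compact part
      of the open ball; for n = 0 the function is zero.\<close>
    define \<phi> where "\<phi> n x = flat_exp (real n * g x) * flat_exp (real n * (1 - x \<bullet> x) - 1)" for n x
    have smooth: "Ck_on m UNIV (\<phi> n)" for m n
    proof -
      have "Ck_on m UNIV (\<lambda>x::'a. real n * (1 + (-1) * (x \<bullet> x)) + -1)"
        by (intro Ck_on_mult Ck_on_add Ck_on_const Ck_on_inner_self open_UNIV)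
      then have "Ck_on m UNIV (\<lambda>x::'a. real n * (1 - x \<bullet> x) - 1)" by simp
      then show ?thesis unfolding \<phi>_def
        using g by (intro Ck_on_mult Ck_on_flat_exp Ck_on_const) auto
    qed
    have \<phi>_test: "\<phi> n \<in> test_functions" for n
    proof (rule test_functionsI[where K = "{x. 1 \<le> real n * (1 - x \<bullet> x)}"])
      have "x \<in> ball 0 1" if "1 \<le> real n * (1 - x \<bullet> x)" for x :: 'a
      proof -
        have "0 < real n * (1 - x \<bullet> x)" using that by linarith
        then have "x \<bullet> x < 1" by (simp add: zero_less_mult_iff)
        then show ?thesis by (simp add: dist_norm norm_eq_sqrt_inner)
      qed
      then show sub: "{x. 1 \<le> real n * (1 - x \<bullet> x)} \<subseteq> ball (0::'a) 1" by auto
      show "compact {x::'a. 1 \<le> real n * (1 - x \<bullet> x)}"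
        unfolding compact_eq_bounded_closed
        by (intro conjI bounded_subset[OF bounded_ball sub] closed_Collect_le continuous_intros)
      show "\<phi> n x = 0" if "x \<notin> {x. 1 \<le> real n * (1 - x \<bullet> x)}" for x
        using that by (auto simp: \<phi>_def flat_exp_def)
    qed (simp add: C_k_iff_Ck_on smooth)
    have "(\<lambda>n. \<integral>x. h0 x * \<phi> n x \<partial>lborel) \<longlonglongrightarrow> (LINT x:{x. g x > 0}|lborel. h0 x)"
      unfolding set_lebesgue_integral_def
    proof (rule integral_dominated_convergence[where w = "\<lambda>x. \<bar>h0 x\<bar>"])
      have "\<phi> n \<in> borel_measurable borel" for n
        using smooth[of 0 n] by (auto intro: borel_measurable_continuous_onI)
      then show "(\<lambda>x. h0 x * \<phi> n x) \<in> borel_measurable lborel" for n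
        using h0 by measurable
      have "{x. g x > 0} \<in> sets borel"
        using g_cont by (intro borel_open open_Collect_less) auto
      then show "(\<lambda>x. indicator {x. g x > 0} x *\<^sub>R h0 x) \<in> borel_measurable lborel"
        using h0 by (intro borel_measurable_scaleR borel_measurable_indicator) auto
      show "integrable lborel (\<lambda>x. \<bar>h0 x\<bar>)" using int0 by simp
      show "AE x in lborel. norm (h0 x * \<phi> n x) \<le> \<bar>h0 x\<bar>" for n
        by (intro AE_I2) (auto simp: \<phi>_def abs_mult flat_exp_range intro!: mult_left_le mult_le_one)
      show "AE x in lborel. (\<lambda>n. h0 x * \<phi> n x) \<longlonglongrightarrow> indicator {x. g x > 0} x *\<^sub>R h0 x"
        using eq
      proof eventually_elim
        fix x assume x: "indicator ?B x * h x = h0 x"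
        \<comment> \<open>Outside the ball \<open>h0\<close> vanishes, so both cutoffs have to tend
          to 1 only at points of the ball where \<open>g\<close> is positive.\<close>
        consider "h0 x = 0" | "g x \<le> 0" | "x \<in> ?B" "g x > 0"
          using x by (fastforce simp: indicator_def split: if_splits)
        then show "(\<lambda>n. h0 x * \<phi> n x) \<longlonglongrightarrow> indicator {x. g x > 0} x *\<^sub>R h0 x"
        proof cases
          case 1
          then show ?thesis by simp
        next
          case 2
          then have "\<phi> n x = 0" for n
            by (auto simp: \<phi>_def flat_exp_def zero_less_mult_iff)
          with 2 show ?thesis by simp
        next
          case 3
          then have "x \<bullet> x < 1"
            by (simp add: norm_eq_sqrt_inner)
          then have "(\<lambda>n. \<phi> n x) \<longlonglongrightarrow> 1 * 1"
            unfolding \<phi>_def using \<open>g x > 0\<close>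
            by (intro tendsto_mult flat_exp_tendsto_1) real_asymp+
          then have "(\<lambda>n. h0 x * \<phi> n x) \<longlonglongrightarrow> h0 x * 1"
            by (intro tendsto_mult tendsto_const) simp
          then show ?thesis using 3 by simp
        qed
      qed
    qed
    then show "(LINT x:{x. g x > 0}|lborel. h0 x) = 0"
      by (simp add: test[OF \<phi>_test] LIMSEQ_const_iff)
  qed
  with eq have "AE x in lborel. x \<in> ?B \<longrightarrow> h x = 0"
    by eventually_elim auto
  then have "AE x in lebesgue. x \<in> ?B \<longrightarrow> h x = 0"
    by (rule AE_completion)
  then show ?thesis
    by (subst AE_restrict_space_iff) auto
qed

section \<open>Weak gradients\<close>

definition gradient :: "('a::euclidean_space \<Rightarrow> real) \<Rightarrow> 'a \<Rightarrow> 'a"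
  where "gradient \<phi> x = (\<Sum>b\<in>Basis. frechet_derivative \<phi> (at x) b *\<^sub>R b)"

lemma gradient_inner_Basis: "b \<in> Basis \<Longrightarrow> gradient \<phi> x \<bullet> b = frechet_derivative \<phi> (at x) b"
  by (simp add: gradient_def)

lemma norm_gradient_sq: "(norm (gradient \<phi> x))\<^sup>2 = (\<Sum>b\<in>Basis. (frechet_derivative \<phi> (at x) b)\<^sup>2)"
  unfolding power2_norm_eq_inner
  by (subst euclidean_inner) (simp add: gradient_inner_Basis power2_eq_square)

lemma test_functions_C_k: "\<phi> \<in> test_functions \<Longrightarrow> C_k n \<phi>"
  by (simp add: test_functions_def)

lemma test_function_has_derivative:
  "\<phi> \<in> test_functions \<Longrightarrow> (\<phi> has_derivative frechet_derivative \<phi> (at x)) (at x)"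
  using Ck_on_SucD[of 0 UNIV \<phi> x] test_functions_C_k[of \<phi> "Suc 0"] unfolding C_k_iff_Ck_on by blast

lemma test_function_continuous: "\<phi> \<in> test_functions \<Longrightarrow> continuous_on UNIV \<phi>"
  using test_functions_C_k[of \<phi> 0] by simp

lemma test_function_derivative_continuous:
  "\<phi> \<in> test_functions \<Longrightarrow> b \<in> Basis \<Longrightarrow> continuous_on UNIV (\<lambda>x. frechet_derivative \<phi> (at x) b)"
  using test_functions_C_k[of \<phi> "Suc 0"] by simp

lemma gradient_continuous: "\<phi> \<in> test_functions \<Longrightarrow> continuous_on UNIV (gradient \<phi>)"
  unfolding gradient_def by (intro continuous_intros test_function_derivative_continuous)

lemma test_functions_vanishingE:
  assumes "\<phi> \<in> test_functions"
  obtains K where "compact K" "K \<subseteq> ball 0 1" "\<And>x. x \<notin> K \<Longrightarrow> \<phi> x = 0"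
    "\<And>x. x \<notin> K \<Longrightarrow> frechet_derivative \<phi> (at x) = (\<lambda>_. 0)" "\<And>x. x \<notin> K \<Longrightarrow> gradient \<phi> x = 0"
proof -
  obtain K where K: "compact K" "K \<subseteq> ball 0 1" "\<And>x. x \<notin> K \<Longrightarrow> \<phi> x = 0"
    by (rule test_functionsE[OF assms], rule that)
  have D: "frechet_derivative \<phi> (at x) = (\<lambda>_. 0)" if "x \<notin> K" for x
    using frechet_derivative_at[OF has_derivative_zero_outside_compact[OF K(1,3) that]] by simp
  then have "gradient \<phi> x = 0" if "x \<notin> K" for x
    using that by (simp add: gradient_def)
  with K D show ?thesis by (intro that)
qed

lemma borel_measurable_ball_continuous:
  fixes f :: "'a::euclidean_space \<Rightarrow> 'b::euclidean_space"
  shows "continuous_on UNIV f \<Longrightarrow> f \<in> borel_measurable ball_measure"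
  by (intro measurable_restrict_space1 measurable_completion) (simp add: borel_measurable_continuous_onI)

lemma square_integrable_test_function:
  assumes "\<phi> \<in> test_functions"
  shows "square_integrable \<phi>" "square_integrable (gradient \<phi>)"
    "b \<in> Basis \<Longrightarrow> square_integrable (\<lambda>x. frechet_derivative \<phi> (at x) b)"
proof -
  obtain K where K: "compact K" "K \<subseteq> ball 0 1" "\<And>x. x \<notin> K \<Longrightarrow> \<phi> x = 0"
    "\<And>x. x \<notin> K \<Longrightarrow> frechet_derivative \<phi> (at x) = (\<lambda>_. 0)" "\<And>x. x \<notin> K \<Longrightarrow> gradient \<phi> x = 0"
    by (rule test_functions_vanishingE[OF assms], rule that)
  have sq: "square_integrable f" if "continuous_on UNIV f" "\<And>x. x \<notin> K \<Longrightarrow> f x = 0"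
    for f :: "'a \<Rightarrow> 'c::euclidean_space"
    unfolding square_integrable_def
  proof
    show "integrable ball_measure (\<lambda>x. (norm (f x))\<^sup>2)"
      by (rule integrable_on_compact_support[OF open_ball K(1,2)])
        (use that in \<open>auto intro!: continuous_intros intro: continuous_on_subset\<close>)
  qed (rule borel_measurable_ball_continuous[OF that(1)])
  show "square_integrable \<phi>" using K assms by (intro sq test_function_continuous)
  show "square_integrable (gradient \<phi>)" using K assms by (intro sq gradient_continuous)
  show "square_integrable (\<lambda>x. frechet_derivative \<phi> (at x) b)" if "b \<in> Basis"
    using K assms that by (intro sq test_function_derivative_continuous) auto
qed

lemma square_integrable_measurable: "square_integrable f \<Longrightarrow> f \<in> borel_measurable ball_measure"
  by (simp add: square_integrable_def)

lemma square_integrable_inner: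
  fixes f g :: "'a::euclidean_space \<Rightarrow> 'b::euclidean_space"
  assumes "square_integrable f" "square_integrable g"
  shows "integrable ball_measure (\<lambda>x. f x \<bullet> g x)"
proof (rule Bochner_Integration.integrable_bound)
  show "integrable ball_measure (\<lambda>x. (norm (f x))\<^sup>2 + (norm (g x))\<^sup>2)"
    using assms by (auto simp: square_integrable_def)
  show "(\<lambda>x. f x \<bullet> g x) \<in> borel_measurable ball_measure"
    using assms by (auto simp: square_integrable_def)
  have "\<bar>a \<bullet> b\<bar> \<le> (norm a)\<^sup>2 + (norm b)\<^sup>2" for a b :: 'b
  proof -
    have "\<bar>a \<bullet> b\<bar> \<le> norm a * norm b" by (rule Cauchy_Schwarz_ineq2)
    also have "\<dots> \<le> (norm a)\<^sup>2 + (norm b)\<^sup>2"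
      using sum_squares_bound[of "norm a" "norm b"] mult_nonneg_nonneg[OF norm_ge_zero[of a] norm_ge_zero[of b]]
      by linarith
    finally show ?thesis .
  qed
  then show "AE x in ball_measure. norm (f x \<bullet> g x) \<le> norm ((norm (f x))\<^sup>2 + (norm (g x))\<^sup>2)"
    by (intro AE_I2) simp
qed

lemma square_integrable_mult:
  fixes f g :: "'a::euclidean_space \<Rightarrow> real"
  shows "square_integrable f \<Longrightarrow> square_integrable g \<Longrightarrow> integrable ball_measure (\<lambda>x. f x * g x)"
  using square_integrable_inner[of f g] by simp

lemma square_integrable_component:
  assumes "square_integrable f" "b \<in> Basis"
  shows "square_integrable (\<lambda>x. f x \<bullet> b)"
  unfolding square_integrable_def
proof
  show m: "(\<lambda>x. f x \<bullet> b) \<in> borel_measurable ball_measure"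
    using assms by (auto simp: square_integrable_def)
  show "integrable ball_measure (\<lambda>x. (norm (f x \<bullet> b))\<^sup>2)"
  proof (rule Bochner_Integration.integrable_bound)
    show "integrable ball_measure (\<lambda>x. (norm (f x))\<^sup>2)"
      using assms by (auto simp: square_integrable_def)
    show "AE x in ball_measure. norm ((norm (f x \<bullet> b))\<^sup>2) \<le> norm ((norm (f x))\<^sup>2)"
      using Basis_le_norm[OF assms(2)] by (auto simp: abs_le_square_iff[symmetric])
  qed (use m in measurable)
qed

lemma integrable_ball_const: "integrable (ball_measure :: 'a::euclidean_space measure) (\<lambda>_. c::real)"
proof -
  have "emeasure ball_measure (space (ball_measure :: 'a measure)) < \<infinity>"
    by (subst emeasure_restrict_space)
      (use emeasure_bounded_finite[OF bounded_ball, of "0 :: 'a" 1] in \<open>auto simp: space_restrict_space\<close>)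
  then show ?thesis
    by (intro finite_measure.integrable_const finite_measureI) auto
qed

lemma square_integrable_imp_integrable:
  fixes f :: "'a::euclidean_space \<Rightarrow> real"
  shows "square_integrable f \<Longrightarrow> integrable ball_measure f"
  using square_integrable_mult[of f "\<lambda>_. 1"] integrable_ball_const[of 1]
  by (simp add: square_integrable_def)

section \<open>Classes and representatives in L^2 of the ball\<close>

lemma l2_rel_refl: "l2_rel f f \<longleftrightarrow> square_integrable f"
  by (simp add: l2_rel_def)

lemma square_integrable_l2_repr: "square_integrable (l2_repr u)"
  using Quotient3_rep_reflp[OF Quotient3_l2_ball, of u] by (simp add: l2_rel_def)

lemma l2_class_repr: "l2_class (l2_repr u) = u"
  by (rule Quotient3_abs_rep[OF Quotient3_l2_ball])

text \<open>Representatives are picked arbitrarily from their classes, so identities between them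
  hold only almost everywhere and are used under integrals.\<close>

lemma l2_repr_class: "square_integrable f \<Longrightarrow> AE x in ball_measure. l2_repr (l2_class f) x = f x"
  using rep_abs_rsp_left[OF Quotient3_l2_ball, of f f] by (simp add: l2_rel_def)

lemma l2_class_add:
  "square_integrable f \<Longrightarrow> square_integrable g \<Longrightarrow> l2_class f + l2_class g = l2_class (\<lambda>x. f x + g x)"
  by (simp add: plus_l2_ball.abs_eq l2_rel_refl)

lemma l2_class_scaleR: "square_integrable f \<Longrightarrow> c *\<^sub>R l2_class f = l2_class (\<lambda>x. c * f x)"
  by (simp add: scaleR_l2_ball.abs_eq l2_rel_refl)

lemma l2_repr_add: "AE x in ball_measure. l2_repr (u + v) x = l2_repr u x + l2_repr v x"
  using l2_repr_class[OF square_integrable_add[OF square_integrable_l2_repr[of u] square_integrable_l2_repr[of v]]]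
  by (simp add: l2_class_add[symmetric] square_integrable_l2_repr l2_class_repr)

lemma l2_repr_scaleR: "AE x in ball_measure. l2_repr (c *\<^sub>R u) x = c * l2_repr u x"
  using l2_repr_class[OF square_integrable_scaleR[OF square_integrable_l2_repr[of u], of c]]
  by (simp add: l2_class_scaleR[symmetric] square_integrable_l2_repr l2_class_repr)

lemma has_weak_gradient_add:
  fixes u v :: "'a::euclidean_space l2_ball"
  assumes "has_weak_gradient u g" "has_weak_gradient v h"
  shows "has_weak_gradient (u + v) (\<lambda>x. g x + h x)"
  unfolding has_weak_gradient_def
proof (intro conjI ballI)
  have g: "square_integrable g" and h: "square_integrable h"
    using assms by (auto simp: has_weak_gradient_def)
  then show "square_integrable (\<lambda>x. g x + h x)" by (rule square_integrable_add)
  fix \<phi> :: "'a \<Rightarrow> real" and b :: 'a assume \<phi>: "\<phi> \<in> test_functions" and b: "b \<in> Basis"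
  let ?D = "\<lambda>x. frechet_derivative \<phi> (at x) b"
  note sq = square_integrable_test_function[OF \<phi>]
  have "(\<integral>x. l2_repr (u + v) x * ?D x \<partial>ball_measure) =
      (\<integral>x. l2_repr u x * ?D x + l2_repr v x * ?D x \<partial>ball_measure)"
  proof (rule integral_cong_AE)
    show "AE x in ball_measure. l2_repr (u + v) x * ?D x = l2_repr u x * ?D x + l2_repr v x * ?D x"
      using l2_repr_add[of u v] by eventually_elim (simp add: algebra_simps)
  qed (intro borel_measurable_add borel_measurable_times square_integrable_measurable
      square_integrable_l2_repr sq(3)[OF b])+
  also have "\<dots> = (\<integral>x. l2_repr u x * ?D x \<partial>ball_measure) + (\<integral>x. l2_repr v x * ?D x \<partial>ball_measure)"
    by (intro Bochner_Integration.integral_add square_integrable_mult square_integrable_l2_repr sq(3)[OF b])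
  also have "\<dots> = - (\<integral>x. (g x \<bullet> b) * \<phi> x \<partial>ball_measure) - (\<integral>x. (h x \<bullet> b) * \<phi> x \<partial>ball_measure)"
    using assms \<phi> b by (simp add: has_weak_gradient_def)
  also have "\<dots> = - (\<integral>x. ((g x + h x) \<bullet> b) * \<phi> x \<partial>ball_measure)"
    using Bochner_Integration.integral_add[OF
        square_integrable_mult[OF square_integrable_component[OF g b] sq(1)]
        square_integrable_mult[OF square_integrable_component[OF h b] sq(1)]]
    by (simp add: inner_add_left distrib_right)
  finally show "(\<integral>x. l2_repr (u + v) x * ?D x \<partial>ball_measure) = - (\<integral>x. ((g x + h x) \<bullet> b) * \<phi> x \<partial>ball_measure)" .
qed

lemma has_weak_gradient_scaleR:
  fixes u :: "'a::euclidean_space l2_ball"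
  assumes "has_weak_gradient u g"
  shows "has_weak_gradient (c *\<^sub>R u) (\<lambda>x. c *\<^sub>R g x)"
  unfolding has_weak_gradient_def
proof (intro conjI ballI)
  show "square_integrable (\<lambda>x. c *\<^sub>R g x)"
    using assms by (auto simp: has_weak_gradient_def intro: square_integrable_scaleR)
  fix \<phi> :: "'a \<Rightarrow> real" and b :: 'a assume \<phi>: "\<phi> \<in> test_functions" and b: "b \<in> Basis"
  let ?D = "\<lambda>x. frechet_derivative \<phi> (at x) b"
  have "(\<integral>x. l2_repr (c *\<^sub>R u) x * ?D x \<partial>ball_measure) = (\<integral>x. c * (l2_repr u x * ?D x) \<partial>ball_measure)"
  proof (rule integral_cong_AE)
    show "AE x in ball_measure. l2_repr (c *\<^sub>R u) x * ?D x = c * (l2_repr u x * ?D x)"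
      using l2_repr_scaleR[of c u] by eventually_elim simp
  qed (intro borel_measurable_times borel_measurable_const square_integrable_measurable
      square_integrable_l2_repr square_integrable_test_function(3)[OF \<phi> b])+
  also have "\<dots> = - (\<integral>x. ((c *\<^sub>R g x) \<bullet> b) * \<phi> x \<partial>ball_measure)"
    using assms \<phi> b by (simp add: has_weak_gradient_def mult.assoc)
  finally show "(\<integral>x. l2_repr (c *\<^sub>R u) x * ?D x \<partial>ball_measure) = - (\<integral>x. ((c *\<^sub>R g x) \<bullet> b) * \<phi> x \<partial>ball_measure)" .
qed

text \<open>Each component of the difference integrates to zero against all test functions, so the
  fundamental lemma applies componentwise. As \<open>weak_gradient\<close> is a choice, this is what
  allows an explicit weak gradient to replace it in integrals.\<close>

lemma has_weak_gradient_unique: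
  fixes u :: "'a::euclidean_space l2_ball"
  assumes "has_weak_gradient u g" "has_weak_gradient u h"
  shows "AE x in ball_measure. g x = h x"
proof -
  have g: "square_integrable g" and h: "square_integrable h"
    using assms by (auto simp: has_weak_gradient_def)
  have "AE x in ball_measure. g x \<bullet> b - h x \<bullet> b = 0" if b: "b \<in> Basis" for b
  proof (rule fundamental_lemma_calculus_of_variations)
    note gb = square_integrable_component[OF g b] and hb = square_integrable_component[OF h b]
    show "integrable ball_measure (\<lambda>x. g x \<bullet> b - h x \<bullet> b)"
      using gb hb by (intro Bochner_Integration.integrable_diff square_integrable_imp_integrable)
    fix \<phi> :: "'a \<Rightarrow> real" assume \<phi>: "\<phi> \<in> test_functions"
    note sq = square_integrable_test_function(1)[OF \<phi>]
    have "(\<integral>x. l2_repr u x * frechet_derivative \<phi> (at x) b \<partial>ball_measure) = - (\<integral>x. (g x \<bullet> b) * \<phi> x \<partial>ball_measure)"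
      "(\<integral>x. l2_repr u x * frechet_derivative \<phi> (at x) b \<partial>ball_measure) = - (\<integral>x. (h x \<bullet> b) * \<phi> x \<partial>ball_measure)"
      using assms \<phi> b unfolding has_weak_gradient_def by blast+
    then have "(\<integral>x. (g x \<bullet> b) * \<phi> x \<partial>ball_measure) = (\<integral>x. (h x \<bullet> b) * \<phi> x \<partial>ball_measure)"
      by linarith
    then show "(\<integral>x. (g x \<bullet> b - h x \<bullet> b) * \<phi> x \<partial>ball_measure) = 0"
      using Bochner_Integration.integral_diff[OF square_integrable_mult[OF gb sq] square_integrable_mult[OF hb sq]]
      by (simp add: left_diff_distrib)
  qed
  then have "AE x in ball_measure. \<forall>b\<in>Basis. g x \<bullet> b - h x \<bullet> b = 0"
    by (simp add: AE_finite_all)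
  then show ?thesis
    by eventually_elim (rule euclidean_eqI, simp)
qed

lemma has_weak_gradient_weak_gradient: "u \<in> H1 \<Longrightarrow> has_weak_gradient u (weak_gradient u)"
  unfolding H1_def weak_gradient_def mem_Collect_eq by (fact someI_ex)

lemma weak_gradient_unique:
  assumes "has_weak_gradient u g"
  shows "AE x in ball_measure. weak_gradient u x = g x"
  by (rule has_weak_gradient_unique[OF has_weak_gradient_weak_gradient assms]) (use assms in \<open>auto simp: H1_def\<close>)

lemma square_integrable_weak_gradient: "u \<in> H1 \<Longrightarrow> square_integrable (weak_gradient u)"
  using has_weak_gradient_weak_gradient by (auto simp: has_weak_gradient_def)

text \<open>The derivative of \<psi> \<phi> integrates to zero because \<phi> has compact support in
  the ball; the product rule turns this into the defining identity.\<close>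

lemma has_weak_gradient_test_function:
  fixes \<psi> :: "'a::euclidean_space \<Rightarrow> real"
  assumes \<psi>: "\<psi> \<in> test_functions"
  shows "has_weak_gradient (l2_class \<psi>) (gradient \<psi>)"
  unfolding has_weak_gradient_def
proof (intro conjI ballI)
  note sq\<psi> = square_integrable_test_function[OF \<psi>]
  show "square_integrable (gradient \<psi>)" by (rule sq\<psi>(2))
  fix \<phi> :: "'a \<Rightarrow> real" and b :: 'a assume \<phi>: "\<phi> \<in> test_functions" and b: "b \<in> Basis"
  note sq = square_integrable_test_function[OF \<phi>]
  let ?D = "\<lambda>x. frechet_derivative \<phi> (at x) b" and ?E = "\<lambda>x. frechet_derivative \<psi> (at x) b"
  obtain K where K: "compact K" "K \<subseteq> ball 0 1" "\<And>x. x \<notin> K \<Longrightarrow> \<phi> x = 0"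
    by (rule test_functionsE[OF \<phi>], rule that)
  have d: "((\<lambda>x. \<psi> x * \<phi> x) has_derivative
      (\<lambda>h. \<psi> x * frechet_derivative \<phi> (at x) h + frechet_derivative \<psi> (at x) h * \<phi> x)) (at x)" for x
    by (rule has_derivative_mult[OF test_function_has_derivative[OF \<psi>] test_function_has_derivative[OF \<phi>]])
  have "continuous_on UNIV (\<lambda>x. \<psi> x * ?D x + ?E x * \<phi> x)"
    by (intro continuous_on_add continuous_on_mult test_function_continuous[OF \<phi>]
        test_function_continuous[OF \<psi>] test_function_derivative_continuous[OF \<phi> b]
        test_function_derivative_continuous[OF \<psi> b])
  then have c: "continuous_on (ball 0 1) (\<lambda>x. \<psi> x * ?D x + ?E x * \<phi> x)"
    by (rule continuous_on_subset) simp
  have "(\<integral>x. \<psi> x * ?D x + ?E x * \<phi> x \<partial>ball_measure) = 0"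
    by (rule integral_derivative_compact_support(2)[OF open_ball K(1,2) _ d c]) (use K(3) in simp)
  then have "(\<integral>x. \<psi> x * ?D x \<partial>ball_measure) + (\<integral>x. ?E x * \<phi> x \<partial>ball_measure) = 0"
    using Bochner_Integration.integral_add[OF square_integrable_mult[OF sq\<psi>(1) sq(3)[OF b]]
        square_integrable_mult[OF sq\<psi>(3)[OF b] sq(1)]] by simp
  moreover have "(\<integral>x. l2_repr (l2_class \<psi>) x * ?D x \<partial>ball_measure) = (\<integral>x. \<psi> x * ?D x \<partial>ball_measure)"
  proof (rule integral_cong_AE)
    show "AE x in ball_measure. l2_repr (l2_class \<psi>) x * ?D x = \<psi> x * ?D x"
      using l2_repr_class[OF sq\<psi>(1)] by eventually_elim simp
  qed (intro borel_measurable_times square_integrable_measurable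
      square_integrable_l2_repr sq(3)[OF b] sq\<psi>(1))+
  ultimately show "(\<integral>x. l2_repr (l2_class \<psi>) x * ?D x \<partial>ball_measure) = - (\<integral>x. (gradient \<psi> x \<bullet> b) * \<phi> x \<partial>ball_measure)"
    using b by (simp add: gradient_inner_Basis)
qed

lemma l2_class_test_function_H10:
  assumes "\<phi> \<in> test_functions"
  shows "l2_class \<phi> \<in> H10"
proof -
  have H1: "l2_class \<phi> \<in> H1"
    using has_weak_gradient_test_function[OF assms] by (auto simp: H1_def)
  \<comment> \<open>A test function approximates itself. The difference is the zero class, but its
    chosen representative and weak gradient are known to be zero only almost everywhere; scaling by
    0 supplies an explicit zero gradient to compare with.\<close>
  have "H1_norm (l2_class \<phi> - l2_class \<phi>) = 0"
  proof -
    have "AE x in ball_measure. weak_gradient (0 :: 'a l2_ball) x = 0"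
      using weak_gradient_unique[OF has_weak_gradient_scaleR[OF has_weak_gradient_test_function[OF assms], of 0]]
      by simp
    moreover have "AE x in ball_measure. l2_repr (0 :: 'a l2_ball) x = 0"
      using l2_repr_scaleR[of 0 "0 :: 'a l2_ball"] by simp
    ultimately have "(\<integral>x. (norm (weak_gradient (0 :: 'a l2_ball) x))\<^sup>2 \<partial>ball_measure) = 0"
      "(\<integral>x. (l2_repr (0 :: 'a l2_ball) x)\<^sup>2 \<partial>ball_measure) = 0"
      by (auto intro!: integral_eq_zero_AE elim: eventually_mono)
    then show ?thesis by (simp add: H1_norm_def)
  qed
  then show ?thesis
    using H1 assms by (auto simp: H10_def intro!: bexI[of _ \<phi>])
qed

section \<open>The critical Hardy inequality\<close>

text \<open>A regularisation of 1 - ln |x|, which is recovered at \<epsilon> = 0; written through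
  \<open>x \<bullet> x\<close> so as to be smooth at the origin for \<epsilon> > 0.\<close>

definition log_norm :: "real \<Rightarrow> 'a::euclidean_space \<Rightarrow> real"
  where "log_norm \<epsilon> x = 1 - ln (x \<bullet> x + \<epsilon>) / 2"

text \<open>As \<epsilon> tends to 0 this becomes the critical weight 1 / (4 |x|^2 (1 - ln |x|)^2).
  At the origin it is 0, which is also the value of the limit formula there under division by
  zero.\<close>

definition hardy_weight :: "real \<Rightarrow> 'a::euclidean_space \<Rightarrow> real"
  where "hardy_weight \<epsilon> x = (x \<bullet> x) / (4 * ((x \<bullet> x + \<epsilon>) * log_norm \<epsilon> x)\<^sup>2)"

lemma ball_inner_less_1: "x \<in> ball 0 1 \<Longrightarrow> x \<bullet> x < 1"
  by (simp add: norm_eq_sqrt_inner)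

lemma log_norm_bound:
  assumes "x \<in> ball 0 1" "0 < \<epsilon>" "\<epsilon> < 1"
  shows "log_norm \<epsilon> x > 1/2" "x \<bullet> x + \<epsilon> > 0"
proof -
  show pos: "x \<bullet> x + \<epsilon> > 0" using assms by (simp add: add_nonneg_pos)
  have "ln (x \<bullet> x + \<epsilon>) < ln 2"
    using ball_inner_less_1[OF assms(1)] assms pos by (intro ln_less_cancel_iff[THEN iffD2]) auto
  then show "log_norm \<epsilon> x > 1/2"
    using ln_2_less_1 by (simp add: log_norm_def)
qed

lemma hardy_weight_nonneg: "hardy_weight \<epsilon> x \<ge> 0"
  by (simp add: hardy_weight_def)

lemma hardy_weight_continuous:
  assumes "0 < \<epsilon>" "\<epsilon> < 1"
  shows "continuous_on (ball 0 1) (hardy_weight \<epsilon>)"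
  unfolding hardy_weight_def log_norm_def
  by (intro continuous_intros ballI) (use log_norm_bound[OF _ assms] in \<open>fastforce simp: log_norm_def\<close>)+

text \<open>With r = |x|^2 and \<sigma> = \<open>log_norm \<epsilon> x\<close> one has r \<epsilon>
  \<le> (r + \<epsilon>)^2 and 4 \<sigma>^2 \<ge> 1. Boundedness of the weight is what lets L^2
  convergence carry the inequality from test functions to \<open>H10\<close>.\<close>

lemma hardy_weight_le:
  assumes "x \<in> ball 0 1" "0 < \<epsilon>" "\<epsilon> < 1"
  shows "hardy_weight \<epsilon> x \<le> 1 / \<epsilon>"
proof -
  let ?r = "x \<bullet> x" and ?s = "log_norm \<epsilon> x"
  note b = log_norm_bound[OF assms]
  have "(1/2)\<^sup>2 \<le> ?s\<^sup>2" using b by (intro power_mono) auto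
  then have s: "1 \<le> 4 * ?s\<^sup>2" by (simp add: power2_eq_square)
  have "?r * \<epsilon> \<le> (?r + \<epsilon>)\<^sup>2"
    using assms by (simp add: power2_eq_square algebra_simps)
  also have "\<dots> \<le> (?r + \<epsilon>)\<^sup>2 * (4 * ?s\<^sup>2)"
    using mult_left_mono[OF s, of "(?r + \<epsilon>)\<^sup>2"] by simp
  finally have "?r * \<epsilon> \<le> 4 * ((?r + \<epsilon>) * ?s)\<^sup>2"
    by (simp only: power_mult_distrib mult_ac)
  then have "?r \<le> 1 / \<epsilon> * (4 * ((?r + \<epsilon>) * ?s)\<^sup>2)"
    using assms by (simp add: pos_le_divide_eq)
  moreover have "0 < 4 * ((?r + \<epsilon>) * ?s)\<^sup>2"
    using b by simp
  ultimately show ?thesis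
    unfolding hardy_weight_def by (subst pos_divide_le_eq)
qed

text \<open>
  The vector field \<open>F x = x / (2 \<rho> \<sigma>)\<close> with \<open>\<rho> = |x|\<^sup>2 + \<epsilon>\<close> and \<open>\<sigma> = 1 - ln \<rho> / 2\<close> satisfies
  \<open>div F - |F|\<^sup>2 \<ge> hardy_weight \<epsilon>\<close> in dimension two; expand \<open>|\<nabla>\<phi> + \<phi> F|\<^sup>2 \<ge> 0\<close> and integrate by parts.
\<close>

lemma hardy_test_function:
  fixes \<phi> :: "'a::euclidean_space \<Rightarrow> real"
  assumes dim: "DIM('a) = 2" and \<phi>: "\<phi> \<in> test_functions" and \<epsilon>: "0 < \<epsilon>" "\<epsilon> < 1"
  shows "(\<integral>x. hardy_weight \<epsilon> x * (\<phi> x)\<^sup>2 \<partial>ball_measure) \<le> (\<integral>x. (norm (gradient \<phi> x))\<^sup>2 \<partial>ball_measure)"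
proof -
  obtain K where K: "compact K" "K \<subseteq> ball 0 1" "\<And>x. x \<notin> K \<Longrightarrow> \<phi> x = 0"
    by (rule test_functionsE[OF \<phi>], rule that)
  define \<rho> where "\<rho> x = x \<bullet> x + \<epsilon>" for x :: 'a
  define \<sigma> where "\<sigma> x = log_norm \<epsilon> x" for x :: 'a
  define g where "g x = 1 / (2 * \<rho> x * \<sigma> x)" for x
  \<comment> \<open>Chosen so that \<open>g\<close> has gradient - k(x) x, hence div F = 2 g - k
    |x|^2 in the plane.\<close>
  define k where "k x = (\<sigma> x - 1/2) / (\<rho> x * \<sigma> x)\<^sup>2" for x
  define D where "D x = frechet_derivative \<phi> (at x)" for x
  have pos: "\<rho> x > 0" "\<sigma> x > 1/2" if "x \<in> ball 0 1" for x
    using log_norm_bound[OF that \<epsilon>] by (auto simp: \<rho>_def \<sigma>_def)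
  have D: "(\<phi> has_derivative D x) (at x)" for x
    unfolding D_def by (rule test_function_has_derivative[OF \<phi>])
  have cont: "continuous_on (ball 0 1) \<phi>" "\<And>b. b \<in> Basis \<Longrightarrow> continuous_on (ball 0 1) (\<lambda>x. D x b)"
    using test_function_continuous[OF \<phi>] test_function_derivative_continuous[OF \<phi>]
    by (auto simp: D_def intro: continuous_on_subset)
  have c\<rho>: "continuous_on (ball 0 1) \<rho>"
    unfolding \<rho>_def by (intro continuous_intros)
  have c\<sigma>: "continuous_on (ball 0 1) \<sigma>"
  proof -
    have "x \<bullet> x + \<epsilon> \<noteq> 0" if "x \<in> ball 0 1" for x :: 'a
      using pos(1)[OF that] by (simp add: \<rho>_def)
    then show ?thesis
      unfolding \<sigma>_def log_norm_def by (intro continuous_intros ballI) auto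
  qed
  have nz: "\<forall>x\<in>ball 0 1. 2 * \<rho> x * \<sigma> x \<noteq> 0" "\<forall>x\<in>ball 0 1. (\<rho> x * \<sigma> x)\<^sup>2 \<noteq> 0"
    using pos by fastforce+
  have cg: "continuous_on (ball 0 1) g" and ck: "continuous_on (ball 0 1) k"
    unfolding g_def k_def using nz by (intro continuous_intros c\<rho> c\<sigma>; simp)+
  have dg: "(g has_derivative (\<lambda>h. - (k x * (x \<bullet> h)))) (at x)" if x: "x \<in> ball 0 1" for x
  proof -
    define G where "G q = 1 / (2 * (q + \<epsilon>) * (1 - ln (q + \<epsilon>) / 2))" for q :: real
    define p where "p = x \<bullet> x + \<epsilon>"
    define s where "s = 1 - ln p / 2"
    have ps: "p > 0" "s > 1/2"
      using pos[OF x] by (auto simp: p_def s_def \<rho>_def \<sigma>_def log_norm_def)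
    have "(G has_real_derivative - ((s - 1/2) / (p * s)\<^sup>2) / 2) (at (x \<bullet> x))"
    proof -
      have "((\<lambda>q. 2 * (q + \<epsilon>) * (1 - ln (q + \<epsilon>) / 2)) has_real_derivative 2 * s - 1) (at (x \<bullet> x))"
        using ps by (auto intro!: derivative_eq_intros simp: p_def s_def)
      from DERIV_inverse_fun[OF this] show ?thesis
        using ps unfolding G_def[abs_def] p_def[symmetric] s_def[symmetric]
        by (simp add: inverse_eq_divide power2_eq_square field_simps)
    qed
    moreover have "((\<lambda>x. x \<bullet> x) has_derivative (\<lambda>h. 2 * (x \<bullet> h))) (at x)"
      by (auto intro!: derivative_eq_intros simp: inner_commute)
    ultimately have "((\<lambda>x. G (x \<bullet> x)) has_derivative (\<lambda>h. 2 * (x \<bullet> h) * (- ((s - 1/2) / (p * s)\<^sup>2) / 2))) (at x)"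
      by (rule DERIV_compose_FDERIV)
    moreover have "(\<lambda>x. G (x \<bullet> x)) = g"
      by (simp add: G_def g_def \<rho>_def \<sigma>_def log_norm_def fun_eq_iff)
    moreover have "k x = (s - 1/2) / (p * s)\<^sup>2"
      by (simp add: k_def \<rho>_def \<sigma>_def log_norm_def p_def s_def)
    ultimately show ?thesis by (simp add: mult.commute)
  qed
  \<comment> \<open>The derivative in direction \<open>h\<close> of the component along
    \<open>b\<close> of \<phi>^2 F; its diagonal sum is the divergence, which integrates to
    zero.\<close>
  define P where "P x b h = (\<phi> x)\<^sup>2 * ((x \<bullet> b) * - (k x * (x \<bullet> h)) + (h \<bullet> b) * g x) + 2 * \<phi> x * D x h * ((x \<bullet> b) * g x)" for x b h
  have dP: "((\<lambda>x. (\<phi> x)\<^sup>2 * ((x \<bullet> b) * g x)) has_derivative P x b) (at x)" if "x \<in> ball 0 1" for x b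
  proof -
    have "((\<lambda>x. (\<phi> x)\<^sup>2) has_derivative (\<lambda>h. 2 * \<phi> x * D x h)) (at x)"
      using has_derivative_power[OF D, of 2] by (simp add: mult_ac)
    moreover have "((\<lambda>x. x \<bullet> b) has_derivative (\<lambda>h. h \<bullet> b)) (at x)"
      by (auto intro!: derivative_eq_intros)
    ultimately show ?thesis
      unfolding P_def by (intro has_derivative_mult dg that)
  qed
  have cP: "continuous_on (ball 0 1) (\<lambda>x. P x b b)" if "b \<in> Basis" for b
    unfolding P_def by (intro continuous_intros cont cg ck that)
  have IBP: "integrable ball_measure (\<lambda>x. P x b b)" "(\<integral>x. P x b b \<partial>ball_measure) = 0" if "b \<in> Basis" for b
    using integral_derivative_compact_support[OF open_ball K(1,2) _ dP cP[OF that]] K(3) by auto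
  have int: "integrable ball_measure (\<lambda>x. \<Sum>b\<in>Basis. P x b b)"
    by (intro Bochner_Integration.integrable_sum IBP)
  have zero: "(\<integral>x. (\<Sum>b\<in>Basis. P x b b) \<partial>ball_measure) = 0"
    by (subst Bochner_Integration.integral_sum) (auto simp: IBP)
  have sum: "(\<Sum>b\<in>Basis. P x b b) = (\<phi> x)\<^sup>2 * (2 * g x - k x * (x \<bullet> x)) + 2 * \<phi> x * g x * (gradient \<phi> x \<bullet> x)" for x
  proof -
    have "gradient \<phi> x \<bullet> x = (\<Sum>b\<in>Basis. D x b * (x \<bullet> b))"
      by (subst euclidean_inner) (simp add: gradient_inner_Basis D_def)
    moreover have "x \<bullet> x = (\<Sum>b\<in>Basis. (x \<bullet> b) * (x \<bullet> b))"
      by (rule euclidean_inner)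
    \<comment> \<open>The planar dimension enters Hardy's inequality here.\<close>
    moreover have "(\<Sum>b\<in>(Basis::'a set). b \<bullet> b) = 2"
      using dim by simp
    ultimately show ?thesis
      unfolding P_def
      by (simp add: sum.distrib sum_distrib_left sum_subtractf algebra_simps flip: sum_distrib_right)
  qed
  have intg: "integrable ball_measure (\<lambda>x. (norm (gradient \<phi> x))\<^sup>2)"
    using square_integrable_test_function(2)[OF \<phi>] by (simp add: square_integrable_def)
  have intw: "integrable ball_measure (\<lambda>x. hardy_weight \<epsilon> x * (\<phi> x)\<^sup>2)"
    by (rule integrable_on_compact_support[OF open_ball K(1,2)])
      (use K(3) in \<open>auto intro!: continuous_intros cont hardy_weight_continuous \<epsilon>\<close>)
  have "(\<integral>x. hardy_weight \<epsilon> x * (\<phi> x)\<^sup>2 \<partial>ball_measure)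
      \<le> (\<integral>x. (norm (gradient \<phi> x))\<^sup>2 + (\<Sum>b\<in>Basis. P x b b) \<partial>ball_measure)"
  proof (rule integral_mono[OF intw Bochner_Integration.integrable_add[OF intg int]])
    fix x :: 'a assume "x \<in> space ball_measure"
    then have x: "x \<in> ball 0 1" by (simp add: space_restrict_space)
    let ?r = "x \<bullet> x"
    \<comment> \<open>The surplus of div F - |F|^2 over the weight is computed exactly and turns out
      to be a positive multiple of \<epsilon>.\<close>
    have "2 * g x - k x * ?r - (g x)\<^sup>2 * ?r - hardy_weight \<epsilon> x = \<epsilon> * \<sigma> x / (\<rho> x * \<sigma> x)\<^sup>2"
    proof -
      define M where "M = 1 / (\<rho> x * \<sigma> x)\<^sup>2"
      have "2 * g x = \<rho> x * \<sigma> x * M" "(g x)\<^sup>2 = 1/4 * M"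
        using pos[OF x] by (auto simp: g_def M_def power2_eq_square field_simps)
      moreover have "hardy_weight \<epsilon> x = ?r / 4 * M" "k x = (\<sigma> x - 1/2) * M"
        by (simp_all add: hardy_weight_def k_def M_def \<rho>_def \<sigma>_def)
      ultimately have "2 * g x - k x * ?r - (g x)\<^sup>2 * ?r - hardy_weight \<epsilon> x =
          (\<rho> x * \<sigma> x - (\<sigma> x - 1/2) * ?r - 1/4 * ?r - ?r/4) * M"
        by (simp only:) (simp add: algebra_simps)
      also have "\<rho> x * \<sigma> x - (\<sigma> x - 1/2) * ?r - 1/4 * ?r - ?r/4 = \<epsilon> * \<sigma> x"
        by (simp add: \<rho>_def algebra_simps)
      finally show ?thesis by (simp add: M_def)
    qed
    also have "\<dots> \<ge> 0" using pos[OF x] \<epsilon> by simp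
    finally have "(\<phi> x)\<^sup>2 * hardy_weight \<epsilon> x \<le> (\<phi> x)\<^sup>2 * (2 * g x - k x * ?r - (g x)\<^sup>2 * ?r)"
      by (intro mult_left_mono) auto
    moreover have "0 \<le> (gradient \<phi> x + (\<phi> x * g x) *\<^sub>R x) \<bullet> (gradient \<phi> x + (\<phi> x * g x) *\<^sub>R x)"
      by simp
    then have "0 \<le> (norm (gradient \<phi> x))\<^sup>2 + 2 * \<phi> x * g x * (gradient \<phi> x \<bullet> x) + (\<phi> x)\<^sup>2 * (g x)\<^sup>2 * ?r"
      unfolding power2_norm_eq_inner
      by (simp add: inner_add_left inner_add_right inner_commute power2_eq_square algebra_simps)
    ultimately show "hardy_weight \<epsilon> x * (\<phi> x)\<^sup>2 \<le> (norm (gradient \<phi> x))\<^sup>2 + (\<Sum>b\<in>Basis. P x b b)"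
      unfolding sum by (simp add: algebra_simps)
  qed
  also have "\<dots> = (\<integral>x. (norm (gradient \<phi> x))\<^sup>2 \<partial>ball_measure)"
    using zero by (simp add: Bochner_Integration.integral_add[OF intg int])
  finally show ?thesis .
qed

section \<open>From test functions to \<open>H10\<close>, and removal of the regularisation\<close>

lemma norm_add_sq_le:
  fixes a b :: "'a::real_inner"
  assumes "\<eta> > 0"
  shows "(norm (a + b))\<^sup>2 \<le> (1 + \<eta>) * (norm a)\<^sup>2 + (1 + 1 / \<eta>) * (norm b)\<^sup>2"
proof -
  have "0 \<le> (norm (\<eta> *\<^sub>R a - b))\<^sup>2 / \<eta>" using assms by simp
  also have "\<dots> = \<eta> * (norm a)\<^sup>2 - 2 * (a \<bullet> b) + (norm b)\<^sup>2 / \<eta>"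
    using assms unfolding power2_norm_eq_inner
    by (simp add: inner_diff_left inner_diff_right inner_commute field_simps power2_eq_square)
  finally show ?thesis
    unfolding power2_norm_eq_inner by (simp add: inner_add_left inner_add_right inner_commute algebra_simps)
qed

text \<open>Closeness in \<open>H1_norm\<close> is split into function and gradient, made explicit
  by the almost everywhere identities for u - \<phi>. Approximating within sqrt \<delta> compensates
  the square root in the norm.\<close>

lemma H10_approx:
  assumes "u \<in> H10" "\<delta> > 0"
  obtains \<phi> where "\<phi> \<in> test_functions"
    "(\<integral>x. (l2_repr u x - \<phi> x)\<^sup>2 \<partial>ball_measure) \<le> \<delta>"
    "(\<integral>x. (norm (weak_gradient u x - gradient \<phi> x))\<^sup>2 \<partial>ball_measure) \<le> \<delta>"
proof -
  have "\<exists>\<phi>\<in>test_functions. H1_norm (u - l2_class \<phi>) < sqrt \<delta>"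
    using assms by (auto simp: H10_def)
  then obtain \<phi> where \<phi>: "\<phi> \<in> test_functions" and small: "H1_norm (u - l2_class \<phi>) < sqrt \<delta>"
    by (rule bexE)
  have u: "has_weak_gradient u (weak_gradient u)"
    using assms has_weak_gradient_weak_gradient by (auto simp: H10_def)
  note sq = square_integrable_test_function[OF \<phi>]
  let ?v = "u - l2_class \<phi>"
  have v: "?v = u + (-1) *\<^sub>R l2_class \<phi>" by simp
  have wg: "AE x in ball_measure. weak_gradient ?v x = weak_gradient u x - gradient \<phi> x"
    using weak_gradient_unique[OF has_weak_gradient_add[OF u has_weak_gradient_scaleR[OF has_weak_gradient_test_function[OF \<phi>], of "-1"]]]
    by simp
  have wr: "AE x in ball_measure. l2_repr ?v x = l2_repr u x - \<phi> x"
    using l2_repr_add[of u "(-1) *\<^sub>R l2_class \<phi>"] l2_repr_scaleR[of "-1" "l2_class \<phi>"] l2_repr_class[OF sq(1)]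
    unfolding v by eventually_elim simp
  have vH1: "?v \<in> H1"
    unfolding H1_def v using has_weak_gradient_add[OF u has_weak_gradient_scaleR[OF has_weak_gradient_test_function[OF \<phi>], of "-1"]] by blast
  have m: "l2_repr u \<in> borel_measurable ball_measure" "weak_gradient u \<in> borel_measurable ball_measure"
    "\<phi> \<in> borel_measurable ball_measure" "gradient \<phi> \<in> borel_measurable ball_measure"
    "l2_repr ?v \<in> borel_measurable ball_measure" "weak_gradient ?v \<in> borel_measurable ball_measure"
    using u sq vH1 assms(1)[unfolded H10_def]
    by (auto intro!: square_integrable_measurable square_integrable_l2_repr square_integrable_weak_gradient simp: has_weak_gradient_def)
  have e1: "(\<integral>x. (l2_repr ?v x)\<^sup>2 \<partial>ball_measure) = (\<integral>x. (l2_repr u x - \<phi> x)\<^sup>2 \<partial>ball_measure)"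
    using wr by (intro integral_cong_AE borel_measurable_power borel_measurable_diff m) (auto elim: eventually_mono)
  have e2: "(\<integral>x. (norm (weak_gradient ?v x))\<^sup>2 \<partial>ball_measure) = (\<integral>x. (norm (weak_gradient u x - gradient \<phi> x))\<^sup>2 \<partial>ball_measure)"
  proof (rule integral_cong_AE)
    show "AE x in ball_measure. (norm (weak_gradient ?v x))\<^sup>2 = (norm (weak_gradient u x - gradient \<phi> x))\<^sup>2"
      using wg by eventually_elim simp
  qed (use m in measurable)
  have "(\<integral>x. (l2_repr u x - \<phi> x)\<^sup>2 \<partial>ball_measure)
      + (\<integral>x. (norm (weak_gradient u x - gradient \<phi> x))\<^sup>2 \<partial>ball_measure) < \<delta>"
    using small by (simp add: H1_norm_def e1 e2)
  moreover have "0 \<le> (\<integral>x. (l2_repr u x - \<phi> x)\<^sup>2 \<partial>ball_measure)"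
    "0 \<le> (\<integral>x. (norm (weak_gradient u x - gradient \<phi> x))\<^sup>2 \<partial>ball_measure)"
    by (auto intro: integral_nonneg_AE)
  ultimately show ?thesis using that[OF \<phi>] by linarith
qed

lemma square_integrable_diff:
  assumes "square_integrable f" "square_integrable g"
  shows "square_integrable (\<lambda>x. f x - g x)"
  using square_integrable_add[OF assms(1) square_integrable_scaleR[OF assms(2), of "-1"]] by simp

text \<open>Young's inequality with parameter \<eta>, applied to f = g + (f - g). The factor 1 +
  \<eta> can be taken arbitrarily close to 1, so the sharp constant survives approximation.\<close>

lemma integral_norm_sq_le:
  fixes f g :: "'a::euclidean_space \<Rightarrow> 'b::euclidean_space"
  assumes f: "square_integrable f" and g: "square_integrable g" and "\<eta> > 0"
    and w: "w \<in> borel_measurable ball_measure" "\<And>x. x \<in> ball 0 1 \<Longrightarrow> 0 \<le> w x \<and> w x \<le> C"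
  shows "(\<integral>x. w x * (norm (f x))\<^sup>2 \<partial>ball_measure) \<le>
    (1 + \<eta>) * (\<integral>x. w x * (norm (g x))\<^sup>2 \<partial>ball_measure)
      + (1 + 1 / \<eta>) * C * (\<integral>x. (norm (f x - g x))\<^sup>2 \<partial>ball_measure)"
proof -
  have int: "integrable ball_measure (\<lambda>x. w x * (norm (h x))\<^sup>2)" if "square_integrable h" for h :: "'a \<Rightarrow> 'b"
  proof (rule Bochner_Integration.integrable_bound)
    show "integrable ball_measure (\<lambda>x. C * (norm (h x))\<^sup>2)"
      using that by (simp add: square_integrable_def)
    show "(\<lambda>x. w x * (norm (h x))\<^sup>2) \<in> borel_measurable ball_measure"
      using w(1) square_integrable_measurable[OF that] by measurable
    show "AE x in ball_measure. norm (w x * (norm (h x))\<^sup>2) \<le> norm (C * (norm (h x))\<^sup>2)"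
      by (rule AE_I2) (use w(2) in \<open>fastforce simp: space_restrict_space abs_mult intro!: mult_right_mono\<close>)
  qed
  have intd: "integrable ball_measure (\<lambda>x. (norm (f x - g x))\<^sup>2)"
    using square_integrable_diff[OF f g] by (simp add: square_integrable_def)
  have "(\<integral>x. w x * (norm (f x))\<^sup>2 \<partial>ball_measure) \<le>
      (\<integral>x. (1 + \<eta>) * (w x * (norm (g x))\<^sup>2) + (1 + 1 / \<eta>) * C * (norm (f x - g x))\<^sup>2 \<partial>ball_measure)"
  proof (rule integral_mono[OF int[OF f]])
    fix x :: 'a assume "x \<in> space ball_measure"
    then have wx: "0 \<le> w x" "w x \<le> C" using w(2) by (auto simp: space_restrict_space)
    have "w x * (norm (f x))\<^sup>2 \<le> w x * ((1 + \<eta>) * (norm (g x))\<^sup>2 + (1 + 1 / \<eta>) * (norm (f x - g x))\<^sup>2)"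
      using norm_add_sq_le[OF \<open>\<eta> > 0\<close>, of "g x" "f x - g x"] wx by (intro mult_left_mono) auto
    also have "\<dots> = (1 + \<eta>) * (w x * (norm (g x))\<^sup>2) + w x * ((1 + 1 / \<eta>) * (norm (f x - g x))\<^sup>2)"
      by (simp add: algebra_simps)
    also have "w x * ((1 + 1 / \<eta>) * (norm (f x - g x))\<^sup>2) \<le> C * ((1 + 1 / \<eta>) * (norm (f x - g x))\<^sup>2)"
      using wx \<open>\<eta> > 0\<close> by (intro mult_right_mono) auto
    finally show "w x * (norm (f x))\<^sup>2 \<le> (1 + \<eta>) * (w x * (norm (g x))\<^sup>2) + (1 + 1 / \<eta>) * C * (norm (f x - g x))\<^sup>2"
      by (simp only: mult_ac)
  qed (intro Bochner_Integration.integrable_add integrable_mult_right int[OF g] intd)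
  also have "\<dots> = (1 + \<eta>) * (\<integral>x. w x * (norm (g x))\<^sup>2 \<partial>ball_measure)
      + (1 + 1 / \<eta>) * C * (\<integral>x. (norm (f x - g x))\<^sup>2 \<partial>ball_measure)"
    using Bochner_Integration.integral_add[OF integrable_mult_right[OF int[OF g], of "1 + \<eta>"]
        integrable_mult_right[OF intd, of "(1 + 1 / \<eta>) * C"]] by simp
  finally show ?thesis .
qed

lemma hardy_regularized:
  fixes u :: "'a::euclidean_space l2_ball"
  assumes dim: "DIM('a) = 2" and u: "u \<in> H10" and \<epsilon>: "0 < \<epsilon>" "\<epsilon> < 1"
  shows "(\<integral>x. hardy_weight \<epsilon> x * (l2_repr u x)\<^sup>2 \<partial>ball_measure)
    \<le> (\<integral>x. (norm (weak_gradient u x))\<^sup>2 \<partial>ball_measure)" (is "?L \<le> ?A")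
proof -
  have wg: "square_integrable (weak_gradient u)"
    using u square_integrable_weak_gradient by (auto simp: H10_def)
  have wm: "(hardy_weight \<epsilon> :: 'a \<Rightarrow> real) \<in> borel_measurable ball_measure"
  proof -
    have "(\<lambda>x::'a. if x \<in> ball 0 1 then hardy_weight \<epsilon> x else 0) \<in> borel_measurable borel"
      by (rule borel_measurable_continuous_on_if) (use hardy_weight_continuous[OF \<epsilon>] in auto)
    then have "(\<lambda>x::'a. if x \<in> ball 0 1 then hardy_weight \<epsilon> x else 0) \<in> borel_measurable ball_measure"
      by (intro measurable_restrict_space1 measurable_completion) simp
    then show ?thesis
      by (rule measurable_cong[THEN iffD1, rotated]) (simp add: space_restrict_space)
  qed
  \<comment> \<open>The perturbation estimate is applied twice: from \<open>u\<close> to a test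
    function on the weighted side, and back from its gradient to that of \<open>u\<close>.\<close>
  have step: "?L \<le> (1 + \<eta>) * ((1 + \<eta>) * ?A + (1 + 1 / \<eta>) * \<delta>) + (1 + 1 / \<eta>) * (1 / \<epsilon>) * \<delta>"
    if pos: "\<eta> > 0" "\<delta> > 0" for \<eta> \<delta>
  proof -
    obtain \<phi> where \<phi>: "\<phi> \<in> test_functions"
      "(\<integral>x. (l2_repr u x - \<phi> x)\<^sup>2 \<partial>ball_measure) \<le> \<delta>"
      "(\<integral>x. (norm (weak_gradient u x - gradient \<phi> x))\<^sup>2 \<partial>ball_measure) \<le> \<delta>"
      by (rule H10_approx[OF u \<open>\<delta> > 0\<close>])
    note sq = square_integrable_test_function[OF \<phi>(1)]
    have "?L \<le> (1 + \<eta>) * (\<integral>x. hardy_weight \<epsilon> x * (\<phi> x)\<^sup>2 \<partial>ball_measure)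
        + (1 + 1 / \<eta>) * (1 / \<epsilon>) * (\<integral>x. (l2_repr u x - \<phi> x)\<^sup>2 \<partial>ball_measure)"
      using integral_norm_sq_le[OF square_integrable_l2_repr[of u] sq(1) pos(1) wm conjI,
          OF hardy_weight_nonneg hardy_weight_le[OF _ \<epsilon>]] by simp
    also have "\<dots> \<le> (1 + \<eta>) * (\<integral>x. (norm (gradient \<phi> x))\<^sup>2 \<partial>ball_measure) + (1 + 1 / \<eta>) * (1 / \<epsilon>) * \<delta>"
      using pos \<epsilon> \<phi> hardy_test_function[OF dim \<phi>(1) \<epsilon>] by (intro add_mono mult_left_mono) auto
    also have "(\<integral>x. (norm (gradient \<phi> x))\<^sup>2 \<partial>ball_measure) \<le> (1 + \<eta>) * ?A
        + (1 + 1 / \<eta>) * (\<integral>x. (norm (weak_gradient u x - gradient \<phi> x))\<^sup>2 \<partial>ball_measure)"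
      using integral_norm_sq_le[OF sq(2) wg pos(1), of "\<lambda>_. 1" 1] by (simp add: norm_minus_commute)
    also have "\<dots> \<le> (1 + \<eta>) * ?A + (1 + 1 / \<eta>) * \<delta>"
      using pos \<phi> by (intro add_mono mult_left_mono) auto
    finally show ?thesis using pos by simp
  qed
  \<comment> \<open>The order of the limits matters: the error contains \<delta> / \<eta>, so
    \<delta> tends to 0 at fixed \<eta> before \<eta> does.\<close>
  have "?L \<le> (1 + \<eta>) * ((1 + \<eta>) * ?A)" if "\<eta> > 0" for \<eta>
  proof (rule tendsto_lowerbound)
    show "((\<lambda>\<delta>. (1 + \<eta>) * ((1 + \<eta>) * ?A + (1 + 1 / \<eta>) * \<delta>) + (1 + 1 / \<eta>) * (1 / \<epsilon>) * \<delta>)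
        \<longlongrightarrow> (1 + \<eta>) * ((1 + \<eta>) * ?A)) (at_right 0)"
      by (rule tendsto_eq_intros refl | simp)+
  qed (use step[OF that] in \<open>auto simp: eventually_at_filter\<close>)
  then have ev: "eventually (\<lambda>\<eta>. ?L \<le> (1 + \<eta>) * ((1 + \<eta>) * ?A)) (at_right 0)"
    by (auto simp: eventually_at_filter)
  show ?thesis
  proof (rule tendsto_lowerbound[OF _ ev])
    show "((\<lambda>\<eta>. (1 + \<eta>) * ((1 + \<eta>) * ?A)) \<longlongrightarrow> ?A) (at_right 0)"
      by (rule tendsto_eq_intros refl | simp)+
  qed simp
qed

lemma hardy_weight_tendsto:
  fixes x :: "'a::euclidean_space"
  assumes x: "x \<in> ball 0 1"
  shows "(\<lambda>n. hardy_weight (1 / (real n + 2)) x) \<longlonglongrightarrow> 1 / (4 * ((norm x)\<^sup>2 * (1 - ln (norm x))\<^sup>2))"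
proof (cases "x = 0")
  case False
  then have r: "norm x > 0" "norm x < 1" using x by auto
  then have "ln (norm x) < 0" by (intro ln_less_zero)
  then have l: "1 - ln (norm x) > 0" by linarith
  have eq: "1 - ln ((norm x)\<^sup>2) / 2 = 1 - ln (norm x)"
    using r by (simp add: ln_realpow)
  have e: "(\<lambda>n. 1 / (real n + 2)) \<longlonglongrightarrow> 0" by real_asymp
  have "(\<lambda>n. hardy_weight (1 / (real n + 2)) x) \<longlonglongrightarrow>
      (norm x)\<^sup>2 / (4 * (((norm x)\<^sup>2 + 0) * (1 - ln ((norm x)\<^sup>2 + 0) / 2))\<^sup>2)"
    unfolding hardy_weight_def log_norm_def power2_norm_eq_inner[symmetric]
    using r l eq by (intro tendsto_intros e) auto
  moreover have "(norm x)\<^sup>2 / (4 * (((norm x)\<^sup>2 + 0) * (1 - ln ((norm x)\<^sup>2 + 0) / 2))\<^sup>2)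
      = 1 / (4 * ((norm x)\<^sup>2 * (1 - ln (norm x))\<^sup>2))"
  proof -
    have "q / (4 * (q * s)\<^sup>2) = 1 / (4 * (q * s\<^sup>2))" if "q > 0" for q s :: real
      using that by (simp add: power2_eq_square)
    then show ?thesis unfolding add_0_right eq using r by simp
  qed
  ultimately show ?thesis by simp
qed (simp add: hardy_weight_def)

text \<open>The right-hand side of the regularised inequality does not depend on \<epsilon>, so
  Fatou's lemma passes to the limit. Nonnegative integrals are used because integrability of the
  singular integrand is not known beforehand.\<close>

lemma hardy_H10:
  fixes u :: "'a::euclidean_space l2_ball"
  assumes dim: "DIM('a) = 2" and u: "u \<in> H10"
  shows "(\<integral>x. 1 / (4 * ((norm x)\<^sup>2 * (1 - ln (norm x))\<^sup>2)) * (l2_repr u x)\<^sup>2 \<partial>ball_measure)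
    \<le> (\<integral>x. (norm (weak_gradient u x))\<^sup>2 \<partial>ball_measure)" (is "(\<integral>x. ?W x * _ \<partial>_) \<le> ?A")
proof -
  \<comment> \<open>The offset 2 keeps every parameter strictly between 0 and 1, as the regularised
    inequality demands.\<close>
  define e where "e n = 1 / (real n + 2)" for n :: nat
  have e: "0 < e n" "e n < 1" for n by (auto simp: e_def)
  let ?f = "\<lambda>n x. ennreal (hardy_weight (e n) x * (l2_repr u x)\<^sup>2)"
  have m: "l2_repr u \<in> borel_measurable ball_measure"
    by (rule square_integrable_measurable[OF square_integrable_l2_repr])
  have norm_m: "(norm :: 'a \<Rightarrow> real) \<in> borel_measurable ball_measure"
    by (intro borel_measurable_ball_continuous continuous_intros)
  have inner_m: "(\<lambda>x::'a. x \<bullet> x) \<in> borel_measurable ball_measure"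
    by (intro borel_measurable_ball_continuous continuous_intros)
  have wm: "(hardy_weight \<epsilon> :: 'a \<Rightarrow> real) \<in> borel_measurable ball_measure" for \<epsilon>
    unfolding hardy_weight_def[abs_def] log_norm_def using inner_m by measurable
  have Wm: "(?W :: 'a \<Rightarrow> real) \<in> borel_measurable ball_measure"
    using norm_m by measurable
  have bound: "(\<integral>\<^sup>+x. ?f n x \<partial>ball_measure) \<le> ennreal ?A" for n
  proof -
    have int: "integrable ball_measure (\<lambda>x. hardy_weight (e n) x * (l2_repr u x)\<^sup>2)"
    proof (rule Bochner_Integration.integrable_bound)
      show "integrable ball_measure (\<lambda>x. 1 / e n * (l2_repr u x)\<^sup>2)"
        using square_integrable_l2_repr[of u] by (simp add: square_integrable_def)
      show "(\<lambda>x. hardy_weight (e n) x * (l2_repr u x)\<^sup>2) \<in> borel_measurable ball_measure"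
        using wm m by measurable
      show "AE x in ball_measure. norm (hardy_weight (e n) x * (l2_repr u x)\<^sup>2) \<le> norm (1 / e n * (l2_repr u x)\<^sup>2)"
      proof (rule AE_I2)
        fix x :: 'a assume "x \<in> space ball_measure"
        then have "hardy_weight (e n) x \<le> 1 / e n"
          using e[of n] by (intro hardy_weight_le) (auto simp: space_restrict_space)
        then show "norm (hardy_weight (e n) x * (l2_repr u x)\<^sup>2) \<le> norm (1 / e n * (l2_repr u x)\<^sup>2)"
          using hardy_weight_nonneg[of "e n" x] e(1)[of n] mult_right_mono[of "hardy_weight (e n) x" "1 / e n" "(l2_repr u x)\<^sup>2"]
          by (simp add: abs_mult)
      qed
    qed
    have "(\<integral>\<^sup>+x. ?f n x \<partial>ball_measure) = ennreal (\<integral>x. hardy_weight (e n) x * (l2_repr u x)\<^sup>2 \<partial>ball_measure)"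
      by (rule nn_integral_eq_integral[OF int]) (simp add: hardy_weight_nonneg)
    also have "\<dots> \<le> ennreal ?A"
      by (rule ennreal_leI[OF hardy_regularized[OF dim u e]])
    finally show ?thesis .
  qed
  have "(\<integral>\<^sup>+x. ennreal (?W x * (l2_repr u x)\<^sup>2) \<partial>ball_measure) = (\<integral>\<^sup>+x. liminf (\<lambda>n. ?f n x) \<partial>ball_measure)"
  proof (rule nn_integral_cong)
    fix x :: 'a assume "x \<in> space ball_measure"
    then have x: "x \<in> ball 0 1" by (simp add: space_restrict_space)
    have "(\<lambda>n. ?f n x) \<longlonglongrightarrow> ennreal (?W x * (l2_repr u x)\<^sup>2)"
      using hardy_weight_tendsto[OF x] unfolding e_def by (intro tendsto_ennrealI tendsto_mult tendsto_const)
    then show "ennreal (?W x * (l2_repr u x)\<^sup>2) = liminf (\<lambda>n. ?f n x)"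
      by (simp add: lim_imp_Liminf)
  qed
  also have "\<dots> \<le> liminf (\<lambda>n. \<integral>\<^sup>+x. ?f n x \<partial>ball_measure)"
    by (intro nn_integral_liminf measurable_compose[OF borel_measurable_times[OF wm borel_measurable_power[OF m]] measurable_ennreal])
  also have "\<dots> \<le> ennreal ?A"
    using bound by (intro Liminf_le) (auto intro: always_eventually)
  finally have "enn2real (\<integral>\<^sup>+x. ennreal (?W x * (l2_repr u x)\<^sup>2) \<partial>ball_measure) \<le> ?A"
    by (intro enn2real_leI) (auto intro: integral_nonneg_AE)
  moreover have "(\<integral>x. ?W x * (l2_repr u x)\<^sup>2 \<partial>ball_measure) = enn2real (\<integral>\<^sup>+x. ennreal (?W x * (l2_repr u x)\<^sup>2) \<partial>ball_measure)"
    by (intro integral_eq_nn_integral borel_measurable_times[OF Wm borel_measurable_power[OF m]]) (auto intro!: AE_I2)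
  ultimately show ?thesis by simp
qed

text \<open>Hardy's inequality carries the weight with constant 1/4, so the potential term is at
  most 4 c \<le> 1 times the Dirichlet integral.\<close>

lemma quadratic_form_nonneg:
  fixes U :: "'a::euclidean_space \<Rightarrow> real"
  assumes dim: "DIM('a) = 2" and u: "u \<in> H10" and c: "0 \<le> c" "c \<le> 1/4"
    and potential: "\<And>x. x \<in> ball 0 1 \<Longrightarrow>
      l * V (norm x) * deriv f (U x) = c / ((norm x)\<^sup>2 * (1 - ln (norm x))\<^sup>2)"
  shows "quadratic_form l V f U u \<ge> 0"
proof -
  let ?W = "\<lambda>x::'a. 1 / (4 * ((norm x)\<^sup>2 * (1 - ln (norm x))\<^sup>2))"
  have "(\<integral>x. l * V (norm x) * deriv f (U x) * (l2_repr u x)\<^sup>2 \<partial>ball_measure)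
      = (\<integral>x. 4 * c * (?W x * (l2_repr u x)\<^sup>2) \<partial>ball_measure)"
    by (rule Bochner_Integration.integral_cong) (auto simp: space_restrict_space potential)
  also have "\<dots> = 4 * c * (\<integral>x. ?W x * (l2_repr u x)\<^sup>2 \<partial>ball_measure)"
    by (rule integral_mult_right_zero)
  also have "\<dots> \<le> 1 * (\<integral>x. ?W x * (l2_repr u x)\<^sup>2 \<partial>ball_measure)"
    using c by (intro mult_right_mono) (auto intro: integral_nonneg_AE)
  also have "\<dots> \<le> (\<integral>x. (norm (weak_gradient u x))\<^sup>2 \<partial>ball_measure)"
    using hardy_H10[OF dim u] by simp
  finally show ?thesis by (simp add: quadratic_form_def)
qed

section \<open>Radial trial functions\<close>

definition flat_exp' :: "real \<Rightarrow> real"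
  where "flat_exp' y = flat_exp y / y ^ 2"

text \<open>Like \<open>flat_exp'\<close>, correct on the whole line without a case distinction,
  because \<open>flat_exp\<close> vanishes for y \<le> 0.\<close>

definition flat_exp'' :: "real \<Rightarrow> real"
  where "flat_exp'' y = flat_exp y * (1 / y ^ 4 - 2 / y ^ 3)"

lemma DERIV_flat_exp: "(flat_exp has_real_derivative flat_exp' y) (at y)"
proof -
  have "(\<lambda>y. if y > 0 then poly 1 (1 / y) * exp (- 1 / y) else 0) = flat_exp"
    by (auto simp: flat_exp_def)
  then show ?thesis
    using flat_poly_DERIV[of 1 y] by (auto simp: flat_exp_def flat_exp'_def power2_eq_square split: if_splits)
qed

lemma DERIV_flat_exp': "(flat_exp' has_real_derivative flat_exp'' y) (at y)"
  and continuous_flat_exp'': "continuous_on UNIV flat_exp''"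
proof -
  let ?q = "[:0, 0, 1:] :: real poly"
  let ?Q = "\<lambda>p y::real. if y > 0 then poly p (1 / y) * exp (- 1 / y) else 0"
  have 1: "?Q ?q = flat_exp'"
    by (auto simp: flat_exp_def flat_exp'_def power2_eq_square)
  have 2: "?Q (?q * (?q - pderiv ?q)) = flat_exp''"
    by (auto simp: flat_exp_def flat_exp''_def pderiv_pCons power4_eq_xxxx power3_eq_cube field_simps)
  show "(flat_exp' has_real_derivative flat_exp'' y) (at y)"
    using flat_poly_DERIV[of ?q y] unfolding 1[symmetric] 2[symmetric] .
  show "continuous_on UNIV flat_exp''"
    unfolding 2[symmetric]
    by (rule continuous_at_imp_continuous_on) (use flat_poly_DERIV DERIV_isCont in blast)
qed

definition bump :: "real \<Rightarrow> real"
  where "bump y = flat_exp y * flat_exp (1 - y)"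

definition bump' :: "real \<Rightarrow> real"
  where "bump' y = flat_exp' y * flat_exp (1 - y) - flat_exp y * flat_exp' (1 - y)"

definition bump'' :: "real \<Rightarrow> real"
  where "bump'' y = flat_exp'' y * flat_exp (1 - y) - 2 * flat_exp' y * flat_exp' (1 - y)
    + flat_exp y * flat_exp'' (1 - y)"

lemma DERIV_bump: "(bump has_real_derivative bump' y) (at y)"
  and DERIV_bump': "(bump' has_real_derivative bump'' y) (at y)"
proof -
  have r: "((\<lambda>y. 1 - y) has_real_derivative -1) (at y)" for y :: real
    by (auto intro!: derivative_eq_intros)
  have 0: "((\<lambda>y. flat_exp (1 - y)) has_real_derivative - flat_exp' (1 - y)) (at y)" for y
    using DERIV_chain2[OF DERIV_flat_exp r] by simp
  have 1: "((\<lambda>y. flat_exp' (1 - y)) has_real_derivative - flat_exp'' (1 - y)) (at y)" for y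
    using DERIV_chain2[OF DERIV_flat_exp' r] by simp
  show "(bump has_real_derivative bump' y) (at y)"
    unfolding bump_def[abs_def] bump'_def
    using DERIV_mult[OF DERIV_flat_exp 0] by (simp add: algebra_simps)
  show "(bump' has_real_derivative bump'' y) (at y)"
    unfolding bump'_def[abs_def] bump''_def
    using DERIV_diff[OF DERIV_mult[OF DERIV_flat_exp' 0] DERIV_mult[OF DERIV_flat_exp 1]]
    by (simp add: algebra_simps)
qed

lemma continuous_bump'': "continuous_on UNIV bump''"
proof -
  have c: "continuous_on UNIV flat_exp" "continuous_on UNIV flat_exp'"
    using DERIV_flat_exp DERIV_flat_exp' by (auto intro!: continuous_at_imp_continuous_on DERIV_isCont)
  have "continuous_on UNIV (\<lambda>y. f (1 - y))" if "continuous_on UNIV f" for f :: "real \<Rightarrow> real"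
    by (intro continuous_on_compose2[OF that] continuous_intros) auto
  then show ?thesis
    unfolding bump''_def[abs_def] using c continuous_flat_exp'' by (intro continuous_intros) auto
qed

lemma bump_nonzero_iff: "bump y \<noteq> 0 \<longleftrightarrow> 0 < y \<and> y < 1"
  by (simp add: bump_def flat_exp_def)

lemma bump_nonneg: "bump y \<ge> 0"
  by (simp add: bump_def flat_exp_range)

text \<open>Every summand of \<open>bump''\<close> is a multiple of
  \<open>flat_exp y * flat_exp (1 - y)\<close>.\<close>

lemma bump''_zero: "bump y = 0 \<Longrightarrow> bump'' y = 0"
  by (auto simp: bump_def bump''_def flat_exp'_def flat_exp''_def)

text \<open>For a = 1/y and b = 1/(1 - y) the left side is the quotient of \<open>bump''\<close> by
  \<open>bump\<close>, since a^2 - b^2 is the logarithmic derivative of the bump. The constant is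
  144 = 16 * 9: only a < 4 is critical, where a^2 \<le> 16 and (4 - a)(a + 2) = 9 - (a - 1)^2 \<le>
  9.\<close>

lemma bump''_factor_bound:
  fixes a b :: real
  assumes "0 \<le> b" "b \<le> 2" "2 \<le> a"
  shows "(a\<^sup>2 - b\<^sup>2)\<^sup>2 - 2 * a ^ 3 - 2 * b ^ 3 \<ge> - 144"
proof -
  have b: "b\<^sup>2 \<le> 4" "b ^ 3 \<le> 8"
    using power_mono[OF assms(2,1), of 2] power_mono[OF assms(2,1), of 3] by auto
  have a: "a\<^sup>2 \<ge> 4"
    using power_mono[OF assms(3), of 2] by simp
  have "(a\<^sup>2 - 4)\<^sup>2 \<le> (a\<^sup>2 - b\<^sup>2)\<^sup>2"
    using a b by (intro power_mono) auto
  moreover have "(a\<^sup>2 - 4)\<^sup>2 - 2 * a ^ 3 - 16 = a\<^sup>2 * ((a - 4) * (a + 2))"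
    by (simp add: power2_eq_square power3_eq_cube algebra_simps)
  moreover have "a\<^sup>2 * ((a - 4) * (a + 2)) \<ge> - 144"
  proof (cases "a \<ge> 4")
    case True
    then have "0 \<le> a\<^sup>2 * ((a - 4) * (a + 2))" by simp
    then show ?thesis by simp
  next
    case False
    then have "a\<^sup>2 \<le> 4\<^sup>2" using assms by (intro power_mono) auto
    moreover have "(4 - a) * (a + 2) \<le> 9"
      using zero_le_power2[of "a - 1"] by (simp add: power2_eq_square algebra_simps)
    moreover have "0 \<le> (4 - a) * (a + 2)" using False assms by simp
    ultimately have "a\<^sup>2 * ((4 - a) * (a + 2)) \<le> 16 * 9"
      by (intro mult_mono) auto
    moreover have "a\<^sup>2 * ((a - 4) * (a + 2)) = - (a\<^sup>2 * ((4 - a) * (a + 2)))"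
      by (simp add: algebra_simps)
    ultimately show ?thesis by linarith
  qed
  ultimately show ?thesis using b by linarith
qed

text \<open>One of 1/y and 1/(1 - y) is at least 2, the other at most 2, and the factor is symmetric
  in them. Stretching the bump by \<open>L\<close> turns the constant into 144 / L^2, which is small
  for a slowly varying profile.\<close>

lemma bump''_ge: "bump'' y \<ge> - 144 * bump y"
proof (cases "bump y = 0")
  case False
  then have y: "0 < y" "y < 1" by (auto simp: bump_nonzero_iff)
  define a b where "a = 1 / y" and "b = 1 / (1 - y)"
  have "bump'' y = bump y * ((a\<^sup>2 - b\<^sup>2)\<^sup>2 - 2 * a ^ 3 - 2 * b ^ 3)"
    unfolding bump''_def bump_def flat_exp'_def flat_exp''_def a_def b_def
    by (simp add: power_divide algebra_simps power2_eq_square power4_eq_xxxx)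
  moreover have "(a\<^sup>2 - b\<^sup>2)\<^sup>2 - 2 * a ^ 3 - 2 * b ^ 3 \<ge> - 144"
  proof (cases "y \<le> 1/2")
    case True
    then show ?thesis
      using y by (intro bump''_factor_bound) (auto simp: a_def b_def field_simps)
  next
    case False
    then have "(b\<^sup>2 - a\<^sup>2)\<^sup>2 - 2 * b ^ 3 - 2 * a ^ 3 \<ge> - 144"
      using y by (intro bump''_factor_bound) (auto simp: a_def b_def field_simps)
    then show ?thesis by (simp add: power2_commute)
  qed
  then have "bump y * - 144 \<le> bump y * ((a\<^sup>2 - b\<^sup>2)\<^sup>2 - 2 * a ^ 3 - 2 * b ^ 3)"
    by (intro mult_left_mono bump_nonneg)
  ultimately show ?thesis by (simp add: mult.commute)
qed (simp add: bump''_zero)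

section \<open>The logarithmic coordinate t = ln (1 - ln |x|) on the punctured ball\<close>

lemma log_norm_0: "log_norm 0 x = 1 - ln (norm x)"
proof (cases "x = 0")
  case False
  have "ln (x \<bullet> x) = ln ((norm x)\<^sup>2)" by (simp add: power2_norm_eq_inner)
  also have "\<dots> = 2 * ln (norm x)" using False by (simp add: ln_realpow)
  finally show ?thesis by (simp add: log_norm_def)
qed (simp add: log_norm_def)

lemma log_norm_0_gt_1: "x \<in> ball 0 1 - {0} \<Longrightarrow> log_norm 0 x > 1"
  using ln_less_zero[of "norm x"] by (simp add: log_norm_0)

text \<open>The set \<alpha> \<le> t \<le> \<beta> in terms of radii: |x| = exp (1 - exp t)
  decreases in t, so \<beta> determines the inner radius. Stated through the norm, it is visibly
  compact.\<close>

definition annulus :: "real \<Rightarrow> real \<Rightarrow> 'a::euclidean_space set"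
  where "annulus \<alpha> \<beta> = {x. exp (1 - exp \<beta>) \<le> norm x \<and> norm x \<le> exp (1 - exp \<alpha>)}"

lemma annulus_compact: "compact (annulus \<alpha> \<beta>)"
proof -
  have "annulus \<alpha> \<beta> = cball 0 (exp (1 - exp \<alpha>)) - ball 0 (exp (1 - exp \<beta>))"
    by (auto simp: annulus_def)
  then show ?thesis using compact_diff[OF compact_cball open_ball] by metis
qed

lemma annulus_subset: "\<alpha> > 0 \<Longrightarrow> annulus \<alpha> \<beta> \<subseteq> ball 0 1 - {0}"
proof -
  assume "\<alpha> > 0"
  then have "exp (1 - exp \<alpha>) < 1" by simp
  moreover have "exp (1 - exp \<beta>) > 0" by simp
  ultimately show ?thesis unfolding annulus_def by (auto simp del: exp_gt_zero exp_less_one_iff)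
qed

lemma annulus_iff:
  assumes "x \<in> ball 0 1 - {0}"
  shows "x \<in> annulus \<alpha> \<beta> \<longleftrightarrow> \<alpha> \<le> ln (log_norm 0 x) \<and> ln (log_norm 0 x) \<le> \<beta>"
proof -
  have n: "norm x > 0" using assms by auto
  have s: "log_norm 0 x > 0" using log_norm_0_gt_1[OF assms] by simp
  have "exp (1 - exp \<beta>) \<le> norm x \<longleftrightarrow> 1 - exp \<beta> \<le> ln (norm x)"
    using n by (simp add: ln_ge_iff)
  also have "\<dots> \<longleftrightarrow> log_norm 0 x \<le> exp \<beta>" by (auto simp: log_norm_0)
  also have "\<dots> \<longleftrightarrow> ln (log_norm 0 x) \<le> \<beta>" using s by (metis exp_le_cancel_iff exp_ln)
  finally have 1: "exp (1 - exp \<beta>) \<le> norm x \<longleftrightarrow> ln (log_norm 0 x) \<le> \<beta>" .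
  have "norm x \<le> exp (1 - exp \<alpha>) \<longleftrightarrow> ln (norm x) \<le> 1 - exp \<alpha>"
    using n by (metis exp_le_cancel_iff exp_ln)
  also have "\<dots> \<longleftrightarrow> exp \<alpha> \<le> log_norm 0 x" by (auto simp: log_norm_0)
  also have "\<dots> \<longleftrightarrow> \<alpha> \<le> ln (log_norm 0 x)" using s by (simp add: ln_ge_iff)
  finally show ?thesis using 1 by (auto simp: annulus_def)
qed

text \<open>The default 0 at the origin and outside the ball is the smooth extension whenever the
  profile is smooth and supported in a compact interval of positive t.\<close>

definition radial :: "(real \<Rightarrow> real) \<Rightarrow> 'a::euclidean_space \<Rightarrow> real"
  where "radial X x = (if x \<in> ball 0 1 - {0} then exp (ln (log_norm 0 x) / 2) * X (ln (log_norm 0 x)) else 0)"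

lemma radial_zero_outside_annulus:
  assumes "\<And>t. t \<notin> {\<alpha>..\<beta>} \<Longrightarrow> X t = 0" "x \<notin> annulus \<alpha> \<beta>"
  shows "radial X x = 0"
  using assms annulus_iff[of x \<alpha> \<beta>] by (auto simp: radial_def)

text \<open>On the punctured ball the function is a composition of smooth maps; off the annulus it
  is zero; these two open sets cover the space. The condition j \<ge> 1 keeps t \<ge> L > 0 on the
  support, hence the support away from the unit sphere.\<close>

lemma radial_bump_test_function:
  assumes L: "L > 0" and j: "j \<ge> 1"
  shows "radial (\<lambda>t. bump (t / L - j)) \<in> (test_functions :: ('a::euclidean_space \<Rightarrow> real) set)" (is "?f \<in> _")
proof -
  let ?K = "annulus (L * j) (L * (j + 1)) :: 'a set" and ?S = "ball 0 1 - {0} :: 'a set"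
  have X0: "bump (t / L - j) = 0" if "t \<notin> {L * j..L * (j + 1)}" for t
    using that L bump_nonzero_iff[of "t / L - j"] by (auto simp: field_simps)
  have zero: "?f x = 0" if "x \<notin> ?K" for x
    by (rule radial_zero_outside_annulus[OF X0 that])
  have sub: "?K \<subseteq> ?S" using L j by (intro annulus_subset) auto
  have S: "open ?S" by (intro open_Diff) auto
  have "Ck_on n ?S ?f" for n
  proof -
    have sq: "x \<bullet> x > 0" if "x \<in> ?S" for x using that by simp
    have "Ck_on n ?S (\<lambda>x. 1 + (- 1/2) * ln (x \<bullet> x))"
      by (intro Ck_on_add Ck_on_mult Ck_on_const Ck_on_ln Ck_on_inner_self S sq)
    then have "Ck_on n ?S (log_norm 0)"
      by (simp add: log_norm_def[abs_def])
    then have t: "Ck_on n ?S (\<lambda>x. ln (log_norm 0 x))"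
      using log_norm_0_gt_1 by (intro Ck_on_ln S) (auto intro: less_trans[OF zero_less_one])
    have l: "Ck_on n ?S (\<lambda>x. p * ln (log_norm 0 x) + q)" for p q
      by (intro Ck_on_add Ck_on_mult Ck_on_const t S)
    have "Ck_on n ?S (\<lambda>x. exp (1/2 * ln (log_norm 0 x) + 0) *
        (flat_exp (1 / L * ln (log_norm 0 x) + - j) * flat_exp ((- 1 / L) * ln (log_norm 0 x) + (1 + j))))"
      by (intro Ck_on_mult Ck_on_exp Ck_on_flat_exp S l)
    then show ?thesis
      by (rule Ck_on_cong[OF S, rotated]) (simp add: radial_def bump_def algebra_simps)
  qed
  moreover have oK: "open (- ?K)"
    by (intro open_Compl compact_imp_closed annulus_compact)
  moreover have "Ck_on n (- ?K) ?f" for n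
    by (rule Ck_on_cong[OF oK _ Ck_on_const[OF oK, of n 0]]) (use zero in auto)
  ultimately have "Ck_on n (?S \<union> - ?K) ?f" for n
    by (intro Ck_on_Un S oK)
  moreover have "?S \<union> - ?K = UNIV" using sub by blast
  ultimately show ?thesis
    using sub zero by (intro test_functionsI[where K = ?K]) (auto simp: C_k_iff_Ck_on annulus_compact)
qed

lemma log_norm_deriv:
  assumes "x \<in> ball 0 1 - {0}"
  shows "((\<lambda>x. ln (log_norm 0 x)) has_derivative (\<lambda>h. - (x \<bullet> h) / ((x \<bullet> x) * log_norm 0 x))) (at x)"
proof -
  have q: "x \<bullet> x > 0" and s: "1 - ln (x \<bullet> x) / 2 > 1"
    using assms log_norm_0_gt_1[OF assms] by (auto simp: log_norm_def)
  have "((\<lambda>q. 1 - ln q / 2) has_real_derivative - 1 / (2 * (x \<bullet> x))) (at (x \<bullet> x))"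
    using q by (auto intro!: derivative_eq_intros)
  from DERIV_chain2[OF DERIV_ln_divide this] s
  have "((\<lambda>q. ln (1 - ln q / 2)) has_real_derivative - 1 / (2 * (x \<bullet> x) * (1 - ln (x \<bullet> x) / 2))) (at (x \<bullet> x))"
    by (simp add: mult.commute)
  moreover have "((\<lambda>x. x \<bullet> x) has_derivative (\<lambda>h. 2 * (x \<bullet> h))) (at x)"
    by (auto intro!: derivative_eq_intros simp: inner_commute)
  ultimately have "((\<lambda>x. ln (1 - ln (x \<bullet> x) / 2)) has_derivative
      (\<lambda>h. 2 * (x \<bullet> h) * (- 1 / (2 * (x \<bullet> x) * (1 - ln (x \<bullet> x) / 2))))) (at x)"
    by (rule DERIV_compose_FDERIV)
  then show ?thesis by (simp add: log_norm_def mult.assoc)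
qed

text \<open>With h 0 = 0 the two extensions by zero are the same function. This permits integration
  by parts on the set where the logarithmic coordinate is smooth.\<close>

lemma integral_punctured_ball:
  fixes h :: "'a::euclidean_space \<Rightarrow> real"
  assumes "h 0 = 0"
  shows "integrable (lebesgue_on (ball 0 1 - {0})) h \<longleftrightarrow> integrable ball_measure h"
    "(\<integral>x. h x \<partial>lebesgue_on (ball 0 1 - {0})) = (\<integral>x. h x \<partial>ball_measure)"
proof -
  have eq: "(\<lambda>x. indicator (ball 0 1 - {0}) x *\<^sub>R h x) = (\<lambda>x. indicator (ball 0 1) x *\<^sub>R h x)"
    using assms by (auto simp: indicator_def fun_eq_iff)
  have S: "ball 0 1 - {0::'a} \<in> sets lebesgue" "ball 0 1 \<in> sets (lebesgue :: 'a measure)" by auto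
  show "integrable (lebesgue_on (ball 0 1 - {0})) h \<longleftrightarrow> integrable ball_measure h"
    using S by (simp only: integrable_restrict_space eq Int_UNIV_right space_completion space_lborel UNIV_I space_borel)
  show "(\<integral>x. h x \<partial>lebesgue_on (ball 0 1 - {0})) = (\<integral>x. h x \<partial>ball_measure)"
    using S by (simp only: integral_restrict_space eq Int_UNIV_right space_completion space_lborel UNIV_I space_borel)
qed

text \<open>
  With \<open>t = ln (1 - ln |x|)\<close> and \<open>\<phi> = exp (t/2) X(t)\<close>, integrating the divergence of \<open>\<phi> \<nabla>\<phi>\<close> over the
  punctured ball turns the quadratic form into the integral of
  \<open>- X (X'' + (c - 1/4) X) / (|x|\<^sup>2 (1 - ln |x|))\<close>, because \<open>ln |x|\<close> is harmonic in dimension two.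
\<close>

lemma radial_energy_negative:
  fixes X X1 X2 :: "real \<Rightarrow> real"
  defines "\<phi> \<equiv> radial X :: 'a::euclidean_space \<Rightarrow> real"
  assumes dim: "DIM('a) = 2"
    and X1: "\<And>t. (X has_real_derivative X1 t) (at t)"
    and X2: "\<And>t. (X1 has_real_derivative X2 t) (at t)" and cont: "continuous_on UNIV X2"
    and supp: "0 < \<alpha>" "\<And>t. t \<notin> {\<alpha>..\<beta>} \<Longrightarrow> X t = 0" and nonzero: "X t0 \<noteq> 0"
    and \<phi>: "\<phi> \<in> test_functions" and \<delta>: "\<delta> > 0"
    and X2_ge: "\<And>t. X t * (X2 t + (c - 1/4) * X t) \<ge> \<delta> * (X t)\<^sup>2"
  shows "(\<integral>x. (norm (gradient \<phi> x))\<^sup>2 \<partial>ball_measure)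
      - (\<integral>x. c / ((norm x)\<^sup>2 * (1 - ln (norm x))\<^sup>2) * (\<phi> x)\<^sup>2 \<partial>ball_measure) < 0"
proof -
  let ?S = "ball 0 1 - {0} :: 'a set" and ?K = "annulus \<alpha> \<beta> :: 'a set"
  define \<sigma> where "\<sigma> = (log_norm 0 :: 'a \<Rightarrow> real)"
  define \<tau> where "\<tau> x = ln (\<sigma> x)" for x
  \<comment> \<open>The field \<phi> \<nabla>\<phi> equals - \<Omega>(\<tau>) x / |x|^2: the square
    of exp (\<tau>/2) is \<sigma>, which cancels the \<sigma> in the denominator of
    \<nabla>\<tau>.\<close>
  define \<Omega> where "\<Omega> t = X t * (X t / 2 + X1 t)" for t
  define \<Omega>1 where "\<Omega>1 t = X t * (X1 t / 2 + X2 t) + X1 t * (X t / 2 + X1 t)" for t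
  have S: "open ?S" by (intro open_Diff) auto
  have K: "compact ?K" "?K \<subseteq> ?S" by (intro annulus_compact annulus_subset supp)+
  have pos: "x \<bullet> x > 0" "\<sigma> x > 0" if "x \<in> ?S" for x
    using that log_norm_0_gt_1[OF that] by (auto simp: \<sigma>_def)
  have d\<tau>: "(\<tau> has_derivative (\<lambda>h. - (x \<bullet> h) / ((x \<bullet> x) * \<sigma> x))) (at x)" if "x \<in> ?S" for x
    using log_norm_deriv[OF that] by (simp add: \<tau>_def[abs_def] \<sigma>_def)
  have c\<sigma>: "continuous_on ?S \<sigma>"
    unfolding \<sigma>_def log_norm_def by (intro continuous_intros) auto
  have c\<tau>: "continuous_on ?S \<tau>"
    by (intro continuous_at_imp_continuous_on ballI) (rule has_derivative_continuous[OF d\<tau>])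
  have cX: "continuous_on UNIV X" "continuous_on UNIV X1"
    using X1 X2 by (auto intro!: continuous_at_imp_continuous_on DERIV_isCont)
  have d\<Omega>: "(\<Omega> has_real_derivative \<Omega>1 t) (at t)" for t
  proof -
    have "((\<lambda>t. X t / 2 + X1 t) has_real_derivative X1 t / 2 + X2 t) (at t)"
      by (intro DERIV_add DERIV_cdivide X1 X2)
    from DERIV_mult[OF X1 this] show ?thesis
      unfolding \<Omega>_def[abs_def] \<Omega>1_def by (simp add: algebra_simps)
  qed
  have c\<Omega>: "continuous_on UNIV \<Omega>" "continuous_on UNIV \<Omega>1"
    unfolding \<Omega>_def[abs_def] \<Omega>1_def[abs_def] by (intro continuous_intros cX cont; simp)+
  have \<tau>out: "\<tau> x \<notin> {\<alpha>..\<beta>}" if "x \<in> ?S" "x \<notin> ?K" for x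
    using annulus_iff[OF that(1), of \<alpha> \<beta>] that(2) by (simp add: \<tau>_def \<sigma>_def)
  have \<phi>_eq: "\<phi> x = exp (\<tau> x / 2) * X (\<tau> x)" if "x \<in> ?S" for x
    using that by (simp add: \<phi>_def radial_def \<tau>_def \<sigma>_def)
  have \<phi>_sq: "(\<phi> x)\<^sup>2 = \<sigma> x * (X (\<tau> x))\<^sup>2" if "x \<in> ?S" for x
  proof -
    have "(exp (\<tau> x / 2))\<^sup>2 = \<sigma> x"
      using pos(2)[OF that] by (simp add: \<tau>_def exp_double[symmetric])
    then show ?thesis using that by (simp add: \<phi>_eq power_mult_distrib)
  qed

  \<comment> \<open>The derivative in direction \<open>h\<close> of the component along
    \<open>b\<close> of - \<Omega>(\<tau>) x / |x|^2.\<close>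
  define P where "P x b h = - ((h \<bullet> b) * (x \<bullet> x) - (x \<bullet> b) * (2 * (x \<bullet> h))) / (x \<bullet> x)\<^sup>2 * \<Omega> (\<tau> x)
    + ((x \<bullet> b) / (x \<bullet> x)) * (\<Omega>1 (\<tau> x) * ((x \<bullet> h) / ((x \<bullet> x) * \<sigma> x)))" for x b h
  have dP: "((\<lambda>x. if x \<in> ?S then - (((x \<bullet> b) / (x \<bullet> x)) * \<Omega> (\<tau> x)) else 0) has_derivative P x b) (at x)"
    if x: "x \<in> ?S" for x b
  proof (rule has_derivative_transform_within_open[OF _ S x])
    have 1: "((\<lambda>x. \<Omega> (\<tau> x)) has_derivative (\<lambda>h. - (x \<bullet> h) / ((x \<bullet> x) * \<sigma> x) * \<Omega>1 (\<tau> x))) (at x)"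
      by (rule DERIV_compose_FDERIV[OF d\<Omega> d\<tau>[OF x]])
    have 2: "((\<lambda>x. (x \<bullet> b) / (x \<bullet> x)) has_derivative
        (\<lambda>h. ((h \<bullet> b) * (x \<bullet> x) - (x \<bullet> b) * (2 * (x \<bullet> h))) / (x \<bullet> x)\<^sup>2)) (at x)"
    proof -
      have "((\<lambda>x. x \<bullet> b) has_derivative (\<lambda>h. h \<bullet> b)) (at x)"
        by (auto intro!: derivative_eq_intros)
      moreover have "((\<lambda>x. x \<bullet> x) has_derivative (\<lambda>h. 2 * (x \<bullet> h))) (at x)"
        by (auto intro!: derivative_eq_intros simp: inner_commute)
      ultimately show ?thesis
        using has_derivative_divide'[of "\<lambda>x. x \<bullet> b" "\<lambda>h. h \<bullet> b" x UNIV "\<lambda>x. x \<bullet> x"] pos(1)[OF x]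
        by (simp add: power2_eq_square)
    qed
    from has_derivative_minus[OF has_derivative_mult[OF 2 1]]
    show "((\<lambda>x. - (((x \<bullet> b) / (x \<bullet> x)) * \<Omega> (\<tau> x))) has_derivative P x b) (at x)"
      by (rule has_derivative_eq_rhs) (simp add: P_def fun_eq_iff field_simps, simp add: diff_divide_distrib)
  qed simp
  have cP: "continuous_on ?S (\<lambda>x. P x b b)" for b
  proof -
    have "continuous_on ?S (\<lambda>x. \<Omega> (\<tau> x))" "continuous_on ?S (\<lambda>x. \<Omega>1 (\<tau> x))"
      by (auto intro!: continuous_on_compose2[OF c\<Omega>(1) c\<tau>] continuous_on_compose2[OF c\<Omega>(2) c\<tau>])
    moreover have "\<forall>x\<in>?S. (x \<bullet> x)\<^sup>2 \<noteq> 0" "\<forall>x\<in>?S. x \<bullet> x \<noteq> 0" "\<forall>x\<in>?S. (x \<bullet> x) * \<sigma> x \<noteq> 0"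
      using pos by fastforce+
    ultimately show ?thesis
      unfolding P_def by (intro continuous_on_add continuous_on_mult continuous_on_divide
          continuous_on_minus continuous_on_diff continuous_on_power continuous_on_inner
          continuous_on_id continuous_on_const c\<sigma>)
  qed
  have zero: "(if x \<in> ?S then - (((x \<bullet> b) / (x \<bullet> x)) * \<Omega> (\<tau> x)) else 0) = 0" if "x \<notin> ?K" for x b
    using \<tau>out[OF _ that] supp(2)[of "\<tau> x"] by (auto simp: \<Omega>_def)
  have IBP: "integrable (lebesgue_on ?S) (\<lambda>x. P x b b)" "(\<integral>x. P x b b \<partial>lebesgue_on ?S) = 0" for b
    by (rule integral_derivative_compact_support[OF S K zero dP cP], assumption+)+
  have sum: "(\<Sum>b\<in>Basis. P x b b) = \<Omega>1 (\<tau> x) / ((x \<bullet> x) * \<sigma> x)" if x: "x \<in> ?S" for x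
  proof -
    have r: "(\<Sum>b\<in>Basis. (x \<bullet> b) * (x \<bullet> b)) = x \<bullet> x"
      by (rule euclidean_inner[symmetric])
    have "P x b b = - \<Omega> (\<tau> x) * (x \<bullet> x) / (x \<bullet> x)\<^sup>2 * (b \<bullet> b) + 2 * \<Omega> (\<tau> x) / (x \<bullet> x)\<^sup>2 * ((x \<bullet> b) * (x \<bullet> b))
        + \<Omega>1 (\<tau> x) / ((x \<bullet> x) * ((x \<bullet> x) * \<sigma> x)) * ((x \<bullet> b) * (x \<bullet> b))" for b
      by (simp add: P_def diff_divide_distrib algebra_simps)
    then have "(\<Sum>b\<in>Basis. P x b b) = - \<Omega> (\<tau> x) * (x \<bullet> x) / (x \<bullet> x)\<^sup>2 * (\<Sum>b\<in>(Basis::'a set). b \<bullet> b)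
        + 2 * \<Omega> (\<tau> x) / (x \<bullet> x)\<^sup>2 * (\<Sum>b\<in>Basis. (x \<bullet> b) * (x \<bullet> b))
        + \<Omega>1 (\<tau> x) / ((x \<bullet> x) * ((x \<bullet> x) * \<sigma> x)) * (\<Sum>b\<in>Basis. (x \<bullet> b) * (x \<bullet> b))"
      by (simp only: sum.distrib sum_distrib_left)
    \<comment> \<open>In the plane x / |x|^2 is divergence free: the trace contributes 2 and the
      first two terms cancel, leaving only the derivative of \<Omega>.\<close>
    also have "\<dots> = - \<Omega> (\<tau> x) * (x \<bullet> x) / (x \<bullet> x)\<^sup>2 * 2 + 2 * \<Omega> (\<tau> x) / (x \<bullet> x)\<^sup>2 * (x \<bullet> x)
        + \<Omega>1 (\<tau> x) / ((x \<bullet> x) * ((x \<bullet> x) * \<sigma> x)) * (x \<bullet> x)"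
      unfolding r using dim by simp
    also have "\<dots> = \<Omega>1 (\<tau> x) / ((x \<bullet> x) * \<sigma> x)"
      using pos[OF x] by simp
    finally show ?thesis .
  qed
  have gradient: "(norm (gradient \<phi> x))\<^sup>2 = (X (\<tau> x) / 2 + X1 (\<tau> x))\<^sup>2 / ((x \<bullet> x) * \<sigma> x)" if x: "x \<in> ?S" for x
  proof -
    have e: "(exp (\<tau> x / 2))\<^sup>2 = \<sigma> x"
      using pos(2)[OF x] by (simp add: \<tau>_def exp_double[symmetric])
    have "((\<lambda>t. exp (t / 2) * X t) has_real_derivative exp (\<tau> x / 2) * (X (\<tau> x) / 2 + X1 (\<tau> x))) (at (\<tau> x))"
      by (auto intro!: derivative_eq_intros X1 simp: algebra_simps)
    then have "((\<lambda>x. exp (\<tau> x / 2) * X (\<tau> x)) has_derivative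
        (\<lambda>h. - (x \<bullet> h) / ((x \<bullet> x) * \<sigma> x) * (exp (\<tau> x / 2) * (X (\<tau> x) / 2 + X1 (\<tau> x))))) (at x)"
      by (rule DERIV_compose_FDERIV[OF _ d\<tau>[OF x]])
    then have "(\<phi> has_derivative
        (\<lambda>h. - (x \<bullet> h) / ((x \<bullet> x) * \<sigma> x) * (exp (\<tau> x / 2) * (X (\<tau> x) / 2 + X1 (\<tau> x))))) (at x)"
      by (rule has_derivative_transform_within_open[OF _ S x]) (simp add: \<phi>_eq)
    note fd = frechet_derivative_at[OF this, symmetric]
    have "(norm (gradient \<phi> x))\<^sup>2 = (\<Sum>b\<in>Basis. (x \<bullet> b) * (x \<bullet> b))
        * ((exp (\<tau> x / 2))\<^sup>2 * (X (\<tau> x) / 2 + X1 (\<tau> x))\<^sup>2 / ((x \<bullet> x) * \<sigma> x)\<^sup>2)"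
      unfolding norm_gradient_sq fd sum_distrib_right
      by (intro sum.cong refl) (simp add: power_mult_distrib power_divide power2_eq_square)
    also have "\<dots> = (x \<bullet> x) * (\<sigma> x * (X (\<tau> x) / 2 + X1 (\<tau> x))\<^sup>2 / ((x \<bullet> x) * \<sigma> x)\<^sup>2)"
      unfolding e euclidean_inner[symmetric] ..
    also have "\<dots> = (X (\<tau> x) / 2 + X1 (\<tau> x))\<^sup>2 / ((x \<bullet> x) * \<sigma> x)"
      using pos[OF x] by (simp add: power2_eq_square)
    finally show ?thesis .
  qed
  let ?W = "\<lambda>x::'a. 1 / ((norm x)\<^sup>2 * (1 - ln (norm x))\<^sup>2)"
  have W: "?W x * (\<phi> x)\<^sup>2 = (X (\<tau> x))\<^sup>2 / ((x \<bullet> x) * \<sigma> x)" if "x \<in> ?S" for x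
    using pos[OF that] unfolding \<phi>_sq[OF that] power2_norm_eq_inner log_norm_0[symmetric] \<sigma>_def[symmetric]
    by (simp add: power2_eq_square)
  have out: "\<phi> x = 0" if "x \<notin> ?K" for x
    unfolding \<phi>_def by (rule radial_zero_outside_annulus[OF supp(2) that])
  have "0 \<notin> ?K" using K(2) by auto
  then have at_0: "\<phi> 0 = 0" "gradient \<phi> 0 = 0"
    using out[of 0] frechet_derivative_at[OF has_derivative_zero_outside_compact[where f = \<phi> and x = 0, OF K(1) out], symmetric]
    by (simp_all add: gradient_def)
  have intg: "integrable (lebesgue_on ?S) (\<lambda>x. (norm (gradient \<phi> x))\<^sup>2)"
    using square_integrable_test_function(2)[OF \<phi>] at_0
    by (subst integral_punctured_ball) (auto simp: square_integrable_def)
  have intW: "integrable (lebesgue_on ?S) (\<lambda>x. ?W x * (\<phi> x)\<^sup>2)"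
  proof (rule integrable_on_compact_support[OF S K])
    have "continuous_on ?S (\<lambda>x. X (\<tau> x))"
      by (auto intro!: continuous_on_compose2[OF cX(1) c\<tau>])
    moreover have "\<forall>x\<in>?S. (x \<bullet> x) * \<sigma> x \<noteq> 0" using pos by fastforce
    ultimately have "continuous_on ?S (\<lambda>x. (X (\<tau> x))\<^sup>2 / ((x \<bullet> x) * \<sigma> x))"
      by (intro continuous_intros c\<sigma>)
    then show "continuous_on ?S (\<lambda>x. ?W x * (\<phi> x)\<^sup>2)"
      by (rule continuous_on_cong[THEN iffD1, OF refl, rotated]) (simp only: W)
  qed (use out in simp)
  have intP: "integrable (lebesgue_on ?S) (\<lambda>x. \<Sum>b\<in>Basis. P x b b)"
    by (intro Bochner_Integration.integrable_sum IBP)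
  have zeroP: "(\<integral>x. (\<Sum>b\<in>Basis. P x b b) \<partial>lebesgue_on ?S) = 0"
    by (subst Bochner_Integration.integral_sum) (auto simp: IBP)
  have W_nonneg: "0 \<le> ?W x * (\<phi> x)\<^sup>2" for x by simp
  have "(\<integral>x. (norm (gradient \<phi> x))\<^sup>2 \<partial>lebesgue_on ?S)
      \<le> (\<integral>x. (c - \<delta>) * (?W x * (\<phi> x)\<^sup>2) + (\<Sum>b\<in>Basis. P x b b) \<partial>lebesgue_on ?S)"
  proof (rule integral_mono[OF intg Bochner_Integration.integrable_add[OF integrable_mult_right[OF intW] intP]])
    fix x assume "x \<in> space (lebesgue_on ?S)"
    then have x: "x \<in> ?S" by (simp add: space_restrict_space)
    let ?t = "\<tau> x"
    \<comment> \<open>The square expands to X^2/4 + X X1 + X1^2, and \<Omega>1 equals X X1 + X1^2 +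
      X X2, so the claim is \<open>X2_ge\<close> rearranged.\<close>
    have "(X ?t / 2 + X1 ?t)\<^sup>2 \<le> (c - \<delta>) * (X ?t)\<^sup>2 + \<Omega>1 ?t"
      using X2_ge[of ?t] by (simp add: \<Omega>1_def power2_eq_square algebra_simps)
    then have "(X ?t / 2 + X1 ?t)\<^sup>2 / ((x \<bullet> x) * \<sigma> x) \<le> ((c - \<delta>) * (X ?t)\<^sup>2 + \<Omega>1 ?t) / ((x \<bullet> x) * \<sigma> x)"
      using pos[OF x] by (intro divide_right_mono) auto
    then show "(norm (gradient \<phi> x))\<^sup>2 \<le> (c - \<delta>) * (?W x * (\<phi> x)\<^sup>2) + (\<Sum>b\<in>Basis. P x b b)"
      unfolding gradient[OF x] W[OF x] sum[OF x] by (simp add: add_divide_distrib)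
  qed
  also have "\<dots> = (c - \<delta>) * (\<integral>x. ?W x * (\<phi> x)\<^sup>2 \<partial>lebesgue_on ?S)"
    by (subst Bochner_Integration.integral_add[OF integrable_mult_right[OF intW] intP])
      (simp only: zeroP add_0_right integral_mult_right_zero)
  finally have le: "(\<integral>x. (norm (gradient \<phi> x))\<^sup>2 \<partial>lebesgue_on ?S)
      - c * (\<integral>x. ?W x * (\<phi> x)\<^sup>2 \<partial>lebesgue_on ?S) \<le> - \<delta> * (\<integral>x. ?W x * (\<phi> x)\<^sup>2 \<partial>lebesgue_on ?S)"
    by (simp add: algebra_simps)
  \<comment> \<open>A vanishing integral would make \<phi> zero almost everywhere; an open null set
    is empty, so \<phi> would vanish identically.\<close>
  have "(\<integral>x. ?W x * (\<phi> x)\<^sup>2 \<partial>lebesgue_on ?S) \<noteq> 0"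
  proof
    assume "(\<integral>x. ?W x * (\<phi> x)\<^sup>2 \<partial>lebesgue_on ?S) = 0"
    then have "AE x in lebesgue_on ?S. ?W x * (\<phi> x)\<^sup>2 = 0"
      using integral_nonneg_eq_0_iff_AE[OF intW AE_I2[OF W_nonneg]] by blast
    then have "AE x in lebesgue. x \<in> ?S \<longrightarrow> ?W x * (\<phi> x)\<^sup>2 = 0"
      using S by (subst (asm) AE_restrict_space_iff) auto
    then have "AE x in lebesgue. \<phi> x = 0"
    proof eventually_elim
      fix x assume imp: "x \<in> ?S \<longrightarrow> ?W x * (\<phi> x)\<^sup>2 = 0"
      show "\<phi> x = 0"
      proof (cases "x \<in> ?S")
        case True
        then have "norm x > 0" "1 - ln (norm x) > 0"
          using pos[OF True] by (auto simp: \<sigma>_def log_norm_0)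
        with imp True show ?thesis by simp
      qed (use out K(2) in blast)
    qed
    moreover have op: "open {x. \<phi> x \<noteq> 0}"
      using test_function_continuous[OF \<phi>] by (intro open_Collect_neq) auto
    ultimately have "negligible {x. \<phi> x \<noteq> 0}"
      by (simp add: negligible_iff_null_sets AE_iff_null_sets)
    then have "{x. \<phi> x \<noteq> 0} = {}"
      using open_not_negligible[OF op] by blast
    moreover obtain b :: 'a where b: "b \<in> Basis" using nonempty_Basis by blast
    \<comment> \<open>The radius exp (1 - exp t0) is the one with coordinate t = t0, where the
      profile is nonzero.\<close>
    define x where "x = exp (1 - exp t0) *\<^sub>R b"
    have "t0 > 0" using nonzero supp by force
    then have x: "x \<in> ?S" using b by (auto simp: x_def)
    have "\<tau> x = t0"
      using b by (simp add: \<tau>_def \<sigma>_def log_norm_0 x_def)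
    then have "\<phi> x \<noteq> 0" using nonzero \<phi>_eq[OF x] by simp
    ultimately show False by blast
  qed
  moreover have "(\<integral>x. ?W x * (\<phi> x)\<^sup>2 \<partial>lebesgue_on ?S) \<ge> 0"
    by (intro integral_nonneg_AE AE_I2 W_nonneg)
  ultimately have "(\<integral>x. ?W x * (\<phi> x)\<^sup>2 \<partial>lebesgue_on ?S) > 0"
    by (rule le_neq_trans[OF _ not_sym, rotated])
  then have "\<delta> * (\<integral>x. ?W x * (\<phi> x)\<^sup>2 \<partial>lebesgue_on ?S) > 0"
    by (rule mult_pos_pos[OF \<delta>])
  with le have "(\<integral>x. (norm (gradient \<phi> x))\<^sup>2 \<partial>lebesgue_on ?S) - c * (\<integral>x. ?W x * (\<phi> x)\<^sup>2 \<partial>lebesgue_on ?S) < 0"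
    by linarith
  moreover have "(\<integral>x. (norm (gradient \<phi> x))\<^sup>2 \<partial>lebesgue_on ?S) = (\<integral>x. (norm (gradient \<phi> x))\<^sup>2 \<partial>ball_measure)"
    by (rule integral_punctured_ball(2)) (simp add: at_0)
  moreover have "(\<integral>x. ?W x * (\<phi> x)\<^sup>2 \<partial>lebesgue_on ?S) = (\<integral>x. ?W x * (\<phi> x)\<^sup>2 \<partial>ball_measure)"
    by (rule integral_punctured_ball(2)) (simp add: at_0)
  moreover have "(\<integral>x. c / ((norm x)\<^sup>2 * (1 - ln (norm x))\<^sup>2) * (\<phi> x)\<^sup>2 \<partial>ball_measure)
      = c * (\<integral>x. ?W x * (\<phi> x)\<^sup>2 \<partial>ball_measure)"
    by (subst integral_mult_right_zero[symmetric]) simp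
  ultimately show ?thesis by simp
qed

section \<open>Morse index\<close>

lemma radial_sum: "radial (\<lambda>t. \<Sum>j\<in>J. a j * X j t) x = (\<Sum>j\<in>J. a j * radial (X j) x)"
  by (cases "x \<in> ball 0 1 - {0}") (simp_all only: radial_def if_True if_False sum_distrib_left mult_ac mult_zero_left mult_zero_right sum.neutral_const)

text \<open>The combination is itself radial, with profile \<open>X\<close>. At each t at most one
  bump is nonzero, and both sides of the pointwise inequality scale with the square of its
  coefficient, so the estimate for one bump covers all combinations.\<close>

lemma bump_combination_energy_negative:
  fixes a :: "nat \<Rightarrow> real"
  defines "\<phi> \<equiv> \<lambda>L J (x::'a::euclidean_space). \<Sum>j\<in>J. a j * radial (\<lambda>t. bump (t / L - real j)) x"
  assumes dim: "DIM('a) = 2" and \<delta>: "\<delta> > 0" "c = 1/4 + \<delta>"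
    and L: "L > 0" "288 \<le> \<delta> * L\<^sup>2" and J: "finite J" "0 \<notin> J" "i \<in> J" "a i \<noteq> 0"
  shows "(\<integral>x. (norm (gradient (\<phi> L J) x))\<^sup>2 \<partial>ball_measure)
      - (\<integral>x. c / ((norm x)\<^sup>2 * (1 - ln (norm x))\<^sup>2) * (\<phi> L J x)\<^sup>2 \<partial>ball_measure) < 0"
proof -
  define X where "X t = (\<Sum>j\<in>J. a j * bump (t / L - real j))" for t
  define X1 where "X1 t = (\<Sum>j\<in>J. a j * (bump' (t / L - real j) / L))" for t
  define X2 where "X2 t = (\<Sum>j\<in>J. a j * (bump'' (t / L - real j) / L\<^sup>2))" for t
  have \<phi>: "\<phi> L J = (radial X :: 'a \<Rightarrow> real)"
    by (simp add: \<phi>_def X_def[abs_def] radial_sum fun_eq_iff)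
  have test: "(radial X :: 'a \<Rightarrow> real) \<in> test_functions"
    unfolding \<phi>[symmetric] \<phi>_def using J(2) by (intro test_functions_sum radial_bump_test_function L) (metis One_nat_def Suc_leI of_nat_1 of_nat_le_iff neq0_conv)
  have lin: "((\<lambda>t. t / L - r) has_real_derivative 1 / L) (at t)" for r t
    using L by (auto intro!: derivative_eq_intros)
  have nz: "0 < t / L - real j \<and> t / L - real j < 1" if "bump (t / L - real j) \<noteq> 0" for t j
    using that bump_nonzero_iff by blast
  have unique: "j = j'" if "bump (t / L - real j) \<noteq> 0" "bump (t / L - real j') \<noteq> 0" for t j j'
    using nz[OF that(1)] nz[OF that(2)] by linarith
  have single: "\<exists>j\<in>J. X t = a j * bump (t / L - real j) \<and> X2 t = a j * (bump'' (t / L - real j) / L\<^sup>2)" for t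
  proof (cases "\<exists>j\<in>J. bump (t / L - real j) \<noteq> 0")
    case True
    then obtain j where j: "j \<in> J" "bump (t / L - real j) \<noteq> 0" by blast
    have 0: "bump (t / L - real j') = 0" if "j' \<in> J - {j}" for j'
      using unique[OF j(2)] that by blast
    have "X t = a j * bump (t / L - real j)"
      unfolding X_def by (subst sum.remove[OF J(1) j(1)]) (simp add: 0)
    moreover have "X2 t = a j * (bump'' (t / L - real j) / L\<^sup>2)"
      unfolding X2_def by (subst sum.remove[OF J(1) j(1)]) (simp add: 0 bump''_zero)
    ultimately show ?thesis using j by blast
  next
    case False
    \<comment> \<open>Where no bump is active, any index is a witness, since both sums vanish and so
      do \<open>bump\<close> and \<open>bump''\<close>.\<close>
    then show ?thesis
      using J(3) by (auto simp: X_def X2_def bump''_zero intro!: bexI[of _ i])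
  qed
  define M where "M = Max J"
  have M: "j \<le> M" if "j \<in> J" for j
    using that J(1) by (simp add: M_def)
  have "(\<integral>x. (norm (gradient (radial X :: 'a \<Rightarrow> real) x))\<^sup>2 \<partial>ball_measure)
      - (\<integral>x. c / ((norm x)\<^sup>2 * (1 - ln (norm x))\<^sup>2) * ((radial X :: 'a \<Rightarrow> real) x)\<^sup>2 \<partial>ball_measure) < 0"
  proof (rule radial_energy_negative[OF dim _ _ _ _ _ _ test, where \<delta> = "\<delta> / 2"])
    show "(X has_real_derivative X1 t) (at t)" for t
      unfolding X_def[abs_def] X1_def
      using DERIV_chain2[OF DERIV_bump lin] by (intro DERIV_sum DERIV_cmult) simp
    show "(X1 has_real_derivative X2 t) (at t)" for t
      unfolding X1_def[abs_def] X2_def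
      using DERIV_cdivide[OF DERIV_chain2[OF DERIV_bump' lin], where c = L]
      by (intro DERIV_sum DERIV_cmult) (simp add: power2_eq_square)
    show "continuous_on UNIV X2"
      unfolding X2_def[abs_def] using L
      by (intro continuous_intros continuous_on_compose2[OF continuous_bump'']) auto
    show "0 < L" by (rule L)
    \<comment> \<open>The interval contains the supports of all bumps with indices from 1 to
      \<open>M\<close>; its positive left end comes from 0 not lying in \<open>J\<close>.\<close>
    show "X t = 0" if "t \<notin> {L..L * (real M + 1)}" for t
      unfolding X_def
    proof (intro sum.neutral ballI)
      fix j assume j: "j \<in> J"
      show "a j * bump (t / L - real j) = 0"
      proof (rule ccontr)
        assume "a j * bump (t / L - real j) \<noteq> 0"
        then have "0 < t / L - real j \<and> t / L - real j < 1" by (intro nz) auto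
        moreover have "real j \<ge> 1" using j J(2) by (cases j) auto
        moreover have "real j \<le> real M" using M[OF j] by simp
        ultimately have "1 \<le> t / L" "t / L \<le> real M + 1" by linarith+
        then show False using that L by (auto simp: field_simps)
      qed
    qed
    \<comment> \<open>The midpoint of the support of bump \<open>i\<close>, where its argument is
      1/2 and the other bumps vanish.\<close>
    show "X (L * (real i + 1/2)) \<noteq> 0"
    proof -
      have "L * (real i + 1/2) / L - real j = real i - real j + 1/2" for j
        using L by simp
      then have b: "bump (L * (real i + 1/2) / L - real i) \<noteq> 0" 
        by (simp add: bump_nonzero_iff)
      have "X (L * (real i + 1/2)) = a i * bump (L * (real i + 1/2) / L - real i)"
        unfolding X_def
      proof (subst sum.remove[OF J(1,3)])
        have "bump (L * (real i + 1/2) / L - real j) = 0" if "j \<in> J - {i}" for j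
          using unique[OF b] that by blast
        then show "a i * bump (L * (real i + 1/2) / L - real i)
            + (\<Sum>j\<in>J - {i}. a j * bump (L * (real i + 1/2) / L - real j)) = a i * bump (L * (real i + 1/2) / L - real i)"
          by (simp add: sum.neutral)
      qed
      then show ?thesis using b J(4) by simp
    qed
    show "0 < \<delta> / 2" using \<delta> by simp
    show "\<delta> / 2 * (X t)\<^sup>2 \<le> X t * (X2 t + (c - 1/4) * X t)" for t
    proof -
      obtain j where j: "X t = a j * bump (t / L - real j)" "X2 t = a j * (bump'' (t / L - real j) / L\<^sup>2)"
        using single[of t] by blast
      define y where "y = t / L - real j"
      \<comment> \<open>Half of \<delta> absorbs the second derivative, which is the origin of 288 =
        2 * 144; the other half remains as the gap.\<close>
      have "144 \<le> \<delta> / 2 * L\<^sup>2" using L(2) by simp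
      then have "- (144 * bump y) \<ge> - (\<delta> / 2 * L\<^sup>2 * bump y)"
        using mult_right_mono[OF _ bump_nonneg[of y]] by simp
      then have "bump'' y \<ge> - (\<delta> / 2 * L\<^sup>2 * bump y)"
        using bump''_ge[of y] by linarith
      then have "bump'' y / L\<^sup>2 \<ge> - (\<delta> / 2 * L\<^sup>2 * bump y) / L\<^sup>2"
        by (intro divide_right_mono) auto
      also have "- (\<delta> / 2 * L\<^sup>2 * bump y) / L\<^sup>2 = - (\<delta> / 2 * bump y)"
        using L(1) by simp
      finally have "bump'' y / L\<^sup>2 + \<delta> * bump y \<ge> \<delta> / 2 * bump y"
        by linarith
      then have "(a j)\<^sup>2 * bump y * (\<delta> / 2 * bump y) \<le> (a j)\<^sup>2 * bump y * (bump'' y / L\<^sup>2 + \<delta> * bump y)"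
        by (intro mult_left_mono) (auto simp: bump_nonneg)
      then show ?thesis
        unfolding j y_def[symmetric] \<delta>(2) by (simp add: power2_eq_square algebra_simps)
    qed
  qed
  then show ?thesis unfolding \<phi> .
qed

lemma quadratic_form_test_function:
  fixes U :: "'a::euclidean_space \<Rightarrow> real"
  assumes \<phi>: "\<phi> \<in> test_functions"
    and potential: "\<And>x. x \<in> ball 0 1 \<Longrightarrow>
      l * V (norm x) * deriv f (U x) = c / ((norm x)\<^sup>2 * (1 - ln (norm x))\<^sup>2)"
  shows "quadratic_form l V f U (l2_class \<phi>) = (\<integral>x. (norm (gradient \<phi> x))\<^sup>2 \<partial>ball_measure)
      - (\<integral>x. c / ((norm x)\<^sup>2 * (1 - ln (norm x))\<^sup>2) * (\<phi> x)\<^sup>2 \<partial>ball_measure)"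
proof -
  note sq = square_integrable_test_function[OF \<phi>]
  have H1: "l2_class \<phi> \<in> H1"
    using l2_class_test_function_H10[OF \<phi>] by (simp add: H10_def)
  have m: "weak_gradient (l2_class \<phi>) \<in> borel_measurable ball_measure" "gradient \<phi> \<in> borel_measurable ball_measure"
    "l2_repr (l2_class \<phi>) \<in> borel_measurable ball_measure" "\<phi> \<in> borel_measurable ball_measure"
    by (intro square_integrable_measurable square_integrable_weak_gradient H1 square_integrable_l2_repr sq)+
  have norm_m: "(norm :: 'a \<Rightarrow> real) \<in> borel_measurable ball_measure"
    by (intro borel_measurable_ball_continuous continuous_intros)
  let ?W = "\<lambda>x::'a. c / ((norm x)\<^sup>2 * (1 - ln (norm x))\<^sup>2)"
  have Wm: "?W \<in> borel_measurable ball_measure"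
    using norm_m by measurable
  have "(\<integral>x. (norm (weak_gradient (l2_class \<phi>) x))\<^sup>2 \<partial>ball_measure) = (\<integral>x. (norm (gradient \<phi> x))\<^sup>2 \<partial>ball_measure)"
  proof (rule integral_cong_AE)
    show "AE x in ball_measure. (norm (weak_gradient (l2_class \<phi>) x))\<^sup>2 = (norm (gradient \<phi> x))\<^sup>2"
      using weak_gradient_unique[OF has_weak_gradient_test_function[OF \<phi>]] by eventually_elim simp
  qed (use m in measurable)
  moreover have "(\<integral>x. l * V (norm x) * deriv f (U x) * (l2_repr (l2_class \<phi>) x)\<^sup>2 \<partial>ball_measure)
      = (\<integral>x. ?W x * (l2_repr (l2_class \<phi>) x)\<^sup>2 \<partial>ball_measure)"
    by (rule Bochner_Integration.integral_cong) (auto simp: space_restrict_space potential)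
  moreover have "\<dots> = (\<integral>x. ?W x * (\<phi> x)\<^sup>2 \<partial>ball_measure)"
  proof (rule integral_cong_AE)
    show "AE x in ball_measure. ?W x * (l2_repr (l2_class \<phi>) x)\<^sup>2 = ?W x * (\<phi> x)\<^sup>2"
      using l2_repr_class[OF sq(1)] by eventually_elim simp
  qed (intro borel_measurable_times borel_measurable_power Wm m)+
  ultimately show ?thesis by (simp add: quadratic_form_def)
qed

lemma l2_class_sum:
  assumes "\<And>j. j \<in> J \<Longrightarrow> \<phi> j \<in> test_functions"
  shows "(\<Sum>j\<in>J. a j *\<^sub>R l2_class (\<phi> j)) = l2_class (\<lambda>x. \<Sum>j\<in>J. a j * \<phi> j x)"
  using assms
proof (induction J rule: infinite_finite_induct)
  case (insert j J)
  have "square_integrable (\<phi> j)"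
    using insert by (simp add: square_integrable_test_function)
  moreover have "square_integrable (\<lambda>x. a j * \<phi> j x)"
    using square_integrable_scaleR[OF calculation, of "a j"] by simp
  moreover have "square_integrable (\<lambda>x. \<Sum>j\<in>J. a j * \<phi> j x)"
    using insert by (intro square_integrable_test_function test_functions_sum) auto
  ultimately show ?case
    using insert by (simp add: l2_class_scaleR l2_class_add)
qed (simp_all add: zero_l2_ball_def)

lemma morse_index_eq_0:
  fixes U :: "'a::euclidean_space \<Rightarrow> real"
  assumes "\<And>u. u \<in> H10 \<Longrightarrow> quadratic_form l V f U u \<ge> 0"
  shows "morse_index l V f U = 0"
proof -
  have "edim X = 0" if X: "X \<subseteq> H10" "\<forall>\<xi>\<in>X - {0}. quadratic_form l V f U \<xi> < 0" for X
  proof -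
    have "X \<subseteq> {0}" using X assms by (meson Diff_iff linorder_not_less subset_iff)
    then have X0: "X \<subseteq> span {}" by simp
    have "dim X = 0" using real_vector.dim_le_card[OF X0] by simp
    with X0 show ?thesis by (auto simp: edim_def zero_enat_def intro!: exI[of _ "{}"])
  qed
  then show ?thesis
    unfolding morse_index_def by (intro antisym SUP_least) auto
qed

text \<open>Negativity on every nontrivial combination does all the work: as the form vanishes at 0,
  no such combination is zero. This yields injectivity and linear independence, hence negative
  subspaces of every finite dimension.\<close>

lemma morse_index_eq_infinity:
  fixes U :: "'a::euclidean_space \<Rightarrow> real"
  assumes dim: "DIM('a) = 2" and c: "c > 1/4"
    and potential: "\<And>x. x \<in> ball 0 1 \<Longrightarrow>
      l * V (norm x) * deriv f (U x) = c / ((norm x)\<^sup>2 * (1 - ln (norm x))\<^sup>2)"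
  shows "morse_index l V f U = \<infinity>"
proof -
  define \<delta> where "\<delta> = c - 1/4"
  have \<delta>: "\<delta> > 0" "c = 1/4 + \<delta>" using c by (auto simp: \<delta>_def)
  \<comment> \<open>The smallest scale with 288 \<le> \<delta> L^2.\<close>
  define L where "L = sqrt (288 / \<delta>)"
  have L: "L > 0" "288 \<le> \<delta> * L\<^sup>2" using \<delta>(1) by (auto simp: L_def)
  define b where "b j = (radial (\<lambda>t. bump (t / L - real j)) :: 'a \<Rightarrow> real)" for j :: nat
  define u where "u j = l2_class (b j)" for j
  have b: "b j \<in> test_functions" if "j \<noteq> 0" for j
    unfolding b_def using that by (intro radial_bump_test_function L) auto
  have sum: "(\<Sum>j\<in>J. a j *\<^sub>R u j) = l2_class (\<lambda>x. \<Sum>j\<in>J. a j * b j x)"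
    "(\<lambda>x. \<Sum>j\<in>J. a j * b j x) \<in> test_functions" if "0 \<notin> J" for J a
  proof -
    have "b j \<in> test_functions" if "j \<in> J" for j
      using that \<open>0 \<notin> J\<close> by (intro b) metis
    then show "(\<Sum>j\<in>J. a j *\<^sub>R u j) = l2_class (\<lambda>x. \<Sum>j\<in>J. a j * b j x)"
      "(\<lambda>x. \<Sum>j\<in>J. a j * b j x) \<in> test_functions"
      unfolding u_def by (intro l2_class_sum test_functions_sum; simp)+
  qed
  have neg: "quadratic_form l V f U (\<Sum>j\<in>J. a j *\<^sub>R u j) < 0"
    if "finite J" "0 \<notin> J" "i \<in> J" "a i \<noteq> 0" for J a i
  proof -
    let ?\<phi> = "\<lambda>x. \<Sum>j\<in>J. a j * b j x"
    have "quadratic_form l V f U (l2_class ?\<phi>) = (\<integral>x. (norm (gradient ?\<phi> x))\<^sup>2 \<partial>ball_measure)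
      - (\<integral>x. c / ((norm x)\<^sup>2 * (1 - ln (norm x))\<^sup>2) * (?\<phi> x)\<^sup>2 \<partial>ball_measure)"
      by (rule quadratic_form_test_function[OF sum(2)[OF that(2)]]) (rule potential)
    also have "\<dots> < 0"
      unfolding b_def by (rule bump_combination_energy_negative[where a = a and i = i, OF dim \<delta> L that])
    finally show ?thesis unfolding sum(1)[OF that(2)] .
  qed
  have Q0: "quadratic_form l V f U 0 = 0"
  proof -
    have "quadratic_form l V f U (l2_class (\<lambda>_. 0)) = (\<integral>x. (norm (gradient (\<lambda>_::'a. 0) x))\<^sup>2 \<partial>ball_measure)
      - (\<integral>x. c / ((norm x)\<^sup>2 * (1 - ln (norm x))\<^sup>2) * 0\<^sup>2 \<partial>(ball_measure :: 'a measure))"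
      by (rule quadratic_form_test_function[OF test_functions_zero]) (rule potential)
    then show ?thesis by (simp add: zero_l2_ball_def gradient_def)
  qed
  have inj: "inj_on u {1..n}" for n
  proof (rule inj_onI, rule ccontr)
    fix i j assume ij: "i \<in> {1..n}" "j \<in> {1..n}" "u i = u j" "i \<noteq> j"
    have "quadratic_form l V f U (\<Sum>m\<in>{i, j}. (if m = i then 1 else -1) *\<^sub>R u m) < 0"
      using ij by (intro neg[where i = i]) auto
    then show False using ij Q0 by simp
  qed
  have unbounded: "enat n \<le> morse_index l V f U" for n
  proof -
    \<comment> \<open>Indices start at 1: the support of the bump with j = 0 would reach t = 0, the
      unit sphere.\<close>
    define X where "X = span (u ` {1..n})"
    have X: "\<exists>a. x = (\<Sum>j\<in>{1..n}. a j *\<^sub>R u j)" if x: "x \<in> X" for x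
    proof -
      obtain a where "x = (\<Sum>v\<in>u ` {1..n}. a v *\<^sub>R v)"
        using x unfolding X_def by (subst (asm) span_finite) auto
      then show ?thesis
        by (intro exI[of _ "a \<circ> u"]) (simp add: sum.reindex[OF inj] del: One_nat_def)
    qed
    have indep: "independent (u ` {1..n})"
    proof (rule independent_if_scalars_zero)
      fix a v assume 0: "(\<Sum>v\<in>u ` {1..n}. a v *\<^sub>R v) = 0" and v: "v \<in> u ` {1..n}"
      then obtain i where i: "i \<in> {1..n}" "v = u i" by blast
      show "a v = 0"
      proof (rule ccontr)
        assume "a v \<noteq> 0"
        then have "quadratic_form l V f U (\<Sum>j\<in>{1..n}. a (u j) *\<^sub>R u j) < 0"
          using i by (intro neg[where i = i]) auto
        then show False using 0 Q0 by (simp add: sum.reindex[OF inj] del: One_nat_def)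
      qed
    qed simp
    have "dim X = n"
      using real_vector.dim_span_eq_card_independent[OF indep] card_image[OF inj[of n]] by (simp add: X_def del: One_nat_def)
    then have "edim X = enat n"
      unfolding edim_def X_def by (auto intro!: exI[of _ "u ` {1..n}"])
    moreover have "subspace X" by (simp add: X_def)
    moreover have "X \<subseteq> H10"
    proof
      fix x assume "x \<in> X"
      then obtain a where "x = (\<Sum>j\<in>{1..n}. a j *\<^sub>R u j)" using X by blast
      then show "x \<in> H10"
        using l2_class_test_function_H10[OF sum(2)] sum(1)[of "{1..n}" a] by simp
    qed
    moreover have "quadratic_form l V f U \<xi> < 0" if \<xi>: "\<xi> \<in> X - {0}" for \<xi>
    proof -
      obtain a where a: "\<xi> = (\<Sum>j\<in>{1..n}. a j *\<^sub>R u j)" using X \<xi> by blast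
      have "\<exists>i\<in>{1..n}. a i \<noteq> 0"
      proof (rule ccontr)
        assume "\<not> ?thesis"
        then have "\<xi> = 0" unfolding a by (intro sum.neutral) auto
        with \<xi> show False by simp
      qed
      then obtain i where "i \<in> {1..n}" "a i \<noteq> 0" by blast
      then show ?thesis using neg[of "{1..n}" i a] a by simp
    qed
    ultimately show ?thesis
      unfolding morse_index_def by (intro SUP_upper2[of X]) auto
  qed
  show ?thesis
  proof (cases "morse_index l V f U")
    case (enat m)
    with unbounded[of "Suc m"] show ?thesis by simp
  qed
qed

section \<open>The two potentials and the critical exponents\<close>

lemma V_weight_powr:
  assumes "0 \<le> r" "r < 1"
  shows "V_weight k r * (- ln (r / exp 1)) powr k = 1 / (r\<^sup>2 * (1 - ln r)\<^sup>2)"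
proof (cases "r = 0")
  case False
  then have r: "r > 0" using assms by simp
  define s where "s = 1 - ln r"
  have "ln r < 0" using r assms by simp
  then have s: "s > 0" by (simp add: s_def)
  have eq: "- ln (r / exp 1) = s" using r by (simp add: ln_div s_def)
  have "s powr (2 + k) = s\<^sup>2 * s powr k"
    using s by (simp add: powr_add powr_numeral)
  then show ?thesis
    using s unfolding V_weight_def eq s_def[symmetric] by simp
qed (simp add: V_weight_def)

text \<open>With \<alpha> = k / (p - 1), the difference 1/4 - c factors over the roots (1 - k + R)/2
  and (1 - k - R)/2. Since p = 1 + k/\<alpha> decreases in \<alpha>, the larger root gives the
  smaller exponent \<open>p_JL_minus\<close>; p > p_s gives \<alpha> < 1.\<close>

lemma joseph_lundgren_exponents:
  fixes k p :: real
  assumes k: "k > 0" and p: "p > p_s k"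
  defines "c \<equiv> k / (p - 1) * (1 - k / (p - 1)) * p"
  shows "c > 0" "p \<le> p_JL_minus k \<or> ereal p \<ge> p_JL_plus k \<Longrightarrow> c \<le> 1/4"
    "p_JL_minus k < p \<and> ereal p < p_JL_plus k \<Longrightarrow> c > 1/4"
proof -
  define \<alpha> where "\<alpha> = k / (p - 1)"
  define R where "R = sqrt (k * (k + 2))"
  have q: "p - 1 > k" using p by (simp add: p_s_def)
  then have \<alpha>: "0 < \<alpha>" "\<alpha> < 1" using k by (auto simp: \<alpha>_def)
  have p_eq: "p = 1 + k / \<alpha>" using k q by (simp add: \<alpha>_def)
  show "c > 0" unfolding c_def using \<alpha> q k by (simp add: \<alpha>_def[symmetric])
  have R: "R > 0" "R\<^sup>2 = k * (k + 2)" using k by (auto simp: R_def)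
  have "c = (\<alpha> + k) * (1 - \<alpha>)"
    unfolding c_def \<alpha>_def[symmetric] p_eq using \<alpha> k by (simp add: field_simps)
  also have "\<dots> = 1/4 - (\<alpha> - (1 - k + R) / 2) * (\<alpha> - (1 - k - R) / 2)"
    using R(2) by (simp add: field_simps power2_eq_square)
  finally have c: "c = 1/4 - (\<alpha> - (1 - k + R) / 2) * (\<alpha> - (1 - k - R) / 2)" .
  \<comment> \<open>The larger root must be positive to correspond to an exponent. Otherwise R \<le>
    k - 1, which forces both 4 k \<le> 1 and k > 1.\<close>
  have plus: "1 - k + R > 0"
  proof (rule ccontr)
    assume "\<not> 1 - k + R > 0"
    then have "R \<le> k - 1" by simp
    then have "R\<^sup>2 \<le> (k - 1)\<^sup>2" using R by (intro power_mono) auto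
    then have "4 * k \<le> 1" using R by (simp add: power2_eq_square algebra_simps)
    with \<open>R \<le> k - 1\<close> R show False by linarith
  qed
  \<comment> \<open>The threshold 1/4 in \<open>p_JL_plus\<close> is where the smaller root changes
    sign: R^2 < (1 - k)^2 reduces to 4 k < 1.\<close>
  have minus: "1 - k - R > 0 \<longleftrightarrow> k < 1/4"
  proof -
    have "1 - k - R > 0 \<longleftrightarrow> k < 1 \<and> R\<^sup>2 < (1 - k)\<^sup>2"
      using R(1) by (auto simp: power_strict_mono dest: power_less_imp_less_base)
    also have "\<dots> \<longleftrightarrow> k < 1/4"
      using R(2) by (auto simp: power2_eq_square algebra_simps)
    finally show ?thesis .
  qed
  have JLm: "p \<le> p_JL_minus k \<longleftrightarrow> \<alpha> \<ge> (1 - k + R) / 2"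
  proof -
    have "p \<le> p_JL_minus k \<longleftrightarrow> k / \<alpha> \<le> 2 * k / (1 - k + R)"
      by (simp add: p_eq p_JL_minus_def R_def)
    also have "\<dots> \<longleftrightarrow> \<alpha> \<ge> (1 - k + R) / 2"
      using k \<alpha> plus by (simp add: divide_simps) (auto simp: mult.commute)
    finally show ?thesis .
  qed
  have JLp: "p_JL_plus k \<le> ereal p \<longleftrightarrow> \<alpha> \<le> (1 - k - R) / 2"
  proof (cases "k < 1/4")
    case True
    then have pos: "1 - k - R > 0" using minus by simp
    have "p_JL_plus k \<le> ereal p \<longleftrightarrow> 2 * k / (1 - k - R) \<le> k / \<alpha>"
      using True by (simp add: p_eq p_JL_plus_def R_def)
    also have "\<dots> \<longleftrightarrow> \<alpha> \<le> (1 - k - R) / 2"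
      using k \<alpha> pos by (simp add: divide_simps) (auto simp: mult.commute)
    finally show ?thesis .
  next
    case False
    \<comment> \<open>The smaller root is now at most 0 < \<alpha>, so neither side holds; the
      infinite exponent encodes this.\<close>
    then show ?thesis using minus \<alpha> by (auto simp: p_JL_plus_def)
  qed
  have order: "(1 - k - R) / 2 < (1 - k + R) / 2" using R by simp
  show "c \<le> 1/4" if "p \<le> p_JL_minus k \<or> ereal p \<ge> p_JL_plus k"
  proof -
    have "0 \<le> (\<alpha> - (1 - k + R) / 2) * (\<alpha> - (1 - k - R) / 2)"
      using that order unfolding JLm JLp zero_le_mult_iff by linarith
    then show ?thesis by (simp add: c)
  qed
  show "c > 1/4" if "p_JL_minus k < p \<and> ereal p < p_JL_plus k"
  proof -
    have "\<alpha> < (1 - k + R) / 2" "\<alpha> > (1 - k - R) / 2"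
      using that JLm JLp by (auto simp: not_le[symmetric])
    then have "(\<alpha> - (1 - k + R) / 2) * (\<alpha> - (1 - k - R) / 2) < 0"
      by (intro mult_neg_pos) auto
    then show ?thesis unfolding c by linarith
  qed
qed

theorem theorem1p4:
  fixes k :: real
  assumes "k > 0"
  shows
    "(let m = morse_index k (V_weight k) exp
                (\<lambda>x :: real^2. k * ln (- ln (norm x / exp 1)))
      in (k \<le> 1/4 \<longrightarrow> m = 0) \<and> (k > 1/4 \<longrightarrow> m = \<infinity>))
     \<and>
     (\<forall>p > p_s k.
        let m = morse_index (k / (p - 1) * (1 - k / (p - 1))) (V_weight k) (\<lambda>u. (1 + u) powr p)
                  (\<lambda>x :: real^2. (- ln (norm x / exp 1)) powr (k / (p - 1)) - 1)
        in (p \<le> p_JL_minus k \<or> ereal p \<ge> p_JL_plus k \<longrightarrow> m = 0)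
         \<and> (p_JL_minus k < p \<and> ereal p < p_JL_plus k \<longrightarrow> m = \<infinity>))"
proof -
  have dim: "DIM(real^2) = 2" by simp
  have s_pos: "- ln (norm x / exp 1) > 0" if "x \<in> ball 0 1" "x \<noteq> 0" for x :: "real^2"
  proof -
    have "ln (norm x) < 0" using that by (intro ln_less_zero) auto
    then have "ln (norm x) < 1" by linarith
    then show ?thesis using that by (simp add: ln_div)
  qed
  \<comment> \<open>At the origin both sides are 0 by the convention for division by zero, so the
    identity holds on the whole ball.\<close>
  have pot_exp: "k * V_weight k (norm x) * deriv exp (k * ln (- ln (norm x / exp 1)))
      = k / ((norm x)\<^sup>2 * (1 - ln (norm x))\<^sup>2)" if x: "x \<in> ball 0 1" for x :: "real^2"
  proof (cases "x = 0")
    case False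
    have "deriv exp (k * ln (- ln (norm x / exp 1))) = exp (k * ln (- ln (norm x / exp 1)))"
      by (intro DERIV_imp_deriv DERIV_exp)
    also have "\<dots> = (- ln (norm x / exp 1)) powr k"
      using s_pos[OF x False] by (simp add: powr_def)
    finally show ?thesis
      using V_weight_powr[of "norm x" k] x by (simp add: mult.assoc)
  qed (simp add: V_weight_def)
  have part1: "let m = morse_index k (V_weight k) exp (\<lambda>x :: real^2. k * ln (- ln (norm x / exp 1)))
      in (k \<le> 1/4 \<longrightarrow> m = 0) \<and> (k > 1/4 \<longrightarrow> m = \<infinity>)"
    unfolding Let_def
  proof (intro conjI impI)
    assume "k \<le> 1/4"
    then show "morse_index k (V_weight k) exp (\<lambda>x :: real^2. k * ln (- ln (norm x / exp 1))) = 0"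
      using assms by (intro morse_index_eq_0 quadratic_form_nonneg[OF dim _ _ _ pot_exp]) auto
  next
    assume "k > 1/4"
    then show "morse_index k (V_weight k) exp (\<lambda>x :: real^2. k * ln (- ln (norm x / exp 1))) = \<infinity>"
      by (intro morse_index_eq_infinity[OF dim _ pot_exp])
  qed
  have part2: "let m = morse_index (k / (p - 1) * (1 - k / (p - 1))) (V_weight k) (\<lambda>u. (1 + u) powr p)
                  (\<lambda>x :: real^2. (- ln (norm x / exp 1)) powr (k / (p - 1)) - 1)
        in (p \<le> p_JL_minus k \<or> ereal p \<ge> p_JL_plus k \<longrightarrow> m = 0)
         \<and> (p_JL_minus k < p \<and> ereal p < p_JL_plus k \<longrightarrow> m = \<infinity>)" if p: "p > p_s k" for p
  proof -
    define \<alpha> where "\<alpha> = k / (p - 1)"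
    define c where "c = \<alpha> * (1 - \<alpha>) * p"
    note c_bounds = joseph_lundgren_exponents[OF assms p, folded \<alpha>_def, folded c_def]
    have q: "p - 1 > 0" using p assms by (simp add: p_s_def)
    have pot: "\<alpha> * (1 - \<alpha>) * V_weight k (norm x)
        * deriv (\<lambda>u. (1 + u) powr p) ((- ln (norm x / exp 1)) powr \<alpha> - 1)
        = c / ((norm x)\<^sup>2 * (1 - ln (norm x))\<^sup>2)" if x: "x \<in> ball 0 1" for x :: "real^2"
    proof (cases "x = 0")
      case False
      define s where "s = - ln (norm x / exp 1)"
      have s: "s > 0" using s_pos[OF x False] by (simp add: s_def)
      have "((\<lambda>u. (1 + u) powr p) has_real_derivative p * (1 + (s powr \<alpha> - 1)) powr (p - 1)) (at (s powr \<alpha> - 1))"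
        using s by (auto intro!: derivative_eq_intros)
      then have "deriv (\<lambda>u. (1 + u) powr p) (s powr \<alpha> - 1) = p * (s powr \<alpha>) powr (p - 1)"
        using DERIV_imp_deriv by fastforce
      \<comment> \<open>Since \<alpha> (p - 1) = k, the power nonlinearity produces the same factor
        \<open>s powr k\<close> as the exponential one.\<close>
      also have "\<dots> = p * s powr k"
        using q by (simp add: powr_powr \<alpha>_def)
      finally show ?thesis
        using V_weight_powr[of "norm x" k] x unfolding s_def c_def
        by (simp add: mult_ac)
    qed (simp add: V_weight_def)
    show ?thesis
      unfolding Let_def \<alpha>_def[symmetric]
    proof (intro conjI impI)
      assume "p \<le> p_JL_minus k \<or> ereal p \<ge> p_JL_plus k"
      then show "morse_index (\<alpha> * (1 - \<alpha>)) (V_weight k) (\<lambda>u. (1 + u) powr p)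
          (\<lambda>x :: real^2. (- ln (norm x / exp 1)) powr \<alpha> - 1) = 0"
        using c_bounds by (intro morse_index_eq_0 quadratic_form_nonneg[OF dim _ _ _ pot]) auto
    next
      assume "p_JL_minus k < p \<and> ereal p < p_JL_plus k"
      then show "morse_index (\<alpha> * (1 - \<alpha>)) (V_weight k) (\<lambda>u. (1 + u) powr p)
          (\<lambda>x :: real^2. (- ln (norm x / exp 1)) powr \<alpha> - 1) = \<infinity>"
        using c_bounds by (intro morse_index_eq_infinity[OF dim _ pot]) auto
    qed
  qed
  from part1 part2 show ?thesis by blast
qed

end
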